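(* Let $(\underline{\mathcal C},\underline x)$ be a $G$-$A$-coring with a fixed grouplike family and left dual graded ring $R$. Then $\mathbb M=(T,R,A,O,\tau,\mu)$ is a Morita context, with $\tau$ and $\mu$ defined by $$\tau:A\otimes_RO\to T,\quad\tau(a\otimes_Rq)=\sum_{\alpha\in G}q_\alpha(x_{\alpha^{-1}}a);\qquad \mu:O\otimes_TA\to R,\quad\mu(q\otimes_Ta)=q\cdot a.$$ If $\underline{\mathcal C}$ is left homogeneously finite, then the Morita contexts $\mathbb M$ and $\mathbb M'=(T',R,A,O',\tau',\mu')$ are isomorphic.
   Context: $G$ is a group with unit $e$, $A$ is a ring with unit. A $G$-$A$-coring $\underline{\mathcal C}$ is a family $(\mathcal C_\alpha)_{\alpha\in G}$ of $A$-bimodules with $A$-bimodule maps $\Delta_{\alpha,\beta}:\mathcal C_{\alpha\beta}\to\mathcal C_\alpha\otimes_A\mathcal C_\beta$, $\Delta_{\alpha,\beta}(c)=c_{(1,\alpha)}\otimes_Ac_{(2,\beta)}$, and $\varepsilon:\mathcal C_e\to A$ such that $(\Delta_{\alpha,\beta}\otimes_A\mathcal C_\gamma)\circ\Delta_{\alpha\beta,\gamma}=(\mathcal C_\alpha\otimes_A\Delta_{\beta,\gamma})\circ\Delta_{\alpha,\beta\gamma}$ and $(\mathcal C_\alpha\otimes_A\varepsilon)\circ\Delta_{\alpha,e}=\mathcal C_\alpha=(\varepsilon\otimes_A\mathcal C_\alpha)\circ\Delta_{e,\alpha}$. It is left homogeneously finite if every $\mathcal C_\alpha$ is finitely generated projective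 as a left $A$-module. A grouplike family is $\underline x=(x_\alpha)_\alpha\in\prod_\alpha\mathcal C_\alpha$ with $\Delta_{\alpha,\beta}(x_{\alpha\beta})=x_\alpha\otimes_Ax_\beta$, $\varepsilon(x_e)=1$. Left dual graded ring: $R=\bigoplus_\alpha R_\alpha$, $R_\alpha={}_A\mathrm{Hom}(\mathcal C_{\alpha^{-1}},A)$ (left $A$-linear maps), $(a\cdot f\cdot b)(c)=f(ca)b$, $(f\#g)(c)=g(c_{(1,\beta^{-1})}f(c_{(2,\alpha^{-1})}))$ for $f\in R_\alpha$, $g\in R_\beta$, $c\in\mathcal C_{(\alpha\beta)^{-1}}$, unit $\varepsilon$. Elements $q\in R$ are written $q=\sum_\alpha q_\alpha$ with $q_\alpha\in R_\alpha$. $A$ is a right $R$-module via $a\cdot f=f(x_{\beta^{-1}}a)$ for $f\in R_\beta$. $T=\{a\in A\mid ax_\alpha=x_\alpha a\ \forall\alpha\in G\}$ and $T'=\{a\in A\mid f(ax_\alpha)=f(x_\alpha a)\ \forall\alpha\in G,f\in R_{\alpha^{-1}}\}$ are subrings of $A$ acting on $A$ by left multiplication. $O=\{q\in R\mid c_{(1,\beta^{-1})}q_\alpha(c_{(2,\alpha^{-1})})=q_{\alpha\beta}(c)x_{\beta^{-1}}\ \forall\alpha,\beta\in G,c\in\mathcal C_{(\alpha\beta)^{-1}}\}$; $O'=\{q\in R\mid f(c_{(1,\beta^{-1})}q_\alpha(c_{(2,\alpha^{-1})}))=f(q_{\alpha\beta}(c)x_{\beta^{-1}})\ \forall\alpha,\beta\in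 G,f\in R_\beta,c\in\mathcal C_{(\alpha\beta)^{-1}}\}$. $O$ is an $(R,T)$-bimodule and $O'$ an $(R,T')$-bimodule, with left action by multiplication in $R$ and right action by restriction of the right $A$-action on $R$. The known Morita context $\mathbb M'$ has connecting maps $\tau':A\otimes_RO'\to T'$, $\tau'(a\otimes q)=\sum_\alpha q_\alpha(x_{\alpha^{-1}}a)$, and $\mu':O'\otimes_{T'}A\to R$, $\mu'(q\otimes a)=q\cdot a$. A Morita context $(S,R,P,Q,\varphi,\psi)$ consists of rings $S,R$, bimodules ${}_SP_R$, ${}_RQ_S$, and bimodule maps $\varphi:P\otimes_RQ\to S$, $\psi:Q\otimes_SP\to R$ with $\varphi(p\otimes q)p'=p\psi(q\otimes p')$, $\psi(q\otimes p)q'=q\varphi(p\otimes q')$; isomorphisms are ring isomorphisms and compatible bimodule isomorphisms commuting with the connecting maps. *)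

theory Defs
  imports "HOL-Algebra.Algebra"
begin

section \<open>Modules and bimodules over noncommutative rings\<close>

text \<open>The library record \<open>module\<close> is reused for its additive structure and its left action; its
  \<open>mult\<close> and \<open>one\<close> fields play no role. The library locale \<open>module\<close> cannot be used, since
  it requires a commutative base ring.\<close>

record ('s, 'r, 'm) bimodule = "('s, 'm) module" +
  rsmult :: "['m, 'r] \<Rightarrow> 'm" (infixl \<open>\<triangleleft>\<index>\<close> 70)

locale left_module = S?: ring S + M?: abelian_group M
  for S :: "('s, 'x) ring_scheme" and M :: "('s, 'm, 'z) module_scheme" +
  assumes lsmult_closed:
      "\<lbrakk>s \<in> carrier S; m \<in> carrier M\<rbrakk> \<Longrightarrow> s \<odot>\<^bsub>M\<^esub> m \<in> carrier M"
    and lsmult_l_distr: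
      "\<lbrakk>s \<in> carrier S; t \<in> carrier S; m \<in> carrier M\<rbrakk> \<Longrightarrow>
        (s \<oplus>\<^bsub>S\<^esub> t) \<odot>\<^bsub>M\<^esub> m = s \<odot>\<^bsub>M\<^esub> m \<oplus>\<^bsub>M\<^esub> t \<odot>\<^bsub>M\<^esub> m"
    and lsmult_r_distr:
      "\<lbrakk>s \<in> carrier S; m \<in> carrier M; n \<in> carrier M\<rbrakk> \<Longrightarrow>
        s \<odot>\<^bsub>M\<^esub> (m \<oplus>\<^bsub>M\<^esub> n) = s \<odot>\<^bsub>M\<^esub> m \<oplus>\<^bsub>M\<^esub> s \<odot>\<^bsub>M\<^esub> n"
    and lsmult_assoc:
      "\<lbrakk>s \<in> carrier S; t \<in> carrier S; m \<in> carrier M\<rbrakk> \<Longrightarrow>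
        (s \<otimes>\<^bsub>S\<^esub> t) \<odot>\<^bsub>M\<^esub> m = s \<odot>\<^bsub>M\<^esub> (t \<odot>\<^bsub>M\<^esub> m)"
    and lsmult_one: "m \<in> carrier M \<Longrightarrow> \<one>\<^bsub>S\<^esub> \<odot>\<^bsub>M\<^esub> m = m"

locale right_module = R?: ring R + M?: abelian_group M
  for R :: "('r, 'x) ring_scheme" and M :: "('s, 'r, 'm, 'z) bimodule_scheme" +
  assumes rsmult_closed:
      "\<lbrakk>m \<in> carrier M; r \<in> carrier R\<rbrakk> \<Longrightarrow> m \<triangleleft>\<^bsub>M\<^esub> r \<in> carrier M"
    and rsmult_l_distr:
      "\<lbrakk>m \<in> carrier M; n \<in> carrier M; r \<in> carrier R\<rbrakk> \<Longrightarrow>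
        (m \<oplus>\<^bsub>M\<^esub> n) \<triangleleft>\<^bsub>M\<^esub> r = m \<triangleleft>\<^bsub>M\<^esub> r \<oplus>\<^bsub>M\<^esub> n \<triangleleft>\<^bsub>M\<^esub> r"
    and rsmult_r_distr:
      "\<lbrakk>m \<in> carrier M; r \<in> carrier R; t \<in> carrier R\<rbrakk> \<Longrightarrow>
        m \<triangleleft>\<^bsub>M\<^esub> (r \<oplus>\<^bsub>R\<^esub> t) = m \<triangleleft>\<^bsub>M\<^esub> r \<oplus>\<^bsub>M\<^esub> m \<triangleleft>\<^bsub>M\<^esub> t"
    and rsmult_assoc:
      "\<lbrakk>m \<in> carrier M; r \<in> carrier R; t \<in> carrier R\<rbrakk> \<Longrightarrow>
        m \<triangleleft>\<^bsub>M\<^esub> (r \<otimes>\<^bsub>R\<^esub> t) = (m \<triangleleft>\<^bsub>M\<^esub> r) \<triangleleft>\<^bsub>M\<^esub> t"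
    and rsmult_one: "m \<in> carrier M \<Longrightarrow> m \<triangleleft>\<^bsub>M\<^esub> \<one>\<^bsub>R\<^esub> = m"

locale bimodule = left_module S M + right_module R M
  for S :: "('s, 'x) ring_scheme" and R :: "('r, 'y) ring_scheme"
    and M :: "('s, 'r, 'm, 'z) bimodule_scheme" +
  assumes bismult_assoc:
    "\<lbrakk>s \<in> carrier S; m \<in> carrier M; r \<in> carrier R\<rbrakk> \<Longrightarrow>
      (s \<odot>\<^bsub>M\<^esub> m) \<triangleleft>\<^bsub>M\<^esub> r = s \<odot>\<^bsub>M\<^esub> (m \<triangleleft>\<^bsub>M\<^esub> r)"

definition regular_bimodule :: "('a, 'x) ring_scheme \<Rightarrow> ('a, 'a, 'a) bimodule" where
  "regular_bimodule A = \<lparr>carrier = carrier A, monoid.mult = monoid.mult A, one = \<one>\<^bsub>A\<^esub>,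
     ring.zero = \<zero>\<^bsub>A\<^esub>, ring.add = ring.add A, smult = monoid.mult A, rsmult = monoid.mult A\<rparr>"

definition left_linear ::
  "('s, 'x) ring_scheme \<Rightarrow> ('s, 'm, 'y) module_scheme \<Rightarrow> ('s, 'n, 'z) module_scheme \<Rightarrow> ('m \<Rightarrow> 'n) set"
  where
  "left_linear S M N = {f \<in> carrier M \<rightarrow> carrier N.
     (\<forall>m\<in>carrier M. \<forall>m'\<in>carrier M. f (m \<oplus>\<^bsub>M\<^esub> m') = f m \<oplus>\<^bsub>N\<^esub> f m') \<and>
     (\<forall>s\<in>carrier S. \<forall>m\<in>carrier M. f (s \<odot>\<^bsub>M\<^esub> m) = s \<odot>\<^bsub>N\<^esub> f m)}"

definition bimodule_hom ::
  "('s, 'x) ring_scheme \<Rightarrow> ('r, 'y) ring_scheme \<Rightarrow> ('s, 'r, 'm, 'z) bimodule_scheme \<Rightarrow>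
   ('s, 'r, 'n, 'w) bimodule_scheme \<Rightarrow> ('m \<Rightarrow> 'n) set" where
  "bimodule_hom S R M N = {f \<in> left_linear S M N.
     \<forall>m\<in>carrier M. \<forall>r\<in>carrier R. f (m \<triangleleft>\<^bsub>M\<^esub> r) = f m \<triangleleft>\<^bsub>N\<^esub> r}"


subsection \<open>Finitely generated projective left modules\<close>

definition left_finitely_generated ::
  "('s, 'x) ring_scheme \<Rightarrow> ('s, 'm, 'y) module_scheme \<Rightarrow> bool" where
  "left_finitely_generated S M \<longleftrightarrow>
     (\<exists>B. finite B \<and> B \<subseteq> carrier M \<and>
        (\<forall>m\<in>carrier M. \<exists>k\<in>B \<rightarrow> carrier S. m = (\<Oplus>\<^bsub>M\<^esub>x\<in>B. k x \<odot>\<^bsub>M\<^esub> x)))"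

definition free_left_module ::
  "('s, 'x) ring_scheme \<Rightarrow> 'i set \<Rightarrow> ('s, 'i \<Rightarrow> 's) module" where
  "free_left_module S I = \<lparr>carrier = {v \<in> I \<rightarrow>\<^sub>E carrier S. finite {i \<in> I. v i \<noteq> \<zero>\<^bsub>S\<^esub>}},
     monoid.mult = undefined, one = undefined,
     ring.zero = (\<lambda>i\<in>I. \<zero>\<^bsub>S\<^esub>), ring.add = (\<lambda>v w. \<lambda>i\<in>I. v i \<oplus>\<^bsub>S\<^esub> w i),
     smult = (\<lambda>s v. \<lambda>i\<in>I. s \<otimes>\<^bsub>S\<^esub> v i)\<rparr>"

definition left_submodule ::
  "('s, 'x) ring_scheme \<Rightarrow> ('s, 'm, 'y) module_scheme \<Rightarrow> 'm set \<Rightarrow> bool" where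
  "left_submodule S M U \<longleftrightarrow> additive_subgroup U M \<and>
     (\<forall>s\<in>carrier S. \<forall>u\<in>U. s \<odot>\<^bsub>M\<^esub> u \<in> U)"

text \<open>Projective means isomorphic to a direct summand of a free module. Restricting to free modules
  on subsets \<open>I\<close> of the type underlying \<open>M\<close> is no loss of generality: a projective module \<open>M\<close>
  is a direct summand of the free module on the set \<open>carrier M\<close>.\<close>

definition left_projective ::
  "('s, 'x) ring_scheme \<Rightarrow> ('s, 'm, 'y) module_scheme \<Rightarrow> bool" where
  "left_projective S M \<longleftrightarrow>
     (\<exists>(I :: 'm set) U V j. left_submodule S (free_left_module S I) U \<and>
        left_submodule S (free_left_module S I) V \<and>
        U \<inter> V = {\<zero>\<^bsub>free_left_module S I\<^esub>} \<and>
        U <+>\<^bsub>free_left_module S I\<^esub> V = carrier (free_left_module S I) \<and>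
        j \<in> left_linear S M (free_left_module S I) \<and> bij_betw j (carrier M) U)"


section \<open>Tensor products\<close>

text \<open>\<open>M \<otimes>\<^sub>A N\<close> is the quotient of the free abelian group on \<open>carrier M \<times> carrier N\<close> by the subgroup
  generated by the usual relations; its elements are cosets. The additive group of
  \<open>free_Abelian_group\<close> is written multiplicatively.\<close>

definition tensor_relators ::
  "('a, 'x) ring_scheme \<Rightarrow> ('s, 'a, 'm, 'y) bimodule_scheme \<Rightarrow> ('a, 't, 'n, 'z) bimodule_scheme \<Rightarrow>
   ('m \<times> 'n \<Rightarrow>\<^sub>0 int) set" where
  "tensor_relators A M N =
     {frag_of (m \<oplus>\<^bsub>M\<^esub> m', n) - frag_of (m, n) - frag_of (m', n) | m m' n.
        m \<in> carrier M \<and> m' \<in> carrier M \<and> n \<in> carrier N} \<union>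
     {frag_of (m, n \<oplus>\<^bsub>N\<^esub> n') - frag_of (m, n) - frag_of (m, n') | m n n'.
        m \<in> carrier M \<and> n \<in> carrier N \<and> n' \<in> carrier N} \<union>
     {frag_of (m \<triangleleft>\<^bsub>M\<^esub> a, n) - frag_of (m, a \<odot>\<^bsub>N\<^esub> n) | m a n.
        m \<in> carrier M \<and> a \<in> carrier A \<and> n \<in> carrier N}"

definition tensor_kernel ::
  "('a, 'x) ring_scheme \<Rightarrow> ('s, 'a, 'm, 'y) bimodule_scheme \<Rightarrow> ('a, 't, 'n, 'z) bimodule_scheme \<Rightarrow>
   ('m \<times> 'n \<Rightarrow>\<^sub>0 int) set" where
  "tensor_kernel A M N =
     generate (free_Abelian_group (carrier M \<times> carrier N)) (tensor_relators A M N)"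

definition tensor_class ::
  "('a, 'x) ring_scheme \<Rightarrow> ('s, 'a, 'm, 'y) bimodule_scheme \<Rightarrow> ('a, 't, 'n, 'z) bimodule_scheme \<Rightarrow>
   ('m \<times> 'n \<Rightarrow>\<^sub>0 int) \<Rightarrow> ('m \<times> 'n \<Rightarrow>\<^sub>0 int) set" where
  "tensor_class A M N t =
     tensor_kernel A M N #>\<^bsub>free_Abelian_group (carrier M \<times> carrier N)\<^esub> t"

definition pure_tensor ::
  "('a, 'x) ring_scheme \<Rightarrow> ('s, 'a, 'm, 'y) bimodule_scheme \<Rightarrow> ('a, 't, 'n, 'z) bimodule_scheme \<Rightarrow>
   'm \<Rightarrow> 'n \<Rightarrow> ('m \<times> 'n \<Rightarrow>\<^sub>0 int) set" where
  "pure_tensor A M N m n = tensor_class A M N (frag_of (m, n))"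

text \<open>The outer actions are \<open>s (m \<otimes> n) = (s m) \<otimes> n\<close> and \<open>(m \<otimes> n) t = m \<otimes> (n t)\<close>. In both, the
  union over the representatives of a class is a union of equal classes.\<close>

definition tensor ::
  "('a, 'x) ring_scheme \<Rightarrow> ('s, 'a, 'm, 'y) bimodule_scheme \<Rightarrow> ('a, 't, 'n, 'z) bimodule_scheme \<Rightarrow>
   ('s, 't, ('m \<times> 'n \<Rightarrow>\<^sub>0 int) set) bimodule" where
  "tensor A M N =
     (let Q = free_Abelian_group (carrier M \<times> carrier N) Mod tensor_kernel A M N in
      \<lparr>carrier = carrier Q, monoid.mult = undefined, one = undefined,
       ring.zero = \<one>\<^bsub>Q\<^esub>, ring.add = monoid.mult Q,
       smult = (\<lambda>s Z. \<Union>t\<in>Z. tensor_class A M N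
                  (frag_extend (\<lambda>(m, n). frag_of (s \<odot>\<^bsub>M\<^esub> m, n)) t)),
       rsmult = (\<lambda>Z r. \<Union>t\<in>Z. tensor_class A M N
                  (frag_extend (\<lambda>(m, n). frag_of (m, n \<triangleleft>\<^bsub>N\<^esub> r)) t))\<rparr>)"

text \<open>For a biadditive \<open>A\<close>-balanced map \<open>f\<close> into an abelian group \<open>L\<close>, \<open>tensor_lift L f\<close> is the
  induced additive map with \<open>m \<otimes> n \<mapsto> f m n\<close>; the choice of the representative is then irrelevant.\<close>

definition tensor_lift ::
  "('l, 'x) ring_scheme \<Rightarrow> ('m \<Rightarrow> 'n \<Rightarrow> 'l) \<Rightarrow> ('m \<times> 'n \<Rightarrow>\<^sub>0 int) set \<Rightarrow> 'l" where
  "tensor_lift L f Z =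
     (let t = (SOME t. t \<in> Z) in
      \<Oplus>\<^bsub>L\<^esub>p\<in>Poly_Mapping.keys t. [Poly_Mapping.lookup t p] \<cdot>\<^bsub>L\<^esub> f (fst p) (snd p))"

text \<open>\<open>g \<otimes> h\<close>, with values in \<open>M' \<otimes>\<^sub>A N'\<close>.\<close>

definition tensor_map ::
  "('a, 'x) ring_scheme \<Rightarrow> ('s, 'a, 'm2, 'y) bimodule_scheme \<Rightarrow> ('a, 't, 'n2, 'z) bimodule_scheme \<Rightarrow>
   ('m \<Rightarrow> 'm2) \<Rightarrow> ('n \<Rightarrow> 'n2) \<Rightarrow> ('m \<times> 'n \<Rightarrow>\<^sub>0 int) set \<Rightarrow> ('m2 \<times> 'n2 \<Rightarrow>\<^sub>0 int) set" where
  "tensor_map A M' N' g h =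
     tensor_lift (tensor A M' N') (\<lambda>m n. pure_tensor A M' N' (g m) (h n))"

text \<open>The canonical isomorphism \<open>(L \<otimes> M) \<otimes> N \<rightarrow> L \<otimes> (M \<otimes> N)\<close>, followed by
  \<open>M \<otimes> A \<rightarrow> M\<close> and \<open>A \<otimes> M \<rightarrow> M\<close>.\<close>

definition tensor_assoc ::
  "('a, 'x) ring_scheme \<Rightarrow> ('s, 'a, 'l, 'y) bimodule_scheme \<Rightarrow> ('a, 'a, 'm, 'z) bimodule_scheme \<Rightarrow>
   ('a, 't, 'n, 'w) bimodule_scheme \<Rightarrow> (('l \<times> 'm \<Rightarrow>\<^sub>0 int) set \<times> 'n \<Rightarrow>\<^sub>0 int) set \<Rightarrow>
   ('l \<times> ('m \<times> 'n \<Rightarrow>\<^sub>0 int) set \<Rightarrow>\<^sub>0 int) set" where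
  "tensor_assoc A L M N =
     (let MN = tensor A M N; LMN = tensor A L MN in
      tensor_lift LMN
        (\<lambda>t n. tensor_lift LMN (\<lambda>l m. pure_tensor A L MN l (pure_tensor A M N m n)) t))"

definition tensor_runit ::
  "('s, 'a, 'm, 'x) bimodule_scheme \<Rightarrow> ('m \<times> 'a \<Rightarrow>\<^sub>0 int) set \<Rightarrow> 'm" where
  "tensor_runit M = tensor_lift M (\<lambda>m a. m \<triangleleft>\<^bsub>M\<^esub> a)"

definition tensor_lunit ::
  "('a, 't, 'm, 'x) bimodule_scheme \<Rightarrow> ('a \<times> 'm \<Rightarrow>\<^sub>0 int) set \<Rightarrow> 'm" where
  "tensor_lunit M = tensor_lift M (\<lambda>a m. a \<odot>\<^bsub>M\<^esub> m)"


section \<open>Morita contexts\<close>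

record ('s, 'r, 'p, 'q) morita_data =
  ringS :: "'s ring"
  ringR :: "'r ring"
  modP :: "('s, 'r, 'p) bimodule"
  modQ :: "('r, 's, 'q) bimodule"
  connPQ :: "('p \<times> 'q \<Rightarrow>\<^sub>0 int) set \<Rightarrow> 's"
  connQP :: "('q \<times> 'p \<Rightarrow>\<^sub>0 int) set \<Rightarrow> 'r"

definition morita_context :: "('s, 'r, 'p, 'q) morita_data \<Rightarrow> bool" where
  "morita_context M \<longleftrightarrow>
     (let S = ringS M; R = ringR M; P = modP M; Q = modQ M; \<phi> = connPQ M; \<psi> = connQP M in
      ring S \<and> ring R \<and> bimodule S R P \<and> bimodule R S Q \<and>
      \<phi> \<in> bimodule_hom S S (tensor R P Q) (regular_bimodule S) \<and>
      \<psi> \<in> bimodule_hom R R (tensor S Q P) (regular_bimodule R) \<and>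
      (\<forall>p\<in>carrier P. \<forall>q\<in>carrier Q. \<forall>p'\<in>carrier P.
         \<phi> (pure_tensor R P Q p q) \<odot>\<^bsub>P\<^esub> p' = p \<triangleleft>\<^bsub>P\<^esub> \<psi> (pure_tensor S Q P q p')) \<and>
      (\<forall>q\<in>carrier Q. \<forall>p\<in>carrier P. \<forall>q'\<in>carrier Q.
         \<psi> (pure_tensor S Q P q p) \<odot>\<^bsub>Q\<^esub> q' = q \<triangleleft>\<^bsub>Q\<^esub> \<phi> (pure_tensor R P Q p q')))"

text \<open>Isomorphism of bimodules along ring isomorphisms \<open>\<sigma>\<close> and \<open>\<rho>\<close> of the two base rings.\<close>

definition bimodule_iso_over ::
  "('s, 'w) ring_scheme \<Rightarrow> ('r, 'x) ring_scheme \<Rightarrow> ('s \<Rightarrow> 's2) \<Rightarrow> ('r \<Rightarrow> 'r2) \<Rightarrow>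
   ('s, 'r, 'm, 'y) bimodule_scheme \<Rightarrow> ('s2, 'r2, 'n, 'z) bimodule_scheme \<Rightarrow> ('m \<Rightarrow> 'n) set" where
  "bimodule_iso_over S R \<sigma> \<rho> M N = {u. bij_betw u (carrier M) (carrier N) \<and>
     (\<forall>m\<in>carrier M. \<forall>m'\<in>carrier M. u (m \<oplus>\<^bsub>M\<^esub> m') = u m \<oplus>\<^bsub>N\<^esub> u m') \<and>
     (\<forall>s\<in>carrier S. \<forall>m\<in>carrier M. u (s \<odot>\<^bsub>M\<^esub> m) = \<sigma> s \<odot>\<^bsub>N\<^esub> u m) \<and>
     (\<forall>m\<in>carrier M. \<forall>r\<in>carrier R. u (m \<triangleleft>\<^bsub>M\<^esub> r) = u m \<triangleleft>\<^bsub>N\<^esub> \<rho> r)}"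

definition morita_isomorphic ::
  "('s, 'r, 'p, 'q) morita_data \<Rightarrow> ('s2, 'r2, 'p2, 'q2) morita_data \<Rightarrow> bool" where
  "morita_isomorphic K L \<longleftrightarrow> morita_context K \<and> morita_context L \<and>
     (\<exists>\<sigma> \<rho> u v.
        \<sigma> \<in> ring_iso (ringS K) (ringS L) \<and>
        \<rho> \<in> ring_iso (ringR K) (ringR L) \<and>
        u \<in> bimodule_iso_over (ringS K) (ringR K) \<sigma> \<rho> (modP K) (modP L) \<and>
        v \<in> bimodule_iso_over (ringR K) (ringS K) \<rho> \<sigma> (modQ K) (modQ L) \<and>
        (\<forall>t\<in>carrier (tensor (ringR K) (modP K) (modQ K)).
           \<sigma> (connPQ K t) = connPQ L (tensor_map (ringR L) (modP L) (modQ L) u v t)) \<and>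
        (\<forall>t\<in>carrier (tensor (ringS K) (modQ K) (modP K)).
           \<rho> (connQP K t) = connQP L (tensor_map (ringS L) (modQ L) (modP L) v u t)))"


section \<open>Group corings and grouplike families\<close>

text \<open>The bimodules \<open>C \<alpha>\<close> share one underlying type but have unrelated carriers and operations;
  \<open>C\<close>, \<open>\<Delta>\<close>, \<open>\<epsilon>\<close> and \<open>x\<close> are only relevant for indices in \<open>carrier G\<close> and arguments in
  the carriers.\<close>

locale group_coring = G: group G + A: ring A
  for G :: "'g monoid" and A :: "'a ring" +
  fixes C :: "'g \<Rightarrow> ('a, 'a, 'c) bimodule"
    and \<Delta> :: "'g \<Rightarrow> 'g \<Rightarrow> 'c \<Rightarrow> ('c \<times> 'c \<Rightarrow>\<^sub>0 int) set"
    and \<epsilon> :: "'c \<Rightarrow> 'a"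
  assumes bimodule_C: "\<alpha> \<in> carrier G \<Longrightarrow> bimodule A A (C \<alpha>)"
    and comult_hom:
      "\<lbrakk>\<alpha> \<in> carrier G; \<beta> \<in> carrier G\<rbrakk> \<Longrightarrow>
        \<Delta> \<alpha> \<beta> \<in> bimodule_hom A A (C (\<alpha> \<otimes>\<^bsub>G\<^esub> \<beta>)) (tensor A (C \<alpha>) (C \<beta>))"
    and counit_hom: "\<epsilon> \<in> bimodule_hom A A (C \<one>\<^bsub>G\<^esub>) (regular_bimodule A)"
    and coassoc:
      "\<lbrakk>\<alpha> \<in> carrier G; \<beta> \<in> carrier G; \<gamma> \<in> carrier G; c \<in> carrier (C (\<alpha> \<otimes>\<^bsub>G\<^esub> \<beta> \<otimes>\<^bsub>G\<^esub> \<gamma>))\<rbrakk> \<Longrightarrow>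
        tensor_assoc A (C \<alpha>) (C \<beta>) (C \<gamma>)
          (tensor_map A (tensor A (C \<alpha>) (C \<beta>)) (C \<gamma>) (\<Delta> \<alpha> \<beta>) id (\<Delta> (\<alpha> \<otimes>\<^bsub>G\<^esub> \<beta>) \<gamma> c)) =
        tensor_map A (C \<alpha>) (tensor A (C \<beta>) (C \<gamma>)) id (\<Delta> \<beta> \<gamma>) (\<Delta> \<alpha> (\<beta> \<otimes>\<^bsub>G\<^esub> \<gamma>) c)"
    and counit_right:
      "\<lbrakk>\<alpha> \<in> carrier G; c \<in> carrier (C \<alpha>)\<rbrakk> \<Longrightarrow>
        tensor_runit (C \<alpha>) (tensor_map A (C \<alpha>) (regular_bimodule A) id \<epsilon> (\<Delta> \<alpha> \<one>\<^bsub>G\<^esub> c)) = c"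
    and counit_left:
      "\<lbrakk>\<alpha> \<in> carrier G; c \<in> carrier (C \<alpha>)\<rbrakk> \<Longrightarrow>
        tensor_lunit (C \<alpha>) (tensor_map A (regular_bimodule A) (C \<alpha>) \<epsilon> id (\<Delta> \<one>\<^bsub>G\<^esub> \<alpha> c)) = c"
begin

definition left_homogeneously_finite :: bool where
  "left_homogeneously_finite \<longleftrightarrow>
     (\<forall>\<alpha>\<in>carrier G. left_finitely_generated A (C \<alpha>) \<and> left_projective A (C \<alpha>))"

text \<open>\<open>R\<^sub>\<alpha>\<close>; maps are made extensional so that equality of functions is equality of maps.\<close>

definition dual_component :: "'g \<Rightarrow> ('c \<Rightarrow> 'a) set" where
  "dual_component \<alpha> = left_linear A (C (inv\<^bsub>G\<^esub> \<alpha>)) (regular_bimodule A) \<inter>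
     extensional (carrier (C (inv\<^bsub>G\<^esub> \<alpha>)))"

definition dual_zero :: "'g \<Rightarrow> 'c \<Rightarrow> 'a" where
  "dual_zero \<alpha> = (\<lambda>c\<in>carrier (C (inv\<^bsub>G\<^esub> \<alpha>)). \<zero>\<^bsub>A\<^esub>)"

definition dual_supp :: "('g \<Rightarrow> 'c \<Rightarrow> 'a) \<Rightarrow> 'g set" where
  "dual_supp q = {\<alpha> \<in> carrier G. q \<alpha> \<noteq> dual_zero \<alpha>}"

text \<open>\<open>c\<^sub>(\<^sub>1\<^sub>,\<^sub>\<gamma>\<^sub>) f(c\<^sub>(\<^sub>2\<^sub>,\<^sub>\<delta>\<^sub>))\<close>, an element of \<open>C\<^sub>\<gamma>\<close>, for left linear \<open>f : C\<^sub>\<delta> \<rightarrow> A\<close> and \<open>c\<close> in \<open>C\<^sub>\<gamma>\<^sub>\<delta>\<close>.\<close>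

definition comult_apply :: "'g \<Rightarrow> 'g \<Rightarrow> ('c \<Rightarrow> 'a) \<Rightarrow> 'c \<Rightarrow> 'c" where
  "comult_apply \<gamma> \<delta> f c =
     tensor_lift (C \<gamma>) (\<lambda>c1 c2. c1 \<triangleleft>\<^bsub>C \<gamma>\<^esub> f c2) (\<Delta> \<gamma> \<delta> c)"

text \<open>The product \<open>f # g\<close> of homogeneous elements \<open>f\<close> of degree \<open>\<alpha>\<close> and \<open>g\<close> of degree \<open>\<beta>\<close>.\<close>

definition dual_hmult :: "'g \<Rightarrow> 'g \<Rightarrow> ('c \<Rightarrow> 'a) \<Rightarrow> ('c \<Rightarrow> 'a) \<Rightarrow> 'c \<Rightarrow> 'a" where
  "dual_hmult \<alpha> \<beta> f g = (\<lambda>c\<in>carrier (C (inv\<^bsub>G\<^esub> (\<alpha> \<otimes>\<^bsub>G\<^esub> \<beta>))).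
     g (comult_apply (inv\<^bsub>G\<^esub> \<beta>) (inv\<^bsub>G\<^esub> \<alpha>) f c))"

text \<open>An element \<open>q\<close> of the direct sum \<open>R\<close> is the family of its components \<open>q\<^sub>\<alpha> = q \<alpha>\<close>.\<close>

definition dual_ring :: "('g \<Rightarrow> 'c \<Rightarrow> 'a) ring" where
  "dual_ring =
     \<lparr>carrier = {q \<in> Pi\<^sub>E (carrier G) dual_component. finite (dual_supp q)},
      monoid.mult = (\<lambda>q r. \<lambda>\<gamma>\<in>carrier G. \<lambda>c\<in>carrier (C (inv\<^bsub>G\<^esub> \<gamma>)).
        \<Oplus>\<^bsub>A\<^esub>p\<in>{(\<alpha>, \<beta>) \<in> dual_supp q \<times> dual_supp r. \<alpha> \<otimes>\<^bsub>G\<^esub> \<beta> = \<gamma>}.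
          dual_hmult (fst p) (snd p) (q (fst p)) (r (snd p)) c),
      one = (\<lambda>\<alpha>\<in>carrier G.
        if \<alpha> = \<one>\<^bsub>G\<^esub> then restrict \<epsilon> (carrier (C \<one>\<^bsub>G\<^esub>)) else dual_zero \<alpha>),
      ring.zero = (\<lambda>\<alpha>\<in>carrier G. dual_zero \<alpha>),
      ring.add = (\<lambda>q r. \<lambda>\<alpha>\<in>carrier G. \<lambda>c\<in>carrier (C (inv\<^bsub>G\<^esub> \<alpha>)). q \<alpha> c \<oplus>\<^bsub>A\<^esub> r \<alpha> c)\<rparr>"

text \<open>The right \<open>A\<close>-action on \<open>R\<close>, \<open>(f \<cdot> b)(c) = f(c) b\<close>.\<close>

definition dual_rsmult :: "('g \<Rightarrow> 'c \<Rightarrow> 'a) \<Rightarrow> 'a \<Rightarrow> ('g \<Rightarrow> 'c \<Rightarrow> 'a)" where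
  "dual_rsmult q b = (\<lambda>\<alpha>\<in>carrier G. \<lambda>c\<in>carrier (C (inv\<^bsub>G\<^esub> \<alpha>)). q \<alpha> c \<otimes>\<^bsub>A\<^esub> b)"

end

locale grouplike_coring = group_coring G A C \<Delta> \<epsilon>
  for G :: "'g monoid" and A :: "'a ring" and C :: "'g \<Rightarrow> ('a, 'a, 'c) bimodule"
    and \<Delta> :: "'g \<Rightarrow> 'g \<Rightarrow> 'c \<Rightarrow> ('c \<times> 'c \<Rightarrow>\<^sub>0 int) set" and \<epsilon> :: "'c \<Rightarrow> 'a" +
  fixes x :: "'g \<Rightarrow> 'c"
  assumes grouplike_closed: "\<alpha> \<in> carrier G \<Longrightarrow> x \<alpha> \<in> carrier (C \<alpha>)"
    and grouplike_comult:
      "\<lbrakk>\<alpha> \<in> carrier G; \<beta> \<in> carrier G\<rbrakk> \<Longrightarrow>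
        \<Delta> \<alpha> \<beta> (x (\<alpha> \<otimes>\<^bsub>G\<^esub> \<beta>)) = pure_tensor A (C \<alpha>) (C \<beta>) (x \<alpha>) (x \<beta>)"
    and grouplike_counit: "\<epsilon> (x \<one>\<^bsub>G\<^esub>) = \<one>\<^bsub>A\<^esub>"
begin

text \<open>\<open>\<Sum>\<^sub>\<alpha> q\<^sub>\<alpha>(x\<^bsub>\<alpha>\<^sup>-\<^sup>1\<^esub> a)\<close>. This is both the right action of \<open>R\<close> on \<open>A\<close>, extended additively from
  homogeneous elements, and the value of the first connecting map at \<open>a \<otimes> q\<close>.\<close>

definition grouplike_eval :: "'a \<Rightarrow> ('g \<Rightarrow> 'c \<Rightarrow> 'a) \<Rightarrow> 'a" where
  "grouplike_eval a q =
     (\<Oplus>\<^bsub>A\<^esub>\<alpha>\<in>dual_supp q. q \<alpha> (x (inv\<^bsub>G\<^esub> \<alpha>) \<triangleleft>\<^bsub>C (inv\<^bsub>G\<^esub> \<alpha>)\<^esub> a))"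

definition T_set :: "'a set" where
  "T_set = {a \<in> carrier A. \<forall>\<alpha>\<in>carrier G. a \<odot>\<^bsub>C \<alpha>\<^esub> x \<alpha> = x \<alpha> \<triangleleft>\<^bsub>C \<alpha>\<^esub> a}"

definition T'_set :: "'a set" where
  "T'_set = {a \<in> carrier A. \<forall>\<alpha>\<in>carrier G. \<forall>f\<in>dual_component (inv\<^bsub>G\<^esub> \<alpha>).
     f (a \<odot>\<^bsub>C \<alpha>\<^esub> x \<alpha>) = f (x \<alpha> \<triangleleft>\<^bsub>C \<alpha>\<^esub> a)}"

definition O_set :: "('g \<Rightarrow> 'c \<Rightarrow> 'a) set" where
  "O_set = {q \<in> carrier dual_ring.
     \<forall>\<alpha>\<in>carrier G. \<forall>\<beta>\<in>carrier G. \<forall>c\<in>carrier (C (inv\<^bsub>G\<^esub> (\<alpha> \<otimes>\<^bsub>G\<^esub> \<beta>))).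
       comult_apply (inv\<^bsub>G\<^esub> \<beta>) (inv\<^bsub>G\<^esub> \<alpha>) (q \<alpha>) c =
       q (\<alpha> \<otimes>\<^bsub>G\<^esub> \<beta>) c \<odot>\<^bsub>C (inv\<^bsub>G\<^esub> \<beta>)\<^esub> x (inv\<^bsub>G\<^esub> \<beta>)}"

definition O'_set :: "('g \<Rightarrow> 'c \<Rightarrow> 'a) set" where
  "O'_set = {q \<in> carrier dual_ring.
     \<forall>\<alpha>\<in>carrier G. \<forall>\<beta>\<in>carrier G. \<forall>f\<in>dual_component \<beta>. \<forall>c\<in>carrier (C (inv\<^bsub>G\<^esub> (\<alpha> \<otimes>\<^bsub>G\<^esub> \<beta>))).
       f (comult_apply (inv\<^bsub>G\<^esub> \<beta>) (inv\<^bsub>G\<^esub> \<alpha>) (q \<alpha>) c) =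
       f (q (\<alpha> \<otimes>\<^bsub>G\<^esub> \<beta>) c \<odot>\<^bsub>C (inv\<^bsub>G\<^esub> \<beta>)\<^esub> x (inv\<^bsub>G\<^esub> \<beta>))}"

text \<open>The rings \<open>T\<close> and \<open>T'\<close> differ only in their carriers and so do the bimodules \<open>O\<close> and \<open>O'\<close>;
  \<open>A_bimodule\<close> carries the left and right actions of every subring of \<open>A\<close> and of \<open>R\<close>.\<close>

definition A_bimodule :: "('a, 'g \<Rightarrow> 'c \<Rightarrow> 'a, 'a) bimodule" where
  "A_bimodule = \<lparr>carrier = carrier A, monoid.mult = monoid.mult A, one = \<one>\<^bsub>A\<^esub>,
     ring.zero = \<zero>\<^bsub>A\<^esub>, ring.add = ring.add A, smult = monoid.mult A, rsmult = grouplike_eval\<rparr>"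

definition sub_bimodule ::
  "('g \<Rightarrow> 'c \<Rightarrow> 'a) set \<Rightarrow> ('g \<Rightarrow> 'c \<Rightarrow> 'a, 'a, 'g \<Rightarrow> 'c \<Rightarrow> 'a) bimodule" where
  "sub_bimodule U = \<lparr>carrier = U, monoid.mult = monoid.mult dual_ring, one = \<one>\<^bsub>dual_ring\<^esub>,
     ring.zero = \<zero>\<^bsub>dual_ring\<^esub>, ring.add = ring.add dual_ring, smult = monoid.mult dual_ring, rsmult = dual_rsmult\<rparr>"

definition T_ring :: "'a ring" where "T_ring = A\<lparr>carrier := T_set\<rparr>"
definition T'_ring :: "'a ring" where "T'_ring = A\<lparr>carrier := T'_set\<rparr>"

definition \<tau> :: "('a \<times> ('g \<Rightarrow> 'c \<Rightarrow> 'a) \<Rightarrow>\<^sub>0 int) set \<Rightarrow> 'a" where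
  "\<tau> = tensor_lift T_ring grouplike_eval"

definition \<tau>' :: "('a \<times> ('g \<Rightarrow> 'c \<Rightarrow> 'a) \<Rightarrow>\<^sub>0 int) set \<Rightarrow> 'a" where
  "\<tau>' = tensor_lift T'_ring grouplike_eval"

text \<open>The maps \<open>\<mu>\<close> and \<open>\<mu>'\<close> are given by the same formula on representatives.\<close>

definition \<mu> :: "(('g \<Rightarrow> 'c \<Rightarrow> 'a) \<times> 'a \<Rightarrow>\<^sub>0 int) set \<Rightarrow> ('g \<Rightarrow> 'c \<Rightarrow> 'a)" where
  "\<mu> = tensor_lift dual_ring dual_rsmult"

definition context_M :: "('a, 'g \<Rightarrow> 'c \<Rightarrow> 'a, 'a, 'g \<Rightarrow> 'c \<Rightarrow> 'a) morita_data" where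
  "context_M = \<lparr>ringS = T_ring, ringR = dual_ring, modP = A_bimodule,
     modQ = sub_bimodule O_set, connPQ = \<tau>, connQP = \<mu>\<rparr>"

definition context_M' :: "('a, 'g \<Rightarrow> 'c \<Rightarrow> 'a, 'a, 'g \<Rightarrow> 'c \<Rightarrow> 'a) morita_data" where
  "context_M' = \<lparr>ringS = T'_ring, ringR = dual_ring, modP = A_bimodule,
     modQ = sub_bimodule O'_set, connPQ = \<tau>', connQP = \<mu>\<rparr>"

end

end

theory Submission
  imports Defs
begin

text \<open>
  The comultiplication enters only through the operators \<open>c \<mapsto> c\<^sub>(\<^sub>1\<^sub>) f(c\<^sub>(\<^sub>2\<^sub>))\<close> for functionals \<open>f\<close>,
  called \<open>comult_apply\<close>. These are left linear in \<open>c\<close> and additive in \<open>f\<close>; the coring axioms say that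
  they compose like the products \<open>f # g\<close> (\<open>comult_apply_coassoc\<close>), that \<open>\<epsilon>\<close> acts as a unit, and that
  they send \<open>x a\<close> to \<open>x f(x a)\<close> (\<open>comult_apply_grouplike\<close>). These facts follow from the universal
  property of the tensor product by checking pure tensors; afterwards the tensor products of the
  \<open>C\<^sub>\<alpha>\<close> can be forgotten. They make \<open>R\<close> a ring and \<open>A\<close> a right \<open>R\<close>-module, since both claims are
  additive and need only be checked on homogeneous elements (\<open>dual_ring_induct\<close>).

  An element \<open>q\<close> of \<open>R\<close> lies in \<open>O\<close> if the operators of its components are
  \<open>c \<mapsto> q\<^sub>\<alpha>\<^sub>\<beta>(c) x\<^bsub>\<beta>\<^sup>-\<^sup>1\<^esub>\<close>. Followed by a functional \<open>f\<close> of degree \<open>\<beta>\<close> this yields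
  \<open>(q \<cdot> a) # f = q \<cdot> (a \<cdot> f)\<close> (\<open>dual_rsmult_mult_O\<close>), which contains the right linearity of \<open>\<mu>\<close> and
  the compatibility \<open>\<mu>(q \<otimes> a) q' = q \<tau>(a \<otimes> q')\<close>. Evaluated at \<open>x a\<close> and summed over all degrees, it
  yields \<open>x\<^sub>\<beta> (a \<cdot> q) = (a \<cdot> q) x\<^sub>\<beta>\<close>, so \<open>\<tau>\<close> takes its values in \<open>T\<close> (\<open>grouplike_eval_O_in_T\<close>). The
  other laws of a Morita context are formal.

  The definitions of \<open>T'\<close> and \<open>O'\<close> test the equations for \<open>T\<close> and \<open>O\<close> against all functionals. If
  every \<open>C\<^sub>\<alpha>\<close> is projective, the functionals separate its points (\<open>left_projective_separating\<close>). Then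
  \<open>T' = T\<close> and \<open>O' = O\<close>, the two contexts coincide, and the identity is the isomorphism.
\<close>

section \<open>The universal property of the tensor product\<close>

text \<open>The additive extension of a function on generators to the free abelian group, in the shape in
  which \<open>tensor_lift\<close> evaluates it on a representative.\<close>

definition frag_sum :: "('l, 'x) ring_scheme \<Rightarrow> ('p \<Rightarrow> 'l) \<Rightarrow> ('p \<Rightarrow>\<^sub>0 int) \<Rightarrow> 'l" where
  "frag_sum L g t = (\<Oplus>\<^bsub>L\<^esub>p\<in>Poly_Mapping.keys t. [Poly_Mapping.lookup t p] \<cdot>\<^bsub>L\<^esub> g p)"

context abelian_group
begin

lemma frag_sum_superset:
  assumes "finite F" "Poly_Mapping.keys t \<subseteq> F" "g \<in> F \<rightarrow> carrier G"
  shows "frag_sum G g t = (\<Oplus>p\<in>F. [Poly_Mapping.lookup t p] \<cdot> g p)"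
  unfolding frag_sum_def
proof (rule add.finprod_mono_neutral_cong_left)
  show "\<And>i. i \<in> F - Poly_Mapping.keys t \<Longrightarrow> [Poly_Mapping.lookup t i] \<cdot> g i = \<zero>"
    by (simp add: add_pow_def in_keys_iff)
qed (use assms in auto)

lemma frag_sum_closed:
  assumes "Poly_Mapping.keys t \<subseteq> S" "g \<in> S \<rightarrow> carrier G"
  shows "frag_sum G g t \<in> carrier G"
  unfolding frag_sum_def using assms by (intro finsum_closed) (auto simp: Pi_iff)

lemma frag_sum_add:
  assumes "Poly_Mapping.keys s \<subseteq> S" "Poly_Mapping.keys t \<subseteq> S" "g \<in> S \<rightarrow> carrier G"
  shows "frag_sum G g (s + t) = frag_sum G g s \<oplus> frag_sum G g t"
proof -
  let ?F = "Poly_Mapping.keys s \<union> Poly_Mapping.keys t"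
  have g: "g \<in> ?F \<rightarrow> carrier G"
    using assms by auto
  have "frag_sum G g (s + t) = (\<Oplus>p\<in>?F. [Poly_Mapping.lookup (s + t) p] \<cdot> g p)"
    by (rule frag_sum_superset) (use g keys_add[of s t] in auto)
  also have "\<dots> = (\<Oplus>p\<in>?F. [Poly_Mapping.lookup s p] \<cdot> g p \<oplus> [Poly_Mapping.lookup t p] \<cdot> g p)"
    by (rule finsum_cong') (use g in \<open>auto simp: lookup_add Pi_iff intro!: add.int_pow_mult\<close>)
  also have "\<dots> = (\<Oplus>p\<in>?F. [Poly_Mapping.lookup s p] \<cdot> g p) \<oplus> (\<Oplus>p\<in>?F. [Poly_Mapping.lookup t p] \<cdot> g p)"
    by (rule finsum_addf) (use g in auto)
  also have "\<dots> = frag_sum G g s \<oplus> frag_sum G g t"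
    by (subst (1 2) frag_sum_superset[where F = ?F]) (use g in auto)
  finally show ?thesis .
qed

lemma frag_sum_of: "g p \<in> carrier G \<Longrightarrow> frag_sum G g (frag_of p) = g p"
  by (simp add: frag_sum_def keys_frag_of)

lemma frag_sum_hom:
  assumes "g \<in> S \<rightarrow> carrier G"
  shows "group_hom (free_Abelian_group S) (add_monoid G) (frag_sum G g)"
  using assms frag_sum_closed frag_sum_add
  by (auto simp: group_hom_def group_hom_axioms_def hom_def a_group)

lemma frag_sum_diff:
  assumes "Poly_Mapping.keys s \<subseteq> S" "Poly_Mapping.keys t \<subseteq> S" "g \<in> S \<rightarrow> carrier G"
  shows "frag_sum G g (s - t) = frag_sum G g s \<ominus> frag_sum G g t"
proof -
  interpret h: group_hom "free_Abelian_group S" "add_monoid G" "frag_sum G g"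
    using assms(3) by (rule frag_sum_hom)
  have "frag_sum G g (s + (- t)) = frag_sum G g s \<oplus> frag_sum G g (- t)"
    by (rule frag_sum_add) (use assms in auto)
  moreover have "frag_sum G g (- t) = \<ominus> frag_sum G g t"
    using h.hom_inv[of t] assms by (simp add: a_inv_def)
  ultimately show ?thesis
    by (simp add: a_minus_def)
qed

end

definition balanced_map ::
  "('a, 'x) ring_scheme \<Rightarrow> ('s, 'a, 'm, 'y) bimodule_scheme \<Rightarrow> ('a, 't, 'n, 'z) bimodule_scheme \<Rightarrow>
   ('l, 'w) ring_scheme \<Rightarrow> ('m \<Rightarrow> 'n \<Rightarrow> 'l) \<Rightarrow> bool" where
  "balanced_map A M N L f \<longleftrightarrow>
     (\<forall>m\<in>carrier M. \<forall>n\<in>carrier N. f m n \<in> carrier L) \<and>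
     (\<forall>m\<in>carrier M. \<forall>m'\<in>carrier M. \<forall>n\<in>carrier N. f (m \<oplus>\<^bsub>M\<^esub> m') n = f m n \<oplus>\<^bsub>L\<^esub> f m' n) \<and>
     (\<forall>m\<in>carrier M. \<forall>n\<in>carrier N. \<forall>n'\<in>carrier N. f m (n \<oplus>\<^bsub>N\<^esub> n') = f m n \<oplus>\<^bsub>L\<^esub> f m n') \<and>
     (\<forall>m\<in>carrier M. \<forall>a\<in>carrier A. \<forall>n\<in>carrier N. f (m \<triangleleft>\<^bsub>M\<^esub> a) n = f m (a \<odot>\<^bsub>N\<^esub> n))"

lemma balanced_mapI:
  assumes "\<And>m n. \<lbrakk>m \<in> carrier M; n \<in> carrier N\<rbrakk> \<Longrightarrow> f m n \<in> carrier L"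
    and "\<And>m m' n. \<lbrakk>m \<in> carrier M; m' \<in> carrier M; n \<in> carrier N\<rbrakk> \<Longrightarrow>
      f (m \<oplus>\<^bsub>M\<^esub> m') n = f m n \<oplus>\<^bsub>L\<^esub> f m' n"
    and "\<And>m n n'. \<lbrakk>m \<in> carrier M; n \<in> carrier N; n' \<in> carrier N\<rbrakk> \<Longrightarrow>
      f m (n \<oplus>\<^bsub>N\<^esub> n') = f m n \<oplus>\<^bsub>L\<^esub> f m n'"
    and "\<And>m a n. \<lbrakk>m \<in> carrier M; a \<in> carrier A; n \<in> carrier N\<rbrakk> \<Longrightarrow>
      f (m \<triangleleft>\<^bsub>M\<^esub> a) n = f m (a \<odot>\<^bsub>N\<^esub> n)"
  shows "balanced_map A M N L f"
  using assms by (simp add: balanced_map_def)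

locale tensor_pair = M: right_module A M + N: left_module A N
  for A :: "('a, 'x) ring_scheme" and M :: "('s, 'a, 'm, 'y) bimodule_scheme"
    and N :: "('a, 't, 'n, 'z) bimodule_scheme"
begin

abbreviation "F \<equiv> free_Abelian_group (carrier M \<times> carrier N)"
abbreviation "K \<equiv> tensor_kernel A M N"
abbreviation "cls \<equiv> tensor_class A M N"
abbreviation "pt \<equiv> pure_tensor A M N"
abbreviation "MN \<equiv> tensor A M N"
abbreviation "supported t \<equiv> Poly_Mapping.keys t \<subseteq> carrier M \<times> carrier N"

lemma relator_add_left:
  "\<lbrakk>m \<in> carrier M; m' \<in> carrier M; n \<in> carrier N\<rbrakk> \<Longrightarrow>
    frag_of (m \<oplus>\<^bsub>M\<^esub> m', n) - frag_of (m, n) - frag_of (m', n) \<in> tensor_relators A M N"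
  unfolding tensor_relators_def by blast

lemma relator_add_right:
  "\<lbrakk>m \<in> carrier M; n \<in> carrier N; n' \<in> carrier N\<rbrakk> \<Longrightarrow>
    frag_of (m, n \<oplus>\<^bsub>N\<^esub> n') - frag_of (m, n) - frag_of (m, n') \<in> tensor_relators A M N"
  unfolding tensor_relators_def by blast

lemma relator_balanced:
  "\<lbrakk>m \<in> carrier M; a \<in> carrier A; n \<in> carrier N\<rbrakk> \<Longrightarrow>
    frag_of (m \<triangleleft>\<^bsub>M\<^esub> a, n) - frag_of (m, a \<odot>\<^bsub>N\<^esub> n) \<in> tensor_relators A M N"
  unfolding tensor_relators_def by blast

lemma relators_cases:
  assumes "r \<in> tensor_relators A M N"
  obtains (add_left) m m' n where "m \<in> carrier M" "m' \<in> carrier M" "n \<in> carrier N"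
      "r = frag_of (m \<oplus>\<^bsub>M\<^esub> m', n) - frag_of (m, n) - frag_of (m', n)"
    | (add_right) m n n' where "m \<in> carrier M" "n \<in> carrier N" "n' \<in> carrier N"
      "r = frag_of (m, n \<oplus>\<^bsub>N\<^esub> n') - frag_of (m, n) - frag_of (m, n')"
    | (balanced) m a n where "m \<in> carrier M" "a \<in> carrier A" "n \<in> carrier N"
      "r = frag_of (m \<triangleleft>\<^bsub>M\<^esub> a, n) - frag_of (m, a \<odot>\<^bsub>N\<^esub> n)"
  using assms unfolding tensor_relators_def
  by (elim UnE CollectE exE conjE) (rule add_left add_right balanced; assumption)+

lemma relators_supported:
  assumes "r \<in> tensor_relators A M N"
  shows "supported r"
proof -
  have 1: "supported (frag_of a - frag_of b)"
    if "a \<in> carrier M \<times> carrier N" "b \<in> carrier M \<times> carrier N" for a b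
    using keys_diff[of "frag_of a" "frag_of b"] that by (auto simp: keys_frag_of)
  have 2: "supported (frag_of a - frag_of b - frag_of c)"
    if "a \<in> carrier M \<times> carrier N" "b \<in> carrier M \<times> carrier N" "c \<in> carrier M \<times> carrier N" for a b c
    using keys_diff[of "frag_of a - frag_of b" "frag_of c"] 1[OF that(1,2)] that(3)
    by (auto simp: keys_frag_of)
  show ?thesis
    using assms by (cases rule: relators_cases) (simp_all add: 1 2 M.rsmult_closed N.lsmult_closed)
qed

lemma kernel_subgroup: "subgroup K F"
  unfolding tensor_kernel_def
  by (rule group.generate_is_subgroup) (use relators_supported in auto)

lemma relator_in_kernel: "t \<in> tensor_relators A M N \<Longrightarrow> t \<in> K"
  unfolding tensor_kernel_def by (rule generate.incl)

lemma kernel_normal: "K \<lhd> F"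
  using comm_group.subgroup_imp_normal[OF abelian_free_Abelian_group kernel_subgroup] .

lemma kernel_supported: "t \<in> K \<Longrightarrow> supported t"
  using subsetD[OF subgroup.subset[OF kernel_subgroup]] by simp

lemma kernel_zero: "0 \<in> K"
  using subgroup.one_closed[OF kernel_subgroup] by simp

lemma kernel_add: "s \<in> K \<Longrightarrow> t \<in> K \<Longrightarrow> s + t \<in> K"
  using subgroup.m_closed[OF kernel_subgroup] by simp

lemma kernel_minus: "t \<in> K \<Longrightarrow> - t \<in> K"
  using subgroup.m_inv_closed[OF kernel_subgroup, of t] kernel_supported[of t] by simp

lemma kernel_diff: "s \<in> K \<Longrightarrow> t \<in> K \<Longrightarrow> s - t \<in> K"
  using kernel_add[of s "- t"] kernel_minus by simp

lemma cls_eq_image: "cls t = (\<lambda>k. k + t) ` K"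
  by (auto simp: tensor_class_def r_coset_def)

lemma cls_self: "t \<in> cls t"
  using kernel_zero by (force simp: cls_eq_image)

lemma cls_eqI:
  assumes "s - t \<in> K"
  shows "cls s = cls t"
proof -
  have "k + s \<in> cls t" if "k \<in> K" for k
    using kernel_add[OF that assms] by (force simp: cls_eq_image)
  moreover have "k + t \<in> cls s" if "k \<in> K" for k
    using kernel_diff[OF that assms] by (force simp: cls_eq_image image_iff)
  ultimately show ?thesis
    by (auto simp: cls_eq_image)
qed

lemma tensor_carrier: "carrier MN = cls ` {t. supported t}"
  by (auto simp: tensor_def Let_def carrier_FactGroup tensor_class_def)

lemma cls_closed: "supported t \<Longrightarrow> cls t \<in> carrier MN"
  by (auto simp: tensor_carrier)

lemma tensor_zero: "\<zero>\<^bsub>MN\<^esub> = cls 0"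
  by (auto simp: tensor_def Let_def cls_eq_image)

lemma cls_add: "supported s \<Longrightarrow> supported t \<Longrightarrow> cls s \<oplus>\<^bsub>MN\<^esub> cls t = cls (s + t)"
  using normal.rcos_sum[OF kernel_normal, of s t] by (simp add: tensor_def Let_def tensor_class_def)

lemma tensor_abelian_group: "abelian_group MN"
proof -
  have "comm_group (F Mod K)"
    by (rule comm_group.abelian_FactGroup[OF abelian_free_Abelian_group kernel_subgroup])
  moreover have "carrier MN = carrier (F Mod K)" "ring.add MN = monoid.mult (F Mod K)"
      "\<zero>\<^bsub>MN\<^esub> = \<one>\<^bsub>F Mod K\<^esub>"
    by (simp_all add: tensor_def Let_def)
  ultimately show ?thesis
    using comm_groupE[of "F Mod K"] by (intro abelian_groupI) simp_all
qed

sublocale MN: abelian_group MN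
  by (rule tensor_abelian_group)

lemma supported_of: "m \<in> carrier M \<Longrightarrow> n \<in> carrier N \<Longrightarrow> supported (frag_of (m, n))"
  by (simp add: keys_frag_of)

lemma pure_closed: "m \<in> carrier M \<Longrightarrow> n \<in> carrier N \<Longrightarrow> pt m n \<in> carrier MN"
  unfolding pure_tensor_def by (intro cls_closed supported_of)

lemma pure_add_left:
  assumes "m \<in> carrier M" "m' \<in> carrier M" "n \<in> carrier N"
  shows "pt (m \<oplus>\<^bsub>M\<^esub> m') n = pt m n \<oplus>\<^bsub>MN\<^esub> pt m' n"
proof -
  from relator_in_kernel[OF relator_add_left[OF assms]] show ?thesis
    unfolding pure_tensor_def
    by (subst cls_add) (use assms in \<open>auto simp: diff_diff_eq keys_frag_of intro!: cls_eqI\<close>)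
qed

lemma pure_add_right:
  assumes "m \<in> carrier M" "n \<in> carrier N" "n' \<in> carrier N"
  shows "pt m (n \<oplus>\<^bsub>N\<^esub> n') = pt m n \<oplus>\<^bsub>MN\<^esub> pt m n'"
proof -
  from relator_in_kernel[OF relator_add_right[OF assms]] show ?thesis
    unfolding pure_tensor_def
    by (subst cls_add) (use assms in \<open>auto simp: diff_diff_eq keys_frag_of intro!: cls_eqI\<close>)
qed

lemma pure_balanced:
  assumes "m \<in> carrier M" "a \<in> carrier A" "n \<in> carrier N"
  shows "pt (m \<triangleleft>\<^bsub>M\<^esub> a) n = pt m (a \<odot>\<^bsub>N\<^esub> n)"
proof -
  from relator_in_kernel[OF relator_balanced[OF assms]] show ?thesis
    unfolding pure_tensor_def by (rule cls_eqI)
qed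

lemma pure_balanced_map: "balanced_map A M N MN pt"
  by (intro balanced_mapI pure_closed pure_add_left pure_add_right pure_balanced)

lemma pure_zero_left: "n \<in> carrier N \<Longrightarrow> pt \<zero>\<^bsub>M\<^esub> n = \<zero>\<^bsub>MN\<^esub>"
  using pure_add_left[of "\<zero>\<^bsub>M\<^esub>" "\<zero>\<^bsub>M\<^esub>" n] pure_closed[of "\<zero>\<^bsub>M\<^esub>" n] by simp

lemma pure_minus_left: "m \<in> carrier M \<Longrightarrow> n \<in> carrier N \<Longrightarrow> pt (\<ominus>\<^bsub>M\<^esub> m) n = \<ominus>\<^bsub>MN\<^esub> pt m n"
  using pure_add_left[of "\<ominus>\<^bsub>M\<^esub> m" m n]
  by (metis M.M.a_inv_closed M.M.l_neg MN.minus_equality pure_closed pure_zero_left)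

lemma cls_minus: "supported t \<Longrightarrow> cls (- t) = \<ominus>\<^bsub>MN\<^esub> cls t"
  using cls_add[of "- t" t] MN.minus_equality cls_closed tensor_zero by simp

text \<open>Negatives of pure tensors have no case of their own because \<open>-(m \<otimes> n) = (-m) \<otimes> n\<close>.\<close>

lemma tensor_induct [consumes 1, case_names pure add]:
  assumes "Z \<in> carrier MN"
    and pure: "\<And>m n. m \<in> carrier M \<Longrightarrow> n \<in> carrier N \<Longrightarrow> P (pt m n)"
    and add: "\<And>Z W. \<lbrakk>Z \<in> carrier MN; W \<in> carrier MN; P Z; P W\<rbrakk> \<Longrightarrow> P (Z \<oplus>\<^bsub>MN\<^esub> W)"
  shows "P Z"
proof -
  obtain t where t: "supported t" "Z = cls t"
    using assms(1) by (auto simp: tensor_carrier)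
  have "P (cls t) \<and> P (cls (- t))"
    using t(1)
  proof (rule free_Abelian_group_induct)
    have "P (pt \<zero>\<^bsub>M\<^esub> \<zero>\<^bsub>N\<^esub>)"
      by (rule pure) auto
    then show "P (cls 0) \<and> P (cls (- 0))"
      by (simp add: pure_zero_left flip: tensor_zero)
  next
    fix s t assume *: "supported s" "supported t" "P (cls s) \<and> P (cls (- s))" "P (cls t) \<and> P (cls (- t))"
    then have "cls (s - t) = cls s \<oplus>\<^bsub>MN\<^esub> cls (- t)" "cls (t - s) = cls t \<oplus>\<^bsub>MN\<^esub> cls (- s)"
      by (simp_all add: cls_add)
    with * show "P (cls (s - t)) \<and> P (cls (- (s - t)))"
      by (simp add: add cls_closed)
  next
    fix p assume "p \<in> carrier M \<times> carrier N"
    then obtain m n where p: "p = (m, n)" "m \<in> carrier M" "n \<in> carrier N"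
      by auto
    have "cls (- frag_of p) = pt (\<ominus>\<^bsub>M\<^esub> m) n"
      using p by (subst cls_minus) (simp_all add: pure_minus_left keys_frag_of flip: pure_tensor_def)
    moreover have "cls (frag_of p) = pt m n"
      by (simp add: p pure_tensor_def)
    ultimately show "P (cls (frag_of p)) \<and> P (cls (- frag_of p))"
      using p by (auto intro!: pure)
  qed
  then show ?thesis
    using t by simp
qed

text \<open>The additive extension of a balanced map to the free abelian group kills every relator, hence the
  whole kernel; so it is constant on classes and the representative that \<open>tensor_lift\<close> picks does
  not matter.\<close>

lemma tensor_lift_cls:
  assumes L: "abelian_group L" and f: "balanced_map A M N L f" and t: "supported t"
  shows "tensor_lift L f (cls t) = frag_sum L (\<lambda>p. f (fst p) (snd p)) t"
proof -
  interpret L: abelian_group L by fact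
  let ?f = "\<lambda>p. f (fst p) (snd p)"
  have f': "?f \<in> carrier M \<times> carrier N \<rightarrow> carrier L"
    using f by (auto simp: balanced_map_def)
  interpret h: group_hom F "add_monoid L" "frag_sum L ?f"
    by (rule L.frag_sum_hom[OF f'])
  have zero: "u \<oplus>\<^bsub>L\<^esub> v \<ominus>\<^bsub>L\<^esub> u \<ominus>\<^bsub>L\<^esub> v = \<zero>\<^bsub>L\<^esub>" if "u \<in> carrier L" "v \<in> carrier L" for u v
    using that L.r_neg[of "u \<oplus>\<^bsub>L\<^esub> v"] by (simp add: a_minus_def L.a_assoc L.minus_add)
  have zero': "u \<ominus>\<^bsub>L\<^esub> u = \<zero>\<^bsub>L\<^esub>" if "u \<in> carrier L" for u
    using that by (simp add: a_minus_def L.r_neg)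
  have sum3: "frag_sum L ?f (frag_of a - frag_of b - frag_of c) = ?f a \<ominus>\<^bsub>L\<^esub> ?f b \<ominus>\<^bsub>L\<^esub> ?f c"
    if "a \<in> carrier M \<times> carrier N" "b \<in> carrier M \<times> carrier N" "c \<in> carrier M \<times> carrier N" for a b c
  proof -
    have "Poly_Mapping.keys (frag_of a - frag_of b) \<subseteq> carrier M \<times> carrier N"
      using keys_diff[of "frag_of a" "frag_of b"] that by (auto simp: keys_frag_of)
    moreover have "?f a \<in> carrier L" "?f b \<in> carrier L" "?f c \<in> carrier L"
      using that f' by blast+
    ultimately show ?thesis
      using that f' by (simp add: L.frag_sum_diff[where S = "carrier M \<times> carrier N"] keys_frag_of L.frag_sum_of)
  qed
  have sum2: "frag_sum L ?f (frag_of a - frag_of b) = ?f a \<ominus>\<^bsub>L\<^esub> ?f b"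
    if "a \<in> carrier M \<times> carrier N" "b \<in> carrier M \<times> carrier N" for a b
  proof -
    have "?f a \<in> carrier L" "?f b \<in> carrier L"
      using that f' by blast+
    then show ?thesis
      using that f' by (simp add: L.frag_sum_diff[where S = "carrier M \<times> carrier N"] keys_frag_of L.frag_sum_of)
  qed
  have "tensor_relators A M N \<subseteq> kernel F (add_monoid L) (frag_sum L ?f)"
  proof
    fix r assume r: "r \<in> tensor_relators A M N"
    then have "frag_sum L ?f r = \<zero>\<^bsub>L\<^esub>"
      using f unfolding tensor_relators_def balanced_map_def
      by (auto simp: sum3 sum2 zero zero' M.rsmult_closed N.lsmult_closed)
    then show "r \<in> kernel F (add_monoid L) (frag_sum L ?f)"
      using relators_supported[OF r] by (simp add: kernel_def)
  qed
  then have "K \<subseteq> kernel F (add_monoid L) (frag_sum L ?f)"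
    unfolding tensor_kernel_def
    using group.generate_subgroup_incl[OF group_free_Abelian_group] h.subgroup_kernel by blast
  then have K: "frag_sum L ?f k = \<zero>\<^bsub>L\<^esub>" if "k \<in> K" for k
    using that by (auto simp: kernel_def)
  have const: "frag_sum L ?f u = frag_sum L ?f t" if "u \<in> cls t" for u
  proof -
    obtain k where k: "k \<in> K" "u = k + t"
      using \<open>u \<in> cls t\<close> by (auto simp: cls_eq_image)
    then show ?thesis
      using L.frag_sum_add[OF kernel_supported[OF k(1)] t f'] K[OF k(1)] L.frag_sum_closed[OF t f']
      by simp
  qed
  show ?thesis
    using const[OF someI[of "\<lambda>u. u \<in> cls t", OF cls_self]]
    by (simp add: tensor_lift_def frag_sum_def)
qed

lemma
  assumes L: "abelian_group L" and f: "balanced_map A M N L f"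
  shows tensor_lift_pure: "\<lbrakk>m \<in> carrier M; n \<in> carrier N\<rbrakk> \<Longrightarrow> tensor_lift L f (pt m n) = f m n"
    and tensor_lift_closed: "Z \<in> carrier MN \<Longrightarrow> tensor_lift L f Z \<in> carrier L"
    and tensor_lift_add: "\<lbrakk>Z \<in> carrier MN; W \<in> carrier MN\<rbrakk> \<Longrightarrow>
      tensor_lift L f (Z \<oplus>\<^bsub>MN\<^esub> W) = tensor_lift L f Z \<oplus>\<^bsub>L\<^esub> tensor_lift L f W"
proof -
  interpret L: abelian_group L by fact
  have f': "(\<lambda>p. f (fst p) (snd p)) \<in> carrier M \<times> carrier N \<rightarrow> carrier L"
    using f by (auto simp: balanced_map_def)
  show "tensor_lift L f (pt m n) = f m n" if "m \<in> carrier M" "n \<in> carrier N"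
    using that f
    by (simp add: pure_tensor_def tensor_lift_cls[OF L f supported_of] L.frag_sum_of balanced_map_def)
  show "tensor_lift L f Z \<in> carrier L" if "Z \<in> carrier MN"
    using that by (auto simp: tensor_carrier tensor_lift_cls[OF L f] intro: L.frag_sum_closed[OF _ f'])
  show "tensor_lift L f (Z \<oplus>\<^bsub>MN\<^esub> W) = tensor_lift L f Z \<oplus>\<^bsub>L\<^esub> tensor_lift L f W"
    if ZW: "Z \<in> carrier MN" "W \<in> carrier MN"
  proof -
    obtain s t where "supported s" "supported t" "Z = cls s" "W = cls t"
      using ZW by (auto simp: tensor_carrier)
    moreover from this have "supported (s + t)"
      using keys_add[of s t] by auto
    ultimately show ?thesis
      by (simp add: cls_add tensor_lift_cls[OF L f] L.frag_sum_add[OF _ _ f'])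
  qed
qed

lemma tensor_map_balanced:
  assumes A': "tensor_pair A M' N'"
    and g: "g \<in> carrier M \<rightarrow> carrier M'"
      "\<And>m m'. \<lbrakk>m \<in> carrier M; m' \<in> carrier M\<rbrakk> \<Longrightarrow> g (m \<oplus>\<^bsub>M\<^esub> m') = g m \<oplus>\<^bsub>M'\<^esub> g m'"
      "\<And>m a. \<lbrakk>m \<in> carrier M; a \<in> carrier A\<rbrakk> \<Longrightarrow> g (m \<triangleleft>\<^bsub>M\<^esub> a) = g m \<triangleleft>\<^bsub>M'\<^esub> a"
    and h: "h \<in> left_linear A N N'"
  shows "balanced_map A M N (tensor A M' N') (\<lambda>m n. pure_tensor A M' N' (g m) (h n))"
proof -
  interpret T': tensor_pair A M' N' by fact
  have gc: "g m \<in> carrier M'" if "m \<in> carrier M" for m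
    using g(1) that by auto
  have h': "\<And>n. n \<in> carrier N \<Longrightarrow> h n \<in> carrier N'"
    "\<And>n n'. \<lbrakk>n \<in> carrier N; n' \<in> carrier N\<rbrakk> \<Longrightarrow> h (n \<oplus>\<^bsub>N\<^esub> n') = h n \<oplus>\<^bsub>N'\<^esub> h n'"
    "\<And>a n. \<lbrakk>a \<in> carrier A; n \<in> carrier N\<rbrakk> \<Longrightarrow> h (a \<odot>\<^bsub>N\<^esub> n) = a \<odot>\<^bsub>N'\<^esub> h n"
    using h unfolding left_linear_def by blast+
  show ?thesis
  proof (rule balanced_mapI, goal_cases)
    case 1 then show ?case by (intro T'.pure_closed gc h')
  next
    case 2 then show ?case by (simp only: g T'.pure_add_left gc h')
  next
    case 3 then show ?case by (simp only: h' T'.pure_add_right gc)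
  next
    case 4 then show ?case by (simp only: g h' T'.pure_balanced gc)
  qed
qed

text \<open>Additive maps of the two factors that commute with the inner action send relators to relators. The outer
  actions, which are unions over all representatives, can therefore be computed on a single one.\<close>

lemma action_cls:
  assumes e: "\<And>m. m \<in> carrier M \<Longrightarrow> g m \<in> carrier M" "\<And>n. n \<in> carrier N \<Longrightarrow> h n \<in> carrier N"
    and g: "\<And>m m'. \<lbrakk>m \<in> carrier M; m' \<in> carrier M\<rbrakk> \<Longrightarrow> g (m \<oplus>\<^bsub>M\<^esub> m') = g m \<oplus>\<^bsub>M\<^esub> g m'"
      "\<And>m a. \<lbrakk>m \<in> carrier M; a \<in> carrier A\<rbrakk> \<Longrightarrow> g (m \<triangleleft>\<^bsub>M\<^esub> a) = g m \<triangleleft>\<^bsub>M\<^esub> a"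
    and h: "\<And>n n'. \<lbrakk>n \<in> carrier N; n' \<in> carrier N\<rbrakk> \<Longrightarrow> h (n \<oplus>\<^bsub>N\<^esub> n') = h n \<oplus>\<^bsub>N\<^esub> h n'"
      "\<And>n a. \<lbrakk>n \<in> carrier N; a \<in> carrier A\<rbrakk> \<Longrightarrow> h (a \<odot>\<^bsub>N\<^esub> n) = a \<odot>\<^bsub>N\<^esub> h n"
    and t: "supported t"
  shows "(\<Union>u\<in>cls t. cls (frag_extend (\<lambda>(m, n). frag_of (g m, h n)) u)) =
    cls (frag_extend (\<lambda>(m, n). frag_of (g m, h n)) t)"
    and "supported (frag_extend (\<lambda>(m, n). frag_of (g m, h n)) t)"
proof -
  let ?e = "\<lambda>(m, n). frag_of (g m, h n)"
  let ?E = "frag_extend ?e"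
  have supp: "supported (?E u)" if u: "supported u" for u
  proof -
    have "Poly_Mapping.keys (?e p) \<subseteq> carrier M \<times> carrier N" if "p \<in> Poly_Mapping.keys u" for p
      using subsetD[OF u that] e by (cases p) (simp add: keys_frag_of)
    then show ?thesis
      using keys_frag_extend[of ?e u] by blast
  qed
  then show "supported (?E t)"
    using t .
  interpret E: group_hom F F ?E
    by (rule group_hom.intro) (auto simp: group_hom_axioms_def hom_def supp frag_extend_add)
  have "?E r \<in> tensor_relators A M N" if r: "r \<in> tensor_relators A M N" for r
    using r
  proof (cases rule: relators_cases)
    case (add_left m m' n)
    then show ?thesis
      using relator_add_left[of "g m" "g m'" "h n"] by (simp add: frag_extend_diff g e)
  next
    case (add_right m n n')
    then show ?thesis
      using relator_add_right[of "g m" "h n" "h n'"] by (simp add: frag_extend_diff h e)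
  next
    case (balanced m a n)
    then show ?thesis
      using relator_balanced[of "g m" a "h n"] by (simp add: frag_extend_diff g h e)
  qed
  then have "?E ` tensor_relators A M N \<subseteq> tensor_relators A M N"
    by auto
  then have "generate F (?E ` tensor_relators A M N) \<subseteq> K"
    unfolding tensor_kernel_def by (intro E.mono_generate)
  then have E: "?E ` K \<subseteq> K"
    unfolding tensor_kernel_def using relators_supported by (subst E.generate_img[symmetric]) auto
  have "cls (?E u) = cls (?E t)" if u: "u \<in> cls t" for u
  proof (rule cls_eqI)
    obtain k where "k \<in> K" "u = k + t"
      using u by (auto simp: cls_eq_image)
    then show "?E u - ?E t \<in> K"
      using E by (auto simp: frag_extend_add)
  qed
  then have "(\<Union>u\<in>cls t. cls (?E u)) = (\<Union>u\<in>cls t. cls (?E t))"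
    by (rule SUP_cong[OF refl])
  also have "\<dots> = cls (?E t)"
    using cls_self[of t] by blast
  finally show "(\<Union>u\<in>cls t. cls (?E u)) = cls (?E t)" .
qed

lemma
  assumes "bimodule S A M" and s: "s \<in> carrier S"
  shows smult_closed: "Z \<in> carrier MN \<Longrightarrow> s \<odot>\<^bsub>MN\<^esub> Z \<in> carrier MN"
    and smult_add: "\<lbrakk>Z \<in> carrier MN; W \<in> carrier MN\<rbrakk> \<Longrightarrow>
      s \<odot>\<^bsub>MN\<^esub> (Z \<oplus>\<^bsub>MN\<^esub> W) = s \<odot>\<^bsub>MN\<^esub> Z \<oplus>\<^bsub>MN\<^esub> s \<odot>\<^bsub>MN\<^esub> W"
    and smult_pure: "\<lbrakk>m \<in> carrier M; n \<in> carrier N\<rbrakk> \<Longrightarrow> s \<odot>\<^bsub>MN\<^esub> pt m n = pt (s \<odot>\<^bsub>M\<^esub> m) n"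
proof -
  interpret B: bimodule S A M by fact
  let ?E = "frag_extend (\<lambda>(m, n). frag_of (s \<odot>\<^bsub>M\<^esub> m, n))"
  have E: "s \<odot>\<^bsub>MN\<^esub> cls t = cls (?E t)" and supp: "supported (?E t)" if "supported t" for t
    using action_cls[of "\<lambda>m. s \<odot>\<^bsub>M\<^esub> m" "\<lambda>n. n" t] s that
    by (simp_all add: tensor_def Let_def B.lsmult_closed B.lsmult_r_distr B.bismult_assoc)
  show "s \<odot>\<^bsub>MN\<^esub> Z \<in> carrier MN" if "Z \<in> carrier MN"
    using that E supp by (auto simp: tensor_carrier)
  show "s \<odot>\<^bsub>MN\<^esub> (Z \<oplus>\<^bsub>MN\<^esub> W) = s \<odot>\<^bsub>MN\<^esub> Z \<oplus>\<^bsub>MN\<^esub> s \<odot>\<^bsub>MN\<^esub> W"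
    if ZW: "Z \<in> carrier MN" "W \<in> carrier MN"
  proof -
    obtain u v where uv: "supported u" "supported v" "Z = cls u" "W = cls v"
      using ZW by (auto simp: tensor_carrier)
    then have "supported (u + v)"
      using keys_add[of u v] by auto
    then show ?thesis
      using uv by (simp add: cls_add E supp frag_extend_add)
  qed
  show "s \<odot>\<^bsub>MN\<^esub> pt m n = pt (s \<odot>\<^bsub>M\<^esub> m) n" if "m \<in> carrier M" "n \<in> carrier N"
    using that by (simp add: pure_tensor_def E supported_of)
qed

lemma
  assumes "bimodule A T N" and r: "r \<in> carrier T"
  shows rsmult_closed: "Z \<in> carrier MN \<Longrightarrow> Z \<triangleleft>\<^bsub>MN\<^esub> r \<in> carrier MN"
    and rsmult_add: "\<lbrakk>Z \<in> carrier MN; W \<in> carrier MN\<rbrakk> \<Longrightarrow>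
      (Z \<oplus>\<^bsub>MN\<^esub> W) \<triangleleft>\<^bsub>MN\<^esub> r = Z \<triangleleft>\<^bsub>MN\<^esub> r \<oplus>\<^bsub>MN\<^esub> W \<triangleleft>\<^bsub>MN\<^esub> r"
    and rsmult_pure: "\<lbrakk>m \<in> carrier M; n \<in> carrier N\<rbrakk> \<Longrightarrow> pt m n \<triangleleft>\<^bsub>MN\<^esub> r = pt m (n \<triangleleft>\<^bsub>N\<^esub> r)"
proof -
  interpret B: bimodule A T N by fact
  let ?E = "frag_extend (\<lambda>(m, n). frag_of (m, n \<triangleleft>\<^bsub>N\<^esub> r))"
  have E: "cls t \<triangleleft>\<^bsub>MN\<^esub> r = cls (?E t)" and supp: "supported (?E t)" if "supported t" for t
  proof -
    note * = action_cls[of "\<lambda>m. m" "\<lambda>n. n \<triangleleft>\<^bsub>N\<^esub> r" t, OF _ _ _ _ _ _ that]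
    have "(\<Union>u\<in>cls t. cls (?E u)) = cls (?E t)"
      by (rule *(1)) (use r in \<open>simp_all add: B.rsmult_closed B.rsmult_l_distr B.bismult_assoc\<close>)
    then show "cls t \<triangleleft>\<^bsub>MN\<^esub> r = cls (?E t)"
      by (simp add: tensor_def Let_def)
    show "supported (?E t)"
      by (rule *(2)) (use r in \<open>simp_all add: B.rsmult_closed B.rsmult_l_distr B.bismult_assoc\<close>)
  qed
  show "Z \<triangleleft>\<^bsub>MN\<^esub> r \<in> carrier MN" if "Z \<in> carrier MN"
    using that E supp by (auto simp: tensor_carrier)
  show "(Z \<oplus>\<^bsub>MN\<^esub> W) \<triangleleft>\<^bsub>MN\<^esub> r = Z \<triangleleft>\<^bsub>MN\<^esub> r \<oplus>\<^bsub>MN\<^esub> W \<triangleleft>\<^bsub>MN\<^esub> r"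
    if ZW: "Z \<in> carrier MN" "W \<in> carrier MN"
  proof -
    obtain u v where uv: "supported u" "supported v" "Z = cls u" "W = cls v"
      using ZW by (auto simp: tensor_carrier)
    then have "supported (u + v)"
      using keys_add[of u v] by auto
    then show ?thesis
      using uv by (simp add: cls_add E supp frag_extend_add)
  qed
  show "pt m n \<triangleleft>\<^bsub>MN\<^esub> r = pt m (n \<triangleleft>\<^bsub>N\<^esub> r)" if "m \<in> carrier M" "n \<in> carrier N"
    using that by (simp add: pure_tensor_def E supported_of)
qed

text \<open>Every law is additive in the tensor and so follows from its validity on pure tensors.\<close>

lemma tensor_bimodule:
  assumes M: "bimodule S A M" and N: "bimodule A T N"
  shows "bimodule S T MN"
proof -
  interpret BM: bimodule S A M by fact
  interpret BN: bimodule A T N by fact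
  note l = smult_closed[OF M] smult_add[OF M] smult_pure[OF M]
  note r = rsmult_closed[OF N] rsmult_add[OF N] rsmult_pure[OF N]
  have "left_module S MN"
  proof (intro left_module.intro left_module_axioms.intro)
    show "(s \<oplus>\<^bsub>S\<^esub> t) \<odot>\<^bsub>MN\<^esub> Z = s \<odot>\<^bsub>MN\<^esub> Z \<oplus>\<^bsub>MN\<^esub> t \<odot>\<^bsub>MN\<^esub> Z"
      if st: "s \<in> carrier S" "t \<in> carrier S" and Z: "Z \<in> carrier MN" for s t Z
      using Z
    proof (induction rule: tensor_induct)
      case (pure m n) then show ?case
        using st by (simp add: l BM.lsmult_l_distr BM.lsmult_closed pure_add_left)
    next
      case (add Z W) then show ?case
        using st by (simp add: l MN.a_ac)
    qed
    show "(s \<otimes>\<^bsub>S\<^esub> t) \<odot>\<^bsub>MN\<^esub> Z = s \<odot>\<^bsub>MN\<^esub> (t \<odot>\<^bsub>MN\<^esub> Z)"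
      if st: "s \<in> carrier S" "t \<in> carrier S" and Z: "Z \<in> carrier MN" for s t Z
      using Z
    proof (induction rule: tensor_induct)
      case (pure m n) then show ?case
        using st by (simp add: l BM.lsmult_assoc BM.lsmult_closed)
    next
      case (add Z W) then show ?case
        using st by (simp add: l)
    qed
    show "\<one>\<^bsub>S\<^esub> \<odot>\<^bsub>MN\<^esub> Z = Z" if Z: "Z \<in> carrier MN" for Z
      using Z
      by (induction rule: tensor_induct) (simp_all add: l BM.lsmult_one)
  qed (simp_all add: l BM.S.ring_axioms tensor_abelian_group)
  moreover have "right_module T MN"
  proof (intro right_module.intro right_module_axioms.intro)
    show "Z \<triangleleft>\<^bsub>MN\<^esub> (s \<oplus>\<^bsub>T\<^esub> t) = Z \<triangleleft>\<^bsub>MN\<^esub> s \<oplus>\<^bsub>MN\<^esub> Z \<triangleleft>\<^bsub>MN\<^esub> t"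
      if st: "s \<in> carrier T" "t \<in> carrier T" and Z: "Z \<in> carrier MN" for s t Z
      using Z
    proof (induction rule: tensor_induct)
      case (pure m n) then show ?case
        using st by (simp add: r BN.rsmult_r_distr BN.rsmult_closed pure_add_right)
    next
      case (add Z W) then show ?case
        using st by (simp add: r MN.a_ac)
    qed
    show "Z \<triangleleft>\<^bsub>MN\<^esub> (s \<otimes>\<^bsub>T\<^esub> t) = (Z \<triangleleft>\<^bsub>MN\<^esub> s) \<triangleleft>\<^bsub>MN\<^esub> t"
      if st: "s \<in> carrier T" "t \<in> carrier T" and Z: "Z \<in> carrier MN" for s t Z
      using Z
    proof (induction rule: tensor_induct)
      case (pure m n) then show ?case
        using st by (simp add: r BN.rsmult_assoc BN.rsmult_closed)
    next
      case (add Z W) then show ?case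
        using st by (simp add: r)
    qed
    show "Z \<triangleleft>\<^bsub>MN\<^esub> \<one>\<^bsub>T\<^esub> = Z" if Z: "Z \<in> carrier MN" for Z
      using Z
      by (induction rule: tensor_induct) (simp_all add: r BN.rsmult_one)
  qed (simp_all add: r BN.R.ring_axioms tensor_abelian_group)
  moreover have "(s \<odot>\<^bsub>MN\<^esub> Z) \<triangleleft>\<^bsub>MN\<^esub> t = s \<odot>\<^bsub>MN\<^esub> (Z \<triangleleft>\<^bsub>MN\<^esub> t)"
    if st: "s \<in> carrier S" "t \<in> carrier T" and Z: "Z \<in> carrier MN" for s t Z
    using Z
  proof (induction rule: tensor_induct)
    case (pure m n) then show ?case
      using st by (simp add: l r BM.lsmult_closed BN.rsmult_closed)
  next
    case (add Z W) then show ?case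
      using st by (simp add: l r)
  qed
  ultimately show ?thesis
    by (intro bimodule.intro bimodule_axioms.intro)
qed

end

section \<open>Contraction along the comultiplication\<close>

lemma tensor_pairI: "bimodule S A M \<Longrightarrow> bimodule A T N \<Longrightarrow> tensor_pair A M N"
  by (simp add: tensor_pair_def bimodule_def)

lemma regular_bimodule_simps:
  "carrier (regular_bimodule A) = carrier A" "\<zero>\<^bsub>regular_bimodule A\<^esub> = \<zero>\<^bsub>A\<^esub>"
  "x \<oplus>\<^bsub>regular_bimodule A\<^esub> y = x \<oplus>\<^bsub>A\<^esub> y" "x \<odot>\<^bsub>regular_bimodule A\<^esub> y = x \<otimes>\<^bsub>A\<^esub> y"
  "x \<triangleleft>\<^bsub>regular_bimodule A\<^esub> y = x \<otimes>\<^bsub>A\<^esub> y"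
  by (simp_all add: regular_bimodule_def)

lemma (in ring) bimodule_regular: "bimodule R R (regular_bimodule R)"
proof -
  have "abelian_group (regular_bimodule R)"
    using add.l_inv_ex by (intro abelian_groupI) (simp_all add: regular_bimodule_simps a_ac)
  then show ?thesis
    by (intro bimodule.intro left_module.intro right_module.intro left_module_axioms.intro
        right_module_axioms.intro bimodule_axioms.intro ring_axioms)
      (simp_all add: regular_bimodule_simps m_assoc l_distr r_distr)
qed

context group_coring
begin

abbreviation functionals :: "'g \<Rightarrow> ('c \<Rightarrow> 'a) set" where
  "functionals \<delta> \<equiv> left_linear A (C \<delta>) (regular_bimodule A)"

lemma functionalsI:
  assumes "\<And>c. c \<in> carrier (C \<delta>) \<Longrightarrow> f c \<in> carrier A"
    and "\<And>c d. \<lbrakk>c \<in> carrier (C \<delta>); d \<in> carrier (C \<delta>)\<rbrakk> \<Longrightarrow> f (c \<oplus>\<^bsub>C \<delta>\<^esub> d) = f c \<oplus>\<^bsub>A\<^esub> f d"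
    and "\<And>a c. \<lbrakk>a \<in> carrier A; c \<in> carrier (C \<delta>)\<rbrakk> \<Longrightarrow> f (a \<odot>\<^bsub>C \<delta>\<^esub> c) = a \<otimes>\<^bsub>A\<^esub> f c"
  shows "f \<in> functionals \<delta>"
  using assms by (simp add: left_linear_def regular_bimodule_simps)

lemma
  assumes "f \<in> functionals \<delta>"
  shows functional_closed: "c \<in> carrier (C \<delta>) \<Longrightarrow> f c \<in> carrier A"
    and functional_add: "\<lbrakk>c \<in> carrier (C \<delta>); d \<in> carrier (C \<delta>)\<rbrakk> \<Longrightarrow> f (c \<oplus>\<^bsub>C \<delta>\<^esub> d) = f c \<oplus>\<^bsub>A\<^esub> f d"
    and functional_smult: "\<lbrakk>a \<in> carrier A; c \<in> carrier (C \<delta>)\<rbrakk> \<Longrightarrow> f (a \<odot>\<^bsub>C \<delta>\<^esub> c) = a \<otimes>\<^bsub>A\<^esub> f c"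
  using assms by (auto simp: left_linear_def regular_bimodule_simps)

lemma functionals_cong:
  assumes "f \<in> functionals \<delta>" "\<And>c. c \<in> carrier (C \<delta>) \<Longrightarrow> g c = f c" "\<delta> \<in> carrier G"
  shows "g \<in> functionals \<delta>"
proof -
  interpret bimodule A A "C \<delta>" by (rule bimodule_C) fact
  show ?thesis
    using assms(1) by (intro functionalsI)
      (simp_all add: assms(2) functional_closed functional_add functional_smult lsmult_closed)
qed

lemma functional_precomp:
  assumes \<delta>: "\<delta> \<in> carrier G" and f: "f \<in> functionals \<delta>" and a: "a \<in> carrier A"
  shows "(\<lambda>d. f (d \<triangleleft>\<^bsub>C \<delta>\<^esub> a)) \<in> functionals \<delta>"
proof -
  interpret bimodule A A "C \<delta>" by (rule bimodule_C) fact
  show ?thesis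
    using a by (intro functionalsI) (simp_all add: functional_closed[OF f] functional_add[OF f]
        functional_smult[OF f] rsmult_closed rsmult_l_distr bismult_assoc)
qed

lemma functional_postmult:
  assumes f: "f \<in> functionals \<delta>" and b: "b \<in> carrier A"
  shows "(\<lambda>d. f d \<otimes>\<^bsub>A\<^esub> b) \<in> functionals \<delta>"
  using b by (intro functionalsI) (simp_all add: functional_closed[OF f] functional_add[OF f]
      functional_smult[OF f] A.l_distr A.m_assoc)

lemma functional_plus:
  assumes f: "f \<in> functionals \<delta>" and g: "g \<in> functionals \<delta>"
  shows "(\<lambda>d. f d \<oplus>\<^bsub>A\<^esub> g d) \<in> functionals \<delta>"
  by (intro functionalsI) (simp_all add: functional_closed[OF f] functional_add[OF f]
      functional_smult[OF f] functional_closed[OF g] functional_add[OF g]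
      functional_smult[OF g] A.r_distr A.a_ac)

lemma functional_zero: "(\<lambda>d. \<zero>\<^bsub>A\<^esub>) \<in> functionals \<delta>"
  by (intro functionalsI) simp_all

lemma tensor_pair_C: "\<lbrakk>\<gamma> \<in> carrier G; \<delta> \<in> carrier G\<rbrakk> \<Longrightarrow> tensor_pair A (C \<gamma>) (C \<delta>)"
  by (rule tensor_pairI[OF bimodule_C bimodule_C])

lemma bimodule_CC: "\<lbrakk>\<gamma> \<in> carrier G; \<delta> \<in> carrier G\<rbrakk> \<Longrightarrow> bimodule A A (tensor A (C \<gamma>) (C \<delta>))"
  by (intro tensor_pair.tensor_bimodule tensor_pair_C bimodule_C)

text \<open>The second half of \<open>comult_apply\<close>. It is kept apart because identities are proved by induction
  over all tensors in \<open>C\<^sub>\<gamma> \<otimes> C\<^sub>\<delta>\<close>, not only over those in the image of \<open>\<Delta>\<close>.\<close>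

definition contract :: "'g \<Rightarrow> ('c \<Rightarrow> 'a) \<Rightarrow> ('c \<times> 'c \<Rightarrow>\<^sub>0 int) set \<Rightarrow> 'c" where
  "contract \<gamma> f = tensor_lift (C \<gamma>) (\<lambda>c1 c2. c1 \<triangleleft>\<^bsub>C \<gamma>\<^esub> f c2)"

lemma comult_apply_contract: "comult_apply \<gamma> \<delta> f c = contract \<gamma> f (\<Delta> \<gamma> \<delta> c)"
  by (simp add: comult_apply_def contract_def)

context
  fixes \<gamma> \<delta> assumes \<gamma>: "\<gamma> \<in> carrier G" and \<delta>: "\<delta> \<in> carrier G"
begin

interpretation C\<gamma>: bimodule A A "C \<gamma>" by (rule bimodule_C[OF \<gamma>])
interpretation C\<delta>: bimodule A A "C \<delta>" by (rule bimodule_C[OF \<delta>])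
interpretation CC: tensor_pair A "C \<gamma>" "C \<delta>" by (rule tensor_pair_C[OF \<gamma> \<delta>])

lemma contract_balanced:
  assumes f: "f \<in> functionals \<delta>"
  shows "balanced_map A (C \<gamma>) (C \<delta>) (C \<gamma>) (\<lambda>c1 c2. c1 \<triangleleft>\<^bsub>C \<gamma>\<^esub> f c2)"
  by (rule balanced_mapI)
    (simp_all add: functional_closed[OF f] functional_add[OF f] functional_smult[OF f]
      C\<gamma>.rsmult_closed C\<gamma>.rsmult_l_distr C\<gamma>.rsmult_r_distr C\<gamma>.rsmult_assoc)

lemma
  assumes f: "f \<in> functionals \<delta>"
  shows contract_pure: "\<lbrakk>c \<in> carrier (C \<gamma>); d \<in> carrier (C \<delta>)\<rbrakk> \<Longrightarrow>
      contract \<gamma> f (pure_tensor A (C \<gamma>) (C \<delta>) c d) = c \<triangleleft>\<^bsub>C \<gamma>\<^esub> f d"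
    and contract_closed: "Z \<in> carrier CC.MN \<Longrightarrow> contract \<gamma> f Z \<in> carrier (C \<gamma>)"
    and contract_add: "\<lbrakk>Z \<in> carrier CC.MN; W \<in> carrier CC.MN\<rbrakk> \<Longrightarrow>
      contract \<gamma> f (Z \<oplus>\<^bsub>CC.MN\<^esub> W) = contract \<gamma> f Z \<oplus>\<^bsub>C \<gamma>\<^esub> contract \<gamma> f W"
  unfolding contract_def
  using CC.tensor_lift_pure CC.tensor_lift_closed CC.tensor_lift_add
    C\<gamma>.M.abelian_group_axioms contract_balanced[OF f] by blast+

lemma contract_smult:
  assumes f: "f \<in> functionals \<delta>" and a: "a \<in> carrier A" and Z: "Z \<in> carrier CC.MN"
  shows "contract \<gamma> f (a \<odot>\<^bsub>CC.MN\<^esub> Z) = a \<odot>\<^bsub>C \<gamma>\<^esub> contract \<gamma> f Z"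
  using Z
proof (induction rule: CC.tensor_induct)
  case (pure m n)
  then show ?case
    using a by (simp add: CC.smult_pure[OF bimodule_C[OF \<gamma>]] contract_pure[OF f] C\<gamma>.lsmult_closed
        C\<gamma>.bismult_assoc functional_closed[OF f])
next
  case (add Z W)
  then show ?case
    using a by (simp add: CC.smult_add[OF bimodule_C[OF \<gamma>]] CC.smult_closed[OF bimodule_C[OF \<gamma>]]
        contract_add[OF f] contract_closed[OF f] C\<gamma>.lsmult_r_distr)
qed

lemma contract_rsmult:
  assumes f: "f \<in> functionals \<delta>" and a: "a \<in> carrier A" and Z: "Z \<in> carrier CC.MN"
  shows "contract \<gamma> f (Z \<triangleleft>\<^bsub>CC.MN\<^esub> a) = contract \<gamma> (\<lambda>d. f (d \<triangleleft>\<^bsub>C \<delta>\<^esub> a)) Z"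
  using Z
proof (induction rule: CC.tensor_induct)
  case (pure m n)
  then show ?case
    using a by (simp add: CC.rsmult_pure[OF bimodule_C[OF \<delta>]] contract_pure[OF f] C\<delta>.rsmult_closed
        contract_pure[OF functional_precomp[OF \<delta> f a]])
next
  case (add Z W)
  then show ?case
    using a by (simp add: CC.rsmult_add[OF bimodule_C[OF \<delta>]] CC.rsmult_closed[OF bimodule_C[OF \<delta>]]
        contract_add[OF f] contract_add[OF functional_precomp[OF \<delta> f a]])
qed

text \<open>The functional \<open>h\<close> is described pointwise on the carrier because components of elements of the
  dual ring are extensional, which \<open>\<lambda>d. f d \<otimes> b\<close> is not.\<close>

lemma contract_postmult:
  assumes f: "f \<in> functionals \<delta>" and h: "h \<in> functionals \<delta>" and b: "b \<in> carrier A"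
    and fh: "\<And>d. d \<in> carrier (C \<delta>) \<Longrightarrow> h d = f d \<otimes>\<^bsub>A\<^esub> b" and Z: "Z \<in> carrier CC.MN"
  shows "contract \<gamma> h Z = contract \<gamma> f Z \<triangleleft>\<^bsub>C \<gamma>\<^esub> b"
  using Z
proof (induction rule: CC.tensor_induct)
  case (pure m n)
  then show ?case
    using b by (simp add: contract_pure[OF f] contract_pure[OF h] fh functional_closed[OF f] C\<gamma>.rsmult_assoc)
next
  case (add Z W)
  then show ?case
    using b by (simp add: contract_add[OF f] contract_add[OF h] contract_closed[OF f] C\<gamma>.rsmult_l_distr)
qed

lemma contract_plus:
  assumes f: "f \<in> functionals \<delta>" and g: "g \<in> functionals \<delta>" and h: "h \<in> functionals \<delta>"
    and fgh: "\<And>d. d \<in> carrier (C \<delta>) \<Longrightarrow> h d = f d \<oplus>\<^bsub>A\<^esub> g d" and Z: "Z \<in> carrier CC.MN"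
  shows "contract \<gamma> h Z = contract \<gamma> f Z \<oplus>\<^bsub>C \<gamma>\<^esub> contract \<gamma> g Z"
  using Z
proof (induction rule: CC.tensor_induct)
  case (pure m n)
  then show ?case
    by (simp add: contract_pure[OF f] contract_pure[OF g] contract_pure[OF h] fgh
        functional_closed[OF f] functional_closed[OF g] C\<gamma>.rsmult_r_distr)
next
  case (add Z W)
  then show ?case
    by (simp add: contract_add[OF f] contract_add[OF g] contract_add[OF h]
        contract_closed[OF f] contract_closed[OF g] C\<gamma>.M.a_ac)
qed

lemma contract_cong:
  assumes f: "f \<in> functionals \<delta>" and fg: "\<And>d. d \<in> carrier (C \<delta>) \<Longrightarrow> g d = f d"
    and Z: "Z \<in> carrier CC.MN"
  shows "contract \<gamma> g Z = contract \<gamma> f Z"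
proof -
  have g: "g \<in> functionals \<delta>"
    using f fg \<delta> by (rule functionals_cong)
  show ?thesis
    using Z
    by (induction rule: CC.tensor_induct)
      (simp_all add: contract_pure[OF f] contract_pure[OF g] contract_add[OF f] contract_add[OF g] fg)
qed

lemma comult_left_linear: "\<Delta> \<gamma> \<delta> \<in> left_linear A (C (\<gamma> \<otimes>\<^bsub>G\<^esub> \<delta>)) CC.MN"
  using comult_hom[OF \<gamma> \<delta>] by (simp add: bimodule_hom_def)

lemma
  shows comult_closed: "c \<in> carrier (C (\<gamma> \<otimes>\<^bsub>G\<^esub> \<delta>)) \<Longrightarrow> \<Delta> \<gamma> \<delta> c \<in> carrier CC.MN"
    and comult_add: "\<lbrakk>c \<in> carrier (C (\<gamma> \<otimes>\<^bsub>G\<^esub> \<delta>)); d \<in> carrier (C (\<gamma> \<otimes>\<^bsub>G\<^esub> \<delta>))\<rbrakk> \<Longrightarrow>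
      \<Delta> \<gamma> \<delta> (c \<oplus>\<^bsub>C (\<gamma> \<otimes>\<^bsub>G\<^esub> \<delta>)\<^esub> d) = \<Delta> \<gamma> \<delta> c \<oplus>\<^bsub>CC.MN\<^esub> \<Delta> \<gamma> \<delta> d"
    and comult_smult: "\<lbrakk>a \<in> carrier A; c \<in> carrier (C (\<gamma> \<otimes>\<^bsub>G\<^esub> \<delta>))\<rbrakk> \<Longrightarrow>
      \<Delta> \<gamma> \<delta> (a \<odot>\<^bsub>C (\<gamma> \<otimes>\<^bsub>G\<^esub> \<delta>)\<^esub> c) = a \<odot>\<^bsub>CC.MN\<^esub> \<Delta> \<gamma> \<delta> c"
    and comult_rsmult: "\<lbrakk>a \<in> carrier A; c \<in> carrier (C (\<gamma> \<otimes>\<^bsub>G\<^esub> \<delta>))\<rbrakk> \<Longrightarrow>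
      \<Delta> \<gamma> \<delta> (c \<triangleleft>\<^bsub>C (\<gamma> \<otimes>\<^bsub>G\<^esub> \<delta>)\<^esub> a) = \<Delta> \<gamma> \<delta> c \<triangleleft>\<^bsub>CC.MN\<^esub> a"
  using comult_hom[OF \<gamma> \<delta>] by (simp_all add: bimodule_hom_def left_linear_def Pi_iff)

context
  fixes f assumes f: "f \<in> functionals \<delta>"
begin

lemma comult_apply_closed:
  "c \<in> carrier (C (\<gamma> \<otimes>\<^bsub>G\<^esub> \<delta>)) \<Longrightarrow> comult_apply \<gamma> \<delta> f c \<in> carrier (C \<gamma>)"
  by (simp add: comult_apply_contract contract_closed[OF f] comult_closed)

lemma comult_apply_add:
  "\<lbrakk>c \<in> carrier (C (\<gamma> \<otimes>\<^bsub>G\<^esub> \<delta>)); d \<in> carrier (C (\<gamma> \<otimes>\<^bsub>G\<^esub> \<delta>))\<rbrakk> \<Longrightarrow>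
    comult_apply \<gamma> \<delta> f (c \<oplus>\<^bsub>C (\<gamma> \<otimes>\<^bsub>G\<^esub> \<delta>)\<^esub> d) = comult_apply \<gamma> \<delta> f c \<oplus>\<^bsub>C \<gamma>\<^esub> comult_apply \<gamma> \<delta> f d"
  by (simp add: comult_apply_contract contract_add[OF f] comult_closed comult_add)

lemma comult_apply_smult:
  "\<lbrakk>a \<in> carrier A; c \<in> carrier (C (\<gamma> \<otimes>\<^bsub>G\<^esub> \<delta>))\<rbrakk> \<Longrightarrow>
    comult_apply \<gamma> \<delta> f (a \<odot>\<^bsub>C (\<gamma> \<otimes>\<^bsub>G\<^esub> \<delta>)\<^esub> c) = a \<odot>\<^bsub>C \<gamma>\<^esub> comult_apply \<gamma> \<delta> f c"
  by (simp add: comult_apply_contract contract_smult[OF f] comult_closed comult_smult)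

lemma comult_apply_rsmult:
  "\<lbrakk>a \<in> carrier A; c \<in> carrier (C (\<gamma> \<otimes>\<^bsub>G\<^esub> \<delta>))\<rbrakk> \<Longrightarrow>
    comult_apply \<gamma> \<delta> f (c \<triangleleft>\<^bsub>C (\<gamma> \<otimes>\<^bsub>G\<^esub> \<delta>)\<^esub> a) = comult_apply \<gamma> \<delta> (\<lambda>d. f (d \<triangleleft>\<^bsub>C \<delta>\<^esub> a)) c"
  by (simp add: comult_apply_contract contract_rsmult[OF f] comult_closed comult_rsmult)

lemma comult_apply_postmult:
  assumes "h \<in> functionals \<delta>" "b \<in> carrier A" "\<And>d. d \<in> carrier (C \<delta>) \<Longrightarrow> h d = f d \<otimes>\<^bsub>A\<^esub> b"
    and "c \<in> carrier (C (\<gamma> \<otimes>\<^bsub>G\<^esub> \<delta>))"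
  shows "comult_apply \<gamma> \<delta> h c = comult_apply \<gamma> \<delta> f c \<triangleleft>\<^bsub>C \<gamma>\<^esub> b"
  using assms by (simp add: comult_apply_contract comult_closed contract_postmult[OF f])

lemma comult_apply_plus:
  assumes "g \<in> functionals \<delta>" "h \<in> functionals \<delta>" "\<And>d. d \<in> carrier (C \<delta>) \<Longrightarrow> h d = f d \<oplus>\<^bsub>A\<^esub> g d"
    and "c \<in> carrier (C (\<gamma> \<otimes>\<^bsub>G\<^esub> \<delta>))"
  shows "comult_apply \<gamma> \<delta> h c = comult_apply \<gamma> \<delta> f c \<oplus>\<^bsub>C \<gamma>\<^esub> comult_apply \<gamma> \<delta> g c"
  using assms by (simp add: comult_apply_contract comult_closed contract_plus[OF f])

lemma comult_apply_cong:
  assumes "\<And>d. d \<in> carrier (C \<delta>) \<Longrightarrow> g d = f d" and "c \<in> carrier (C (\<gamma> \<otimes>\<^bsub>G\<^esub> \<delta>))"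
  shows "comult_apply \<gamma> \<delta> g c = comult_apply \<gamma> \<delta> f c"
  unfolding comult_apply_contract
  by (rule contract_cong[OF f assms(1)]) (use assms(2) comult_closed in auto)

lemma comult_apply_functional:
  assumes g: "g \<in> functionals \<gamma>"
  shows "(\<lambda>c. g (comult_apply \<gamma> \<delta> f c)) \<in> functionals (\<gamma> \<otimes>\<^bsub>G\<^esub> \<delta>)"
  by (intro functionalsI) (simp_all add: comult_apply_closed comult_apply_add comult_apply_smult
      functional_closed[OF g] functional_add[OF g] functional_smult[OF g])

end

end

lemma comult_apply_zero:
  assumes "\<gamma> \<in> carrier G" "\<delta> \<in> carrier G"
    and c: "c \<in> carrier (C (\<gamma> \<otimes>\<^bsub>G\<^esub> \<delta>))" and f: "\<And>d. d \<in> carrier (C \<delta>) \<Longrightarrow> f d = \<zero>\<^bsub>A\<^esub>"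
  shows "comult_apply \<gamma> \<delta> f c = \<zero>\<^bsub>C \<gamma>\<^esub>"
proof -
  interpret C\<gamma>: bimodule A A "C \<gamma>" by (rule bimodule_C) fact
  have f': "f \<in> functionals \<delta>"
    by (rule functionals_cong[OF functional_zero]) (use assms in auto)
  have "comult_apply \<gamma> \<delta> f c = comult_apply \<gamma> \<delta> f c \<oplus>\<^bsub>C \<gamma>\<^esub> comult_apply \<gamma> \<delta> f c"
    by (rule comult_apply_plus) (use assms f' in auto)
  then show ?thesis
    using comult_apply_closed[OF assms(1,2) f' c] by (metis C\<gamma>.M.add.l_cancel_one')
qed

text \<open>The additive map \<open>\<Phi>\<close> with
  \<open>l \<otimes> (m \<otimes> n) \<mapsto> l g(m f(n))\<close> sends one side of the coassociativity law for \<open>c\<close> to the left hand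
  side below and the other to the right hand side. For functionals in the dual ring, \<open>h\<close> is the
  product \<open>f # g\<close>.\<close>

lemma comult_apply_coassoc:
  assumes G: "\<beta> \<in> carrier G" "\<gamma> \<in> carrier G" "\<delta> \<in> carrier G"
    and f: "f \<in> functionals \<delta>" and g: "g \<in> functionals \<gamma>"
    and c: "c \<in> carrier (C (\<beta> \<otimes>\<^bsub>G\<^esub> \<gamma> \<otimes>\<^bsub>G\<^esub> \<delta>))"
    and h: "\<And>d. d \<in> carrier (C (\<gamma> \<otimes>\<^bsub>G\<^esub> \<delta>)) \<Longrightarrow> h d = g (comult_apply \<gamma> \<delta> f d)"
  shows "comult_apply \<beta> \<gamma> g (comult_apply (\<beta> \<otimes>\<^bsub>G\<^esub> \<gamma>) \<delta> f c) = comult_apply \<beta> (\<gamma> \<otimes>\<^bsub>G\<^esub> \<delta>) h c"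
proof -
  let ?L = "C \<beta>" and ?M = "C \<gamma>" and ?N = "C \<delta>"
  interpret L: bimodule A A ?L by (rule bimodule_C) fact
  interpret M: bimodule A A ?M by (rule bimodule_C) fact
  interpret N: bimodule A A ?N by (rule bimodule_C) fact
  interpret BG: bimodule A A "C (\<beta> \<otimes>\<^bsub>G\<^esub> \<gamma>)" by (rule bimodule_C) (use G in simp)
  interpret GD: bimodule A A "C (\<gamma> \<otimes>\<^bsub>G\<^esub> \<delta>)" by (rule bimodule_C) (use G in simp)
  interpret LM: tensor_pair A ?L ?M by (rule tensor_pair_C; fact)
  interpret MN: tensor_pair A ?M ?N by (rule tensor_pair_C; fact)
  interpret bLM: bimodule A A LM.MN by (rule bimodule_CC; fact)
  interpret bMN: bimodule A A MN.MN by (rule bimodule_CC; fact)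
  interpret L_MN: tensor_pair A ?L MN.MN
    by (rule tensor_pairI[OF L.bimodule_axioms bMN.bimodule_axioms])
  interpret LM_N: tensor_pair A LM.MN ?N
    by (rule tensor_pairI[OF bLM.bimodule_axioms N.bimodule_axioms])
  interpret BGN: tensor_pair A "C (\<beta> \<otimes>\<^bsub>G\<^esub> \<gamma>)" ?N by (rule tensor_pair_C) (use G in simp_all)
  interpret LGD: tensor_pair A ?L "C (\<gamma> \<otimes>\<^bsub>G\<^esub> \<delta>)" by (rule tensor_pair_C) (use G in simp_all)
  interpret bL_MN: bimodule A A L_MN.MN
    by (rule L_MN.tensor_bimodule[OF L.bimodule_axioms bMN.bimodule_axioms])
  have h': "h \<in> functionals (\<gamma> \<otimes>\<^bsub>G\<^esub> \<delta>)"
    by (rule functionals_cong[OF comult_apply_functional[OF G(2,3) f g]]) (use h G in simp_all)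
  note cf = contract_closed[OF G(2,3) f] contract_add[OF G(2,3) f] contract_smult[OF G(2,3) f]
    contract_pure[OF G(2,3) f]
  note fg = functional_closed[OF f] functional_closed[OF g] functional_add[OF g] functional_smult[OF g]
  define \<Phi> where "\<Phi> = tensor_lift ?L (\<lambda>l w. l \<triangleleft>\<^bsub>?L\<^esub> g (contract \<gamma> f w))"
  have bal_\<Phi>: "balanced_map A ?L MN.MN ?L (\<lambda>l w. l \<triangleleft>\<^bsub>?L\<^esub> g (contract \<gamma> f w))"
    by (rule balanced_mapI)
      (simp_all add: cf fg L.rsmult_closed L.rsmult_l_distr L.rsmult_r_distr L.rsmult_assoc)
  note \<Phi>_pure = L_MN.tensor_lift_pure[OF L.M.abelian_group_axioms bal_\<Phi>, folded \<Phi>_def]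
  note \<Phi>_add = L_MN.tensor_lift_add[OF L.M.abelian_group_axioms bal_\<Phi>, folded \<Phi>_def]

  \<comment> \<open>The associator is a lift within a lift: \<open>asc n\<close> is its inner layer, for a fixed last factor.\<close>
  define asc where "asc n = tensor_lift L_MN.MN (\<lambda>l m. L_MN.pt l (MN.pt m n))" for n
  have bal_asc: "balanced_map A ?L ?M L_MN.MN (\<lambda>l m. L_MN.pt l (MN.pt m n))"
    if n: "n \<in> carrier ?N" for n
  proof (rule balanced_mapI, goal_cases)
    case (1 l m) then show ?case using n by (intro L_MN.pure_closed MN.pure_closed)
  next
    case (2 l l' m) then show ?case using n by (intro L_MN.pure_add_left MN.pure_closed)
  next
    case (3 l m m') then show ?case using n
      by (simp only: MN.pure_add_left L_MN.pure_add_right MN.pure_closed)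
  next
    case (4 l a m) then show ?case using n
      by (simp only: MN.smult_pure[OF M.bimodule_axioms] L_MN.pure_balanced MN.pure_closed)
  qed
  note asc_pure = LM.tensor_lift_pure[OF L_MN.tensor_abelian_group bal_asc, folded asc_def]
  note asc_add = LM.tensor_lift_add[OF L_MN.tensor_abelian_group bal_asc, folded asc_def]
  note asc_closed = LM.tensor_lift_closed[OF L_MN.tensor_abelian_group bal_asc, folded asc_def]
  have asc_add_right: "asc (n \<oplus>\<^bsub>?N\<^esub> n') W = asc n W \<oplus>\<^bsub>L_MN.MN\<^esub> asc n' W"
    if n: "n \<in> carrier ?N" "n' \<in> carrier ?N" and W: "W \<in> carrier LM.MN" for n n' W
    using W
  proof (induction rule: LM.tensor_induct)
    case (pure l m)
    then show ?case
      using n by (simp add: asc_pure MN.pure_add_right L_MN.pure_add_right MN.pure_closed)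
  next
    case (add Z W)
    then show ?case
      using n by (simp add: asc_add asc_closed L_MN.MN.a_ac)
  qed
  have asc_bal: "asc n (W \<triangleleft>\<^bsub>LM.MN\<^esub> a) = asc (a \<odot>\<^bsub>?N\<^esub> n) W"
    if n: "n \<in> carrier ?N" and a: "a \<in> carrier A" and W: "W \<in> carrier LM.MN" for n a W
    using W
  proof (induction rule: LM.tensor_induct)
    case (pure l m)
    then show ?case
      using n a by (simp add: LM.rsmult_pure[OF M.bimodule_axioms] asc_pure MN.pure_balanced
          M.rsmult_closed N.lsmult_closed)
  next
    case (add Z W)
    then show ?case
      using n a by (simp add: LM.rsmult_add[OF M.bimodule_axioms] LM.rsmult_closed[OF M.bimodule_axioms]
          asc_add N.lsmult_closed)
  qed
  have bal_assoc: "balanced_map A LM.MN ?N L_MN.MN (\<lambda>W n. asc n W)"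
    by (rule balanced_mapI) (simp_all add: asc_closed asc_add asc_add_right asc_bal)
  have assoc_eq: "tensor_assoc A ?L ?M ?N = tensor_lift L_MN.MN (\<lambda>W n. asc n W)"
    by (simp add: tensor_assoc_def Let_def asc_def fun_eq_iff)
  note assoc_pure = LM_N.tensor_lift_pure[OF L_MN.tensor_abelian_group bal_assoc, folded assoc_eq]
  note assoc_add = LM_N.tensor_lift_add[OF L_MN.tensor_abelian_group bal_assoc, folded assoc_eq]
  note assoc_closed = LM_N.tensor_lift_closed[OF L_MN.tensor_abelian_group bal_assoc, folded assoc_eq]

  \<comment> \<open>The maps \<open>\<Delta> \<otimes> id\<close> and \<open>id \<otimes> \<Delta>\<close> that occur in the coassociativity law.\<close>
  have bal1: "balanced_map A (C (\<beta> \<otimes>\<^bsub>G\<^esub> \<gamma>)) ?N LM_N.MN (\<lambda>d n. LM_N.pt (\<Delta> \<beta> \<gamma> d) (id n))"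
    by (rule BGN.tensor_map_balanced[OF LM_N.tensor_pair_axioms])
      (simp_all add: comult_closed comult_add comult_rsmult G left_linear_def)
  note map1_pure = BGN.tensor_lift_pure[OF LM_N.tensor_abelian_group bal1, folded tensor_map_def, unfolded id_apply]
  note map1_add = BGN.tensor_lift_add[OF LM_N.tensor_abelian_group bal1, folded tensor_map_def, unfolded id_apply]
  note map1_closed = BGN.tensor_lift_closed[OF LM_N.tensor_abelian_group bal1, folded tensor_map_def, unfolded id_apply]
  have bal2: "balanced_map A ?L (C (\<gamma> \<otimes>\<^bsub>G\<^esub> \<delta>)) L_MN.MN (\<lambda>l d. L_MN.pt (id l) (\<Delta> \<gamma> \<delta> d))"
    by (rule LGD.tensor_map_balanced[OF L_MN.tensor_pair_axioms])
      (simp_all add: comult_left_linear G)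
  note map2_pure = LGD.tensor_lift_pure[OF L_MN.tensor_abelian_group bal2, folded tensor_map_def, unfolded id_apply]
  note map2_add = LGD.tensor_lift_add[OF L_MN.tensor_abelian_group bal2, folded tensor_map_def, unfolded id_apply]
  note map2_closed = LGD.tensor_lift_closed[OF L_MN.tensor_abelian_group bal2, folded tensor_map_def, unfolded id_apply]

  have key: "\<Phi> (asc n W) = contract \<beta> g (W \<triangleleft>\<^bsub>LM.MN\<^esub> f n)"
    if n: "n \<in> carrier ?N" and W: "W \<in> carrier LM.MN" for n W
    using W
  proof (induction rule: LM.tensor_induct)
    case (pure l m)
    then show ?case
      using n by (simp add: asc_pure \<Phi>_pure MN.pure_closed cf LM.rsmult_pure[OF M.bimodule_axioms] fg
          contract_pure[OF G(1,2) g] M.rsmult_closed)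
  next
    case (add Z W)
    then show ?case
      using n by (simp add: asc_add asc_closed \<Phi>_add LM.rsmult_add[OF M.bimodule_axioms] fg
          LM.rsmult_closed[OF M.bimodule_axioms] contract_add[OF G(1,2) g])
  qed
  have G': "\<beta> \<otimes>\<^bsub>G\<^esub> \<gamma> \<in> carrier G" "\<gamma> \<otimes>\<^bsub>G\<^esub> \<delta> \<in> carrier G"
    using G by simp_all
  have left: "\<Phi> (tensor_assoc A ?L ?M ?N (tensor_map A LM.MN ?N (\<Delta> \<beta> \<gamma>) id Z)) =
      comult_apply \<beta> \<gamma> g (contract (\<beta> \<otimes>\<^bsub>G\<^esub> \<gamma>) f Z)" if Z: "Z \<in> carrier BGN.MN" for Z
    using Z
  proof (induction rule: BGN.tensor_induct)
    case (pure d n)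
    then show ?case
      by (simp add: map1_pure assoc_pure comult_closed G key contract_pure[OF G'(1) G(3) f]
          comult_apply_contract comult_rsmult fg)
  next
    case (add Z W)
    then show ?case
      by (simp add: map1_add map1_closed assoc_add assoc_closed \<Phi>_add contract_add[OF G'(1) G(3) f]
          contract_closed[OF G'(1) G(3) f] comult_apply_add[OF G(1,2) g])
  qed
  have right: "\<Phi> (tensor_map A ?L MN.MN id (\<Delta> \<gamma> \<delta>) Z) = contract \<beta> h Z" if Z: "Z \<in> carrier LGD.MN" for Z
    using Z
  proof (induction rule: LGD.tensor_induct)
    case (pure l d)
    then show ?case
      by (simp add: map2_pure \<Phi>_pure comult_closed G contract_pure[OF G(1) G'(2) h'] h comult_apply_contract)
  next
    case (add Z W)
    then show ?case
      by (simp add: map2_add map2_closed \<Phi>_add contract_add[OF G(1) G'(2) h'])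
  qed
  have c': "c \<in> carrier (C (\<beta> \<otimes>\<^bsub>G\<^esub> (\<gamma> \<otimes>\<^bsub>G\<^esub> \<delta>)))"
    using c G by (simp add: G.m_assoc)
  show ?thesis
    unfolding comult_apply_contract[of "\<beta> \<otimes>\<^bsub>G\<^esub> \<gamma>"] comult_apply_contract[of \<beta> "\<gamma> \<otimes>\<^bsub>G\<^esub> \<delta>"]
    using coassoc[OF G c] left[OF comult_closed[OF G'(1) G(3) c]]
      right[OF comult_closed[OF G(1) G'(2) c']] by simp
qed

text \<open>The functional \<open>e\<close> is only required to agree with \<open>\<epsilon>\<close> on the carrier, since the unit of the dual
  ring is the restriction of \<open>\<epsilon>\<close>.\<close>

lemma comult_apply_counit_right:
  assumes \<alpha>: "\<alpha> \<in> carrier G" and c: "c \<in> carrier (C \<alpha>)"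
    and e: "\<And>d. d \<in> carrier (C \<one>\<^bsub>G\<^esub>) \<Longrightarrow> e d = \<epsilon> d"
  shows "comult_apply \<alpha> \<one>\<^bsub>G\<^esub> e c = c"
proof -
  let ?A = "regular_bimodule A"
  interpret L: bimodule A A "C \<alpha>" by (rule bimodule_C) fact
  interpret LE: tensor_pair A "C \<alpha>" "C \<one>\<^bsub>G\<^esub>" by (rule tensor_pair_C) (use \<alpha> in simp_all)
  interpret LA: tensor_pair A "C \<alpha>" ?A
    by (rule tensor_pairI[OF L.bimodule_axioms A.bimodule_regular])
  have \<epsilon>: "\<epsilon> \<in> functionals \<one>\<^bsub>G\<^esub>"
    using counit_hom by (simp add: bimodule_hom_def)
  have bal1: "balanced_map A (C \<alpha>) (C \<one>\<^bsub>G\<^esub>) LA.MN (\<lambda>c d. LA.pt (id c) (\<epsilon> d))"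
    by (rule LE.tensor_map_balanced[OF LA.tensor_pair_axioms]) (simp_all add: \<epsilon>)
  have bal2: "balanced_map A (C \<alpha>) ?A (C \<alpha>) (\<lambda>m a. m \<triangleleft>\<^bsub>C \<alpha>\<^esub> a)"
    by (rule balanced_mapI) (simp_all add: regular_bimodule_simps L.rsmult_closed L.rsmult_l_distr
        L.rsmult_r_distr L.rsmult_assoc)
  note m1 = LE.tensor_lift_pure[OF LA.tensor_abelian_group bal1, folded tensor_map_def, unfolded id_apply]
    LE.tensor_lift_add[OF LA.tensor_abelian_group bal1, folded tensor_map_def, unfolded id_apply]
    LE.tensor_lift_closed[OF LA.tensor_abelian_group bal1, folded tensor_map_def, unfolded id_apply]
  note m2 = LA.tensor_lift_pure[OF L.M.abelian_group_axioms bal2, folded tensor_runit_def]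
    LA.tensor_lift_add[OF L.M.abelian_group_axioms bal2, folded tensor_runit_def]
  have "tensor_runit (C \<alpha>) (tensor_map A (C \<alpha>) ?A id \<epsilon> Z) = contract \<alpha> \<epsilon> Z"
    if Z: "Z \<in> carrier LE.MN" for Z
    using Z
  proof (induction rule: LE.tensor_induct)
    case (pure c d)
    then show ?case
      by (simp add: m1 m2 regular_bimodule_simps functional_closed[OF \<epsilon>] contract_pure[OF \<alpha> _ \<epsilon>])
  next
    case (add Z W)
    then show ?case
      by (simp add: m1 m2 contract_add[OF \<alpha> _ \<epsilon>])
  qed
  then have "comult_apply \<alpha> \<one>\<^bsub>G\<^esub> \<epsilon> c = c"
    using counit_right[OF \<alpha> c] comult_closed[OF \<alpha> G.one_closed] \<alpha> c
    by (simp add: comult_apply_contract)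
  moreover have "comult_apply \<alpha> \<one>\<^bsub>G\<^esub> e c = comult_apply \<alpha> \<one>\<^bsub>G\<^esub> \<epsilon> c"
    by (rule comult_apply_cong[OF _ _ \<epsilon> e]) (use \<alpha> c in simp_all)
  ultimately show ?thesis
    by simp
qed

text \<open>Left linearity of \<open>f\<close> and right linearity of \<open>\<epsilon>\<close> give
  \<open>\<epsilon>(c\<^sub>(\<^sub>1\<^sub>) f(c\<^sub>(\<^sub>2\<^sub>))) = \<epsilon>(c\<^sub>(\<^sub>1\<^sub>)) f(c\<^sub>(\<^sub>2\<^sub>)) = f(\<epsilon>(c\<^sub>(\<^sub>1\<^sub>)) c\<^sub>(\<^sub>2\<^sub>))\<close>.\<close>

lemma comult_apply_counit_left:
  assumes \<alpha>: "\<alpha> \<in> carrier G" and c: "c \<in> carrier (C \<alpha>)" and f: "f \<in> functionals \<alpha>"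
  shows "\<epsilon> (comult_apply \<one>\<^bsub>G\<^esub> \<alpha> f c) = f c"
proof -
  let ?A = "regular_bimodule A"
  interpret L: bimodule A A "C \<alpha>" by (rule bimodule_C) fact
  interpret E: bimodule A A "C \<one>\<^bsub>G\<^esub>" by (rule bimodule_C) simp
  interpret EL: tensor_pair A "C \<one>\<^bsub>G\<^esub>" "C \<alpha>" by (rule tensor_pair_C) (use \<alpha> in simp_all)
  interpret AL: tensor_pair A ?A "C \<alpha>"
    by (rule tensor_pairI[OF A.bimodule_regular L.bimodule_axioms])
  have \<epsilon>: "\<epsilon> \<in> functionals \<one>\<^bsub>G\<^esub>"
    and \<epsilon>r: "\<And>d a. d \<in> carrier (C \<one>\<^bsub>G\<^esub>) \<Longrightarrow> a \<in> carrier A \<Longrightarrow> \<epsilon> (d \<triangleleft>\<^bsub>C \<one>\<^bsub>G\<^esub>\<^esub> a) = \<epsilon> d \<otimes>\<^bsub>A\<^esub> a"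
    using counit_hom by (simp_all add: bimodule_hom_def regular_bimodule_simps)
  have bal1: "balanced_map A (C \<one>\<^bsub>G\<^esub>) (C \<alpha>) AL.MN (\<lambda>d c. AL.pt (\<epsilon> d) (id c))"
    by (rule EL.tensor_map_balanced[OF AL.tensor_pair_axioms])
      (simp_all add: functional_closed[OF \<epsilon>] functional_add[OF \<epsilon>] \<epsilon>r regular_bimodule_simps left_linear_def)
  have bal2: "balanced_map A ?A (C \<alpha>) (C \<alpha>) (\<lambda>a m. a \<odot>\<^bsub>C \<alpha>\<^esub> m)"
    by (rule balanced_mapI) (simp_all add: regular_bimodule_simps L.lsmult_closed L.lsmult_l_distr
        L.lsmult_r_distr L.lsmult_assoc)
  note m1 = EL.tensor_lift_pure[OF AL.tensor_abelian_group bal1, folded tensor_map_def, unfolded id_apply]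
    EL.tensor_lift_add[OF AL.tensor_abelian_group bal1, folded tensor_map_def, unfolded id_apply]
    EL.tensor_lift_closed[OF AL.tensor_abelian_group bal1, folded tensor_map_def, unfolded id_apply]
  note m2 = AL.tensor_lift_pure[OF L.M.abelian_group_axioms bal2, folded tensor_lunit_def]
    AL.tensor_lift_add[OF L.M.abelian_group_axioms bal2, folded tensor_lunit_def]
    AL.tensor_lift_closed[OF L.M.abelian_group_axioms bal2, folded tensor_lunit_def]
  have *: "f (tensor_lunit (C \<alpha>) (tensor_map A ?A (C \<alpha>) \<epsilon> id Z)) = \<epsilon> (contract \<one>\<^bsub>G\<^esub> f Z)"
    if Z: "Z \<in> carrier EL.MN" for Z
    using Z
  proof (induction rule: EL.tensor_induct)
    case (pure d c)
    then show ?case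
      by (simp add: m1 m2 regular_bimodule_simps functional_closed[OF \<epsilon>] functional_closed[OF f]
          functional_smult[OF f] \<epsilon>r contract_pure[OF _ \<alpha> f])
  next
    case (add Z W)
    then show ?case
      by (simp add: m1 m2 functional_add[OF f] functional_add[OF \<epsilon>] contract_add[OF _ \<alpha> f]
          contract_closed[OF _ \<alpha> f])
  qed
  have "\<Delta> \<one>\<^bsub>G\<^esub> \<alpha> c \<in> carrier EL.MN"
    using comult_closed[OF G.one_closed \<alpha>] \<alpha> c by simp
  from *[OF this] show ?thesis
    unfolding counit_left[OF \<alpha> c] comult_apply_contract by simp
qed

lemma comult_apply_pure:
  assumes G: "\<gamma> \<in> carrier G" "\<delta> \<in> carrier G" and f: "f \<in> functionals \<delta>"
    and "u \<in> carrier (C \<gamma>)" "v \<in> carrier (C \<delta>)" "\<Delta> \<gamma> \<delta> c = pure_tensor A (C \<gamma>) (C \<delta>) u v"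
  shows "comult_apply \<gamma> \<delta> f c = u \<triangleleft>\<^bsub>C \<gamma>\<^esub> f v"
  using assms by (simp add: comult_apply_contract contract_pure[OF G f])

end

section \<open>The left dual graded ring\<close>

context group_coring
begin

abbreviation "R \<equiv> dual_ring"

text \<open>Elements of degree \<open>\<alpha>\<close> in \<open>R\<close> are functions on \<open>C\<^bsub>\<alpha>\<^sup>-\<^sup>1\<^esub>\<close>.\<close>

abbreviation "CI \<alpha> \<equiv> carrier (C (inv\<^bsub>G\<^esub> \<alpha>))"

lemma dual_component_functional: "f \<in> dual_component \<alpha> \<Longrightarrow> f \<in> functionals (inv\<^bsub>G\<^esub> \<alpha>)"
  by (simp add: dual_component_def)

lemma dual_componentI:
  assumes "f \<in> functionals (inv\<^bsub>G\<^esub> \<alpha>)" "\<And>c. c \<in> CI \<alpha> \<Longrightarrow> g c = f c" "g \<in> extensional (CI \<alpha>)" "\<alpha> \<in> carrier G"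
  shows "g \<in> dual_component \<alpha>"
  unfolding dual_component_def
  using functionals_cong[OF assms(1,2)] assms(3,4) by simp

lemma dual_component_eqI:
  assumes "f \<in> dual_component \<alpha>" "g \<in> dual_component \<alpha>" "\<And>c. c \<in> CI \<alpha> \<Longrightarrow> f c = g c"
  shows "f = g"
  using assms extensionalityI[of f "CI \<alpha>" g] by (simp add: dual_component_def)

lemma dual_zero_component: "\<alpha> \<in> carrier G \<Longrightarrow> dual_zero \<alpha> \<in> dual_component \<alpha>"
  by (rule dual_componentI[OF functional_zero]) (auto simp: dual_zero_def)

lemma dual_zero_apply: "c \<in> CI \<alpha> \<Longrightarrow> dual_zero \<alpha> c = \<zero>\<^bsub>A\<^esub>"
  by (simp add: dual_zero_def)

lemma
  assumes "q \<in> carrier R"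
  shows component_in: "\<alpha> \<in> carrier G \<Longrightarrow> q \<alpha> \<in> dual_component \<alpha>"
    and component_functional: "\<alpha> \<in> carrier G \<Longrightarrow> q \<alpha> \<in> functionals (inv\<^bsub>G\<^esub> \<alpha>)"
    and component_closed: "\<alpha> \<in> carrier G \<Longrightarrow> c \<in> CI \<alpha> \<Longrightarrow> q \<alpha> c \<in> carrier A"
    and finite_supp: "finite (dual_supp q)"
    and carrier_extensional: "q \<in> extensional (carrier G)"
proof -
  show 1: "q \<alpha> \<in> dual_component \<alpha>" if "\<alpha> \<in> carrier G" for \<alpha>
    using assms that by (auto simp: dual_ring_def)
  show 2: "q \<alpha> \<in> functionals (inv\<^bsub>G\<^esub> \<alpha>)" if "\<alpha> \<in> carrier G"
    using dual_component_functional[OF 1[OF that]] .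
  show "q \<alpha> c \<in> carrier A" if "\<alpha> \<in> carrier G" "c \<in> CI \<alpha>"
    using functional_closed[OF 2[OF that(1)] that(2)] .
  show "finite (dual_supp q)" "q \<in> extensional (carrier G)"
    using assms by (auto simp: dual_ring_def PiE_def)
qed

lemma supp_subset: "dual_supp q \<subseteq> carrier G"
  by (auto simp: dual_supp_def)

lemma supp_in: "\<alpha> \<in> dual_supp q \<Longrightarrow> \<alpha> \<in> carrier G"
  by (auto simp: dual_supp_def)

lemma outside_supp: "\<lbrakk>\<alpha> \<in> carrier G; \<alpha> \<notin> dual_supp q; c \<in> CI \<alpha>\<rbrakk> \<Longrightarrow> q \<alpha> c = \<zero>\<^bsub>A\<^esub>"
  by (simp add: dual_supp_def dual_zero_apply)

lemma supp_subsetI: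
  assumes "\<And>\<alpha>. \<alpha> \<in> carrier G \<Longrightarrow> q \<alpha> \<in> dual_component \<alpha>"
    and "\<And>\<alpha> c. \<lbrakk>\<alpha> \<in> carrier G; \<alpha> \<notin> F; c \<in> CI \<alpha>\<rbrakk> \<Longrightarrow> q \<alpha> c = \<zero>\<^bsub>A\<^esub>"
  shows "dual_supp q \<subseteq> F"
proof
  fix \<alpha> assume "\<alpha> \<in> dual_supp q"
  then have \<alpha>: "\<alpha> \<in> carrier G" "q \<alpha> \<noteq> dual_zero \<alpha>"
    by (auto simp: dual_supp_def)
  show "\<alpha> \<in> F"
  proof (rule ccontr)
    assume "\<alpha> \<notin> F"
    then have "q \<alpha> = dual_zero \<alpha>"
      using \<alpha> by (intro dual_component_eqI[OF assms(1) dual_zero_component])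
        (simp_all add: assms(2) dual_zero_apply)
    with \<alpha> show False by simp
  qed
qed

lemma dual_carrierI:
  assumes "q \<in> extensional (carrier G)" "\<And>\<alpha>. \<alpha> \<in> carrier G \<Longrightarrow> q \<alpha> \<in> dual_component \<alpha>"
    and "finite F" "\<And>\<alpha> c. \<lbrakk>\<alpha> \<in> carrier G; \<alpha> \<notin> F; c \<in> CI \<alpha>\<rbrakk> \<Longrightarrow> q \<alpha> c = \<zero>\<^bsub>A\<^esub>"
  shows "q \<in> carrier R"
  using assms(1,2) finite_subset[OF supp_subsetI[OF assms(2,4)] assms(3)]
  by (auto simp: dual_ring_def PiE_def)

lemma dual_eqI:
  assumes "q \<in> carrier R" "r \<in> carrier R" "\<And>\<alpha> c. \<lbrakk>\<alpha> \<in> carrier G; c \<in> CI \<alpha>\<rbrakk> \<Longrightarrow> q \<alpha> c = r \<alpha> c"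
  shows "q = r"
proof (rule extensionalityI[OF carrier_extensional carrier_extensional])
  fix \<alpha> assume "\<alpha> \<in> carrier G"
  then show "q \<alpha> = r \<alpha>"
    using assms by (intro dual_component_eqI[OF component_in component_in])
qed fact+

subsection \<open>The additive group\<close>

lemma dual_plus_apply: "\<lbrakk>\<alpha> \<in> carrier G; c \<in> CI \<alpha>\<rbrakk> \<Longrightarrow> (q \<oplus>\<^bsub>R\<^esub> r) \<alpha> c = q \<alpha> c \<oplus>\<^bsub>A\<^esub> r \<alpha> c"
  by (simp add: dual_ring_def)

lemma dual_zero_ring_apply: "\<lbrakk>\<alpha> \<in> carrier G; c \<in> CI \<alpha>\<rbrakk> \<Longrightarrow> \<zero>\<^bsub>R\<^esub> \<alpha> c = \<zero>\<^bsub>A\<^esub>"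
  by (simp add: dual_ring_def dual_zero_apply)

lemma dual_plus_closed:
  assumes q: "q \<in> carrier R" and r: "r \<in> carrier R"
  shows "q \<oplus>\<^bsub>R\<^esub> r \<in> carrier R"
proof (rule dual_carrierI)
  show "finite (dual_supp q \<union> dual_supp r)"
    using finite_supp[OF q] finite_supp[OF r] by simp
  show "(q \<oplus>\<^bsub>R\<^esub> r) \<alpha> \<in> dual_component \<alpha>" if "\<alpha> \<in> carrier G" for \<alpha>
    by (rule dual_componentI[OF functional_plus[OF component_functional[OF q that] component_functional[OF r that]]])
      (use that in \<open>auto simp: dual_plus_apply\<close>, simp add: dual_ring_def)
qed (auto simp: dual_plus_apply outside_supp, simp add: dual_ring_def)

lemma dual_zero_closed: "\<zero>\<^bsub>R\<^esub> \<in> carrier R"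
  by (rule dual_carrierI[where F = "{}"]) (auto simp: dual_ring_def dual_zero_component dual_zero_apply)

lemma dual_uminus_closed:
  assumes q: "q \<in> carrier R"
  shows "(\<lambda>\<alpha>\<in>carrier G. \<lambda>c\<in>CI \<alpha>. \<ominus>\<^bsub>A\<^esub> q \<alpha> c) \<in> carrier R"
proof (rule dual_carrierI)
  show "finite (dual_supp q)"
    using finite_supp[OF q] .
  show "(\<lambda>\<alpha>\<in>carrier G. \<lambda>c\<in>CI \<alpha>. \<ominus>\<^bsub>A\<^esub> q \<alpha> c) \<alpha> \<in> dual_component \<alpha>" if \<alpha>: "\<alpha> \<in> carrier G" for \<alpha>
  proof (rule dual_componentI)
    note f = component_functional[OF q \<alpha>]
    show "(\<lambda>c. \<ominus>\<^bsub>A\<^esub> q \<alpha> c) \<in> functionals (inv\<^bsub>G\<^esub> \<alpha>)"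
      by (intro functionalsI) (simp_all add: functional_closed[OF f] functional_add[OF f]
        functional_smult[OF f] A.minus_add A.r_minus)
  qed (use \<alpha> in auto)
qed (auto simp: outside_supp)

lemma dual_abelian_group: "abelian_group R"
proof (rule abelian_groupI)
  fix q r s assume q: "q \<in> carrier R" and r: "r \<in> carrier R" and s: "s \<in> carrier R"
  show "(q \<oplus>\<^bsub>R\<^esub> r) \<oplus>\<^bsub>R\<^esub> s = q \<oplus>\<^bsub>R\<^esub> (r \<oplus>\<^bsub>R\<^esub> s)"
    by (intro dual_eqI dual_plus_closed q r s)
      (simp_all add: dual_plus_apply component_closed q r s A.a_assoc)
next
  fix q r assume q: "q \<in> carrier R" and r: "r \<in> carrier R"
  show "q \<oplus>\<^bsub>R\<^esub> r = r \<oplus>\<^bsub>R\<^esub> q"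
    by (intro dual_eqI dual_plus_closed q r)
      (simp_all add: dual_plus_apply component_closed q r A.a_comm)
next
  fix q assume q: "q \<in> carrier R"
  show "\<zero>\<^bsub>R\<^esub> \<oplus>\<^bsub>R\<^esub> q = q"
    by (intro dual_eqI dual_plus_closed dual_zero_closed q)
      (simp_all add: dual_plus_apply dual_zero_ring_apply component_closed q)
  show "\<exists>r\<in>carrier R. r \<oplus>\<^bsub>R\<^esub> q = \<zero>\<^bsub>R\<^esub>"
    by (intro bexI[OF _ dual_uminus_closed[OF q]] dual_eqI dual_plus_closed dual_zero_closed q dual_uminus_closed)
      (simp_all add: dual_plus_apply dual_zero_ring_apply component_closed q A.l_neg)
qed (simp_all add: dual_plus_closed dual_zero_closed)

definition single :: "'g \<Rightarrow> ('c \<Rightarrow> 'a) \<Rightarrow> 'g \<Rightarrow> 'c \<Rightarrow> 'a" where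
  "single \<alpha> f = (\<lambda>\<beta>\<in>carrier G. if \<beta> = \<alpha> then f else dual_zero \<beta>)"

lemma single_apply: "\<lbrakk>\<beta> \<in> carrier G; c \<in> CI \<beta>\<rbrakk> \<Longrightarrow> single \<alpha> f \<beta> c = (if \<beta> = \<alpha> then f c else \<zero>\<^bsub>A\<^esub>)"
  by (simp add: single_def dual_zero_apply)

lemma single_closed: "\<lbrakk>\<alpha> \<in> carrier G; f \<in> dual_component \<alpha>\<rbrakk> \<Longrightarrow> single \<alpha> f \<in> carrier R"
  by (rule dual_carrierI[where F = "{\<alpha>}"]) (auto simp: single_def dual_zero_component dual_zero_apply)

lemma single_supp: "dual_supp (single \<alpha> f) \<subseteq> {\<alpha>}"
  by (auto simp: dual_supp_def single_def)

text \<open>The ring \<open>R\<close> is generated additively by its homogeneous elements, so identities between additive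
  expressions reduce to homogeneous arguments. Zero has no case of its own, being homogeneous of
  every degree.\<close>

lemma dual_ring_induct [consumes 1, case_names single add]:
  assumes q: "q \<in> carrier R"
    and single: "\<And>\<alpha> f. \<lbrakk>\<alpha> \<in> carrier G; f \<in> dual_component \<alpha>\<rbrakk> \<Longrightarrow> P (single \<alpha> f)"
    and add: "\<And>q r. \<lbrakk>q \<in> carrier R; r \<in> carrier R; P q; P r\<rbrakk> \<Longrightarrow> P (q \<oplus>\<^bsub>R\<^esub> r)"
  shows "P q"
proof -
  have "P q" if "finite F" "q \<in> carrier R" "dual_supp q \<subseteq> F" for F q
    using that
  proof (induction F arbitrary: q rule: finite_induct)
    case empty
    have "q = single \<one>\<^bsub>G\<^esub> (dual_zero \<one>\<^bsub>G\<^esub>)"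
      by (rule dual_eqI[OF empty.prems(1) single_closed])
        (use empty.prems(2) in \<open>auto simp: outside_supp single_apply dual_zero_apply dual_zero_component\<close>)
    then show ?case
      using single[of "\<one>\<^bsub>G\<^esub>" "dual_zero \<one>\<^bsub>G\<^esub>"] by (simp add: dual_zero_component)
  next
    case (insert \<alpha> F)
    show ?case
    proof (cases "\<alpha> \<in> carrier G")
      case False
      then have "dual_supp q \<subseteq> F"
        using insert.prems(2) supp_subset[of q] by auto
      then show ?thesis
        using insert by blast
    next
      case \<alpha>: True
      note q\<alpha> = component_in[OF insert.prems(1) \<alpha>]
      define r where "r = (\<lambda>\<beta>\<in>carrier G. if \<beta> = \<alpha> then dual_zero \<beta> else q \<beta>)"
      have r_apply: "r \<beta> c = (if \<beta> = \<alpha> then \<zero>\<^bsub>A\<^esub> else q \<beta> c)" if "\<beta> \<in> carrier G" "c \<in> CI \<beta>" for \<beta> c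
        using that by (auto simp: r_def dual_zero_apply)
      have r_comp: "r \<beta> \<in> dual_component \<beta>" if "\<beta> \<in> carrier G" for \<beta>
        using that component_in[OF insert.prems(1)] by (auto simp: r_def dual_zero_component)
      have r_zero: "r \<beta> c = \<zero>\<^bsub>A\<^esub>" if "\<beta> \<in> carrier G" "\<beta> \<notin> F" "c \<in> CI \<beta>" for \<beta> c
        using that insert.prems(2) outside_supp[of \<beta> q c] by (auto simp: r_apply)
      have r: "r \<in> carrier R"
        by (rule dual_carrierI[OF _ r_comp insert.hyps(1) r_zero]) (simp_all add: r_def extensional_def)
      have "P r"
        by (rule insert.IH[OF r supp_subsetI[OF r_comp r_zero]])
      moreover have "q = single \<alpha> (q \<alpha>) \<oplus>\<^bsub>R\<^esub> r"
        by (rule dual_eqI[OF insert.prems(1) dual_plus_closed[OF single_closed[OF \<alpha> q\<alpha>] r]])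
          (auto simp: dual_plus_apply single_apply r_apply component_closed[OF insert.prems(1)])
      ultimately show ?thesis
        using add[OF single_closed[OF \<alpha> q\<alpha>] r single[OF \<alpha> q\<alpha>]] by simp
    qed
  qed
  then show ?thesis
    using q finite_supp by blast
qed

subsection \<open>The product\<close>

lemma comult_apply_inv:
  assumes "\<alpha> \<in> carrier G" "\<beta> \<in> carrier G" "f \<in> functionals (inv\<^bsub>G\<^esub> \<alpha>)" "c \<in> CI (\<alpha> \<otimes>\<^bsub>G\<^esub> \<beta>)"
  shows "comult_apply (inv\<^bsub>G\<^esub> \<beta>) (inv\<^bsub>G\<^esub> \<alpha>) f c \<in> CI \<beta>"
  by (rule comult_apply_closed) (use assms in \<open>simp_all add: G.inv_mult_group\<close>)

lemma dual_hmult_apply: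
  "c \<in> CI (\<alpha> \<otimes>\<^bsub>G\<^esub> \<beta>) \<Longrightarrow> dual_hmult \<alpha> \<beta> f g c = g (comult_apply (inv\<^bsub>G\<^esub> \<beta>) (inv\<^bsub>G\<^esub> \<alpha>) f c)"
  by (simp add: dual_hmult_def)

lemma dual_hmult_closed:
  assumes G: "\<alpha> \<in> carrier G" "\<beta> \<in> carrier G" and f: "f \<in> dual_component \<alpha>" and g: "g \<in> dual_component \<beta>"
  shows "dual_hmult \<alpha> \<beta> f g \<in> dual_component (\<alpha> \<otimes>\<^bsub>G\<^esub> \<beta>)"
proof (rule dual_componentI)
  show "(\<lambda>c. g (comult_apply (inv\<^bsub>G\<^esub> \<beta>) (inv\<^bsub>G\<^esub> \<alpha>) f c)) \<in> functionals (inv\<^bsub>G\<^esub> (\<alpha> \<otimes>\<^bsub>G\<^esub> \<beta>))"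
    using comult_apply_functional[of "inv\<^bsub>G\<^esub> \<beta>" "inv\<^bsub>G\<^esub> \<alpha>" f g] G f g
    by (simp add: G.inv_mult_group dual_component_functional)
qed (use G in \<open>simp_all add: dual_hmult_def\<close>)

lemma functional_zero_arg: "\<delta> \<in> carrier G \<Longrightarrow> g \<in> functionals \<delta> \<Longrightarrow> g \<zero>\<^bsub>C \<delta>\<^esub> = \<zero>\<^bsub>A\<^esub>"
proof -
  assume \<delta>: "\<delta> \<in> carrier G" and g: "g \<in> functionals \<delta>"
  interpret bimodule A A "C \<delta>" by (rule bimodule_C) fact
  show ?thesis
    using functional_add[OF g, of "\<zero>\<^bsub>C \<delta>\<^esub>" "\<zero>\<^bsub>C \<delta>\<^esub>"] functional_closed[OF g, of "\<zero>\<^bsub>C \<delta>\<^esub>"]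
    by simp
qed

text \<open>The contribution of the degrees \<open>\<alpha>\<close> and \<open>\<beta>\<close> to a product. Unlike \<open>dual_hmult\<close> it is not
  restricted to a carrier, so that it needs no bookkeeping of degrees inside sums.\<close>

definition product_summand ::
  "'g \<Rightarrow> 'g \<Rightarrow> ('g \<Rightarrow> 'c \<Rightarrow> 'a) \<Rightarrow> ('g \<Rightarrow> 'c \<Rightarrow> 'a) \<Rightarrow> 'c \<Rightarrow> 'a" where
  "product_summand \<alpha> \<beta> q r c = r \<beta> (comult_apply (inv\<^bsub>G\<^esub> \<beta>) (inv\<^bsub>G\<^esub> \<alpha>) (q \<alpha>) c)"

lemma product_summand_closed:
  assumes "q \<in> carrier R" "r \<in> carrier R" "\<alpha> \<in> carrier G" "\<beta> \<in> carrier G" "c \<in> CI (\<alpha> \<otimes>\<^bsub>G\<^esub> \<beta>)"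
  shows "product_summand \<alpha> \<beta> q r c \<in> carrier A"
  unfolding product_summand_def
  using assms by (intro component_closed comult_apply_inv component_functional)

lemma product_summand_zero:
  assumes "q \<in> carrier R" "r \<in> carrier R" "\<alpha> \<in> carrier G" "\<beta> \<in> carrier G" "c \<in> CI (\<alpha> \<otimes>\<^bsub>G\<^esub> \<beta>)"
    and "\<alpha> \<notin> dual_supp q \<or> \<beta> \<notin> dual_supp r"
  shows "product_summand \<alpha> \<beta> q r c = \<zero>\<^bsub>A\<^esub>"
proof (cases "\<beta> \<in> dual_supp r")
  case True
  then have "comult_apply (inv\<^bsub>G\<^esub> \<beta>) (inv\<^bsub>G\<^esub> \<alpha>) (q \<alpha>) c = \<zero>\<^bsub>C (inv\<^bsub>G\<^esub> \<beta>)\<^esub>"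
    using assms by (intro comult_apply_zero) (auto simp: G.inv_mult_group outside_supp)
  then show ?thesis
    using assms by (simp add: product_summand_def functional_zero_arg component_functional)
next
  case False
  then show ?thesis
    unfolding product_summand_def using assms by (intro outside_supp comult_apply_inv component_functional)
qed

lemma dual_mult_sum:
  assumes q: "q \<in> carrier R" and r: "r \<in> carrier R" and \<gamma>: "\<gamma> \<in> carrier G" and c: "c \<in> CI \<gamma>"
  shows "(q \<otimes>\<^bsub>R\<^esub> r) \<gamma> c =
    (\<Oplus>\<^bsub>A\<^esub>p\<in>{(\<alpha>, \<beta>) \<in> dual_supp q \<times> dual_supp r. \<alpha> \<otimes>\<^bsub>G\<^esub> \<beta> = \<gamma>}. product_summand (fst p) (snd p) q r c)"
proof -
  have "(q \<otimes>\<^bsub>R\<^esub> r) \<gamma> c = (\<Oplus>\<^bsub>A\<^esub>p\<in>{(\<alpha>, \<beta>) \<in> dual_supp q \<times> dual_supp r. \<alpha> \<otimes>\<^bsub>G\<^esub> \<beta> = \<gamma>}.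
      dual_hmult (fst p) (snd p) (q (fst p)) (r (snd p)) c)"
    using \<gamma> c by (simp add: dual_ring_def)
  also have "\<dots> = (\<Oplus>\<^bsub>A\<^esub>p\<in>{(\<alpha>, \<beta>) \<in> dual_supp q \<times> dual_supp r. \<alpha> \<otimes>\<^bsub>G\<^esub> \<beta> = \<gamma>}. product_summand (fst p) (snd p) q r c)"
  proof (rule A.finsum_cong'[OF refl])
    show "(\<lambda>p. product_summand (fst p) (snd p) q r c) \<in> {(\<alpha>, \<beta>) \<in> dual_supp q \<times> dual_supp r. \<alpha> \<otimes>\<^bsub>G\<^esub> \<beta> = \<gamma>} \<rightarrow> carrier A"
      using c by (auto intro!: product_summand_closed q r dest: supp_in)
  qed (use c in \<open>auto simp: product_summand_def dual_hmult_apply\<close>)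
  finally show ?thesis .
qed

text \<open>In degree \<open>\<gamma>\<close> the first degree \<open>\<alpha>\<close> determines the second as \<open>\<alpha>\<^sup>-\<^sup>1\<gamma>\<close>. Summing over \<open>\<alpha>\<close> makes the index
  set independent of the second factor, from which right distributivity follows term by term; the
  sum over the second degree plays the same part for left distributivity.\<close>

lemma dual_mult_apply_left:
  assumes q: "q \<in> carrier R" and r: "r \<in> carrier R" and \<gamma>: "\<gamma> \<in> carrier G" and c: "c \<in> CI \<gamma>"
    and F: "finite F" "dual_supp q \<subseteq> F" "F \<subseteq> carrier G"
  shows "(q \<otimes>\<^bsub>R\<^esub> r) \<gamma> c = (\<Oplus>\<^bsub>A\<^esub>\<alpha>\<in>F. product_summand \<alpha> (inv\<^bsub>G\<^esub> \<alpha> \<otimes>\<^bsub>G\<^esub> \<gamma>) q r c)"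
proof -
  let ?h = "\<lambda>\<alpha>. (\<alpha>, inv\<^bsub>G\<^esub> \<alpha> \<otimes>\<^bsub>G\<^esub> \<gamma>)"
  let ?S = "{\<alpha> \<in> dual_supp q. inv\<^bsub>G\<^esub> \<alpha> \<otimes>\<^bsub>G\<^esub> \<gamma> \<in> dual_supp r}"
  have cancel: "\<alpha> \<otimes>\<^bsub>G\<^esub> (inv\<^bsub>G\<^esub> \<alpha> \<otimes>\<^bsub>G\<^esub> \<gamma>) = \<gamma>" "inv\<^bsub>G\<^esub> \<alpha> \<otimes>\<^bsub>G\<^esub> (\<alpha> \<otimes>\<^bsub>G\<^esub> \<beta>) = \<beta>"
    if "\<alpha> \<in> carrier G" "\<beta> \<in> carrier G" for \<alpha> \<beta>
    using that \<gamma> by (simp_all add: G.m_assoc[symmetric])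
  have eq: "{(\<alpha>, \<beta>) \<in> dual_supp q \<times> dual_supp r. \<alpha> \<otimes>\<^bsub>G\<^esub> \<beta> = \<gamma>} = ?h ` ?S"
    using cancel supp_subset[of q] supp_subset[of r] by (force simp: image_iff)
  have closed: "product_summand \<alpha> (inv\<^bsub>G\<^esub> \<alpha> \<otimes>\<^bsub>G\<^esub> \<gamma>) q r c \<in> carrier A" if "\<alpha> \<in> carrier G" for \<alpha>
    using that \<gamma> c by (intro product_summand_closed q r) (simp_all add: cancel)
  have "(q \<otimes>\<^bsub>R\<^esub> r) \<gamma> c = (\<Oplus>\<^bsub>A\<^esub>\<alpha>\<in>?S. product_summand (fst (?h \<alpha>)) (snd (?h \<alpha>)) q r c)"
    unfolding dual_mult_sum[OF q r \<gamma> c] eq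
    by (rule A.finsum_reindex) (use closed in \<open>auto simp: inj_on_def dest: supp_in\<close>)
  also have "\<dots> = (\<Oplus>\<^bsub>A\<^esub>\<alpha>\<in>F. product_summand \<alpha> (inv\<^bsub>G\<^esub> \<alpha> \<otimes>\<^bsub>G\<^esub> \<gamma>) q r c)"
  proof (rule A.add.finprod_mono_neutral_cong_left)
    fix \<alpha> assume "\<alpha> \<in> F - ?S"
    then show "product_summand \<alpha> (inv\<^bsub>G\<^esub> \<alpha> \<otimes>\<^bsub>G\<^esub> \<gamma>) q r c = \<zero>\<^bsub>A\<^esub>"
      using F \<gamma> c by (intro product_summand_zero q r) (auto simp: cancel)
  qed (use F closed in auto)
  finally show ?thesis .
qed

lemma dual_mult_apply_right:
  assumes q: "q \<in> carrier R" and r: "r \<in> carrier R" and \<gamma>: "\<gamma> \<in> carrier G" and c: "c \<in> CI \<gamma>"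
    and F: "finite F" "dual_supp r \<subseteq> F" "F \<subseteq> carrier G"
  shows "(q \<otimes>\<^bsub>R\<^esub> r) \<gamma> c = (\<Oplus>\<^bsub>A\<^esub>\<beta>\<in>F. product_summand (\<gamma> \<otimes>\<^bsub>G\<^esub> inv\<^bsub>G\<^esub> \<beta>) \<beta> q r c)"
proof -
  let ?h = "\<lambda>\<beta>. (\<gamma> \<otimes>\<^bsub>G\<^esub> inv\<^bsub>G\<^esub> \<beta>, \<beta>)"
  let ?S = "{\<beta> \<in> dual_supp r. \<gamma> \<otimes>\<^bsub>G\<^esub> inv\<^bsub>G\<^esub> \<beta> \<in> dual_supp q}"
  have cancel: "(\<gamma> \<otimes>\<^bsub>G\<^esub> inv\<^bsub>G\<^esub> \<beta>) \<otimes>\<^bsub>G\<^esub> \<beta> = \<gamma>" "(\<alpha> \<otimes>\<^bsub>G\<^esub> \<beta>) \<otimes>\<^bsub>G\<^esub> inv\<^bsub>G\<^esub> \<beta> = \<alpha>"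
    if "\<alpha> \<in> carrier G" "\<beta> \<in> carrier G" for \<alpha> \<beta>
    using that \<gamma> by (simp_all add: G.m_assoc)
  have eq: "{(\<alpha>, \<beta>) \<in> dual_supp q \<times> dual_supp r. \<alpha> \<otimes>\<^bsub>G\<^esub> \<beta> = \<gamma>} = ?h ` ?S"
    using cancel supp_subset[of q] supp_subset[of r] by (force simp: image_iff)
  have closed: "product_summand (\<gamma> \<otimes>\<^bsub>G\<^esub> inv\<^bsub>G\<^esub> \<beta>) \<beta> q r c \<in> carrier A" if "\<beta> \<in> carrier G" for \<beta>
    using that \<gamma> c by (intro product_summand_closed q r) (simp_all add: cancel)
  have "(q \<otimes>\<^bsub>R\<^esub> r) \<gamma> c = (\<Oplus>\<^bsub>A\<^esub>\<beta>\<in>?S. product_summand (fst (?h \<beta>)) (snd (?h \<beta>)) q r c)"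
    unfolding dual_mult_sum[OF q r \<gamma> c] eq
    by (rule A.finsum_reindex) (use closed in \<open>auto simp: inj_on_def dest: supp_in\<close>)
  also have "\<dots> = (\<Oplus>\<^bsub>A\<^esub>\<beta>\<in>F. product_summand (\<gamma> \<otimes>\<^bsub>G\<^esub> inv\<^bsub>G\<^esub> \<beta>) \<beta> q r c)"
  proof (rule A.add.finprod_mono_neutral_cong_left)
    fix \<beta> assume "\<beta> \<in> F - ?S"
    then show "product_summand (\<gamma> \<otimes>\<^bsub>G\<^esub> inv\<^bsub>G\<^esub> \<beta>) \<beta> q r c = \<zero>\<^bsub>A\<^esub>"
      using F \<gamma> c by (intro product_summand_zero q r) (auto simp: cancel)
  qed (use F closed in auto)
  finally show ?thesis .
qed

lemma functional_finsum:
  assumes "\<delta> \<in> carrier G" "finite F" "\<And>i. i \<in> F \<Longrightarrow> f i \<in> functionals \<delta>"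
  shows "(\<lambda>c. \<Oplus>\<^bsub>A\<^esub>i\<in>F. f i c) \<in> functionals \<delta>"
  using assms(2,3)
proof (induction F rule: finite_induct)
  case empty
  then show ?case by (simp add: functional_zero)
next
  case (insert i F)
  have "(\<lambda>c. f i c \<oplus>\<^bsub>A\<^esub> (\<Oplus>\<^bsub>A\<^esub>i\<in>F. f i c)) \<in> functionals \<delta>"
    using insert by (intro functional_plus) auto
  then show ?case
  proof (rule functionals_cong)
    fix c assume c: "c \<in> carrier (C \<delta>)"
    then have "f j c \<in> carrier A" if "j \<in> insert i F" for j
      using functional_closed[OF insert.prems[OF that]] by simp
    then show "(\<Oplus>\<^bsub>A\<^esub>i\<in>insert i F. f i c) = f i c \<oplus>\<^bsub>A\<^esub> (\<Oplus>\<^bsub>A\<^esub>i\<in>F. f i c)"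
      using insert.hyps by (intro A.finsum_insert) auto
  qed fact
qed

lemma mult_inv_cancel:
  assumes "\<alpha> \<in> carrier G" "\<gamma> \<in> carrier G"
  shows "\<alpha> \<otimes>\<^bsub>G\<^esub> (inv\<^bsub>G\<^esub> \<alpha> \<otimes>\<^bsub>G\<^esub> \<gamma>) = \<gamma>" "inv\<^bsub>G\<^esub> \<alpha> \<otimes>\<^bsub>G\<^esub> (\<alpha> \<otimes>\<^bsub>G\<^esub> \<gamma>) = \<gamma>"
    "(\<gamma> \<otimes>\<^bsub>G\<^esub> inv\<^bsub>G\<^esub> \<alpha>) \<otimes>\<^bsub>G\<^esub> \<alpha> = \<gamma>" "(\<gamma> \<otimes>\<^bsub>G\<^esub> \<alpha>) \<otimes>\<^bsub>G\<^esub> inv\<^bsub>G\<^esub> \<alpha> = \<gamma>"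
  using assms by (simp_all add: G.m_assoc[symmetric]) (simp_all add: G.m_assoc)

lemma product_summand_functional:
  assumes "q \<in> carrier R" "r \<in> carrier R" "\<alpha> \<in> carrier G" "\<beta> \<in> carrier G"
  shows "product_summand \<alpha> \<beta> q r \<in> functionals (inv\<^bsub>G\<^esub> (\<alpha> \<otimes>\<^bsub>G\<^esub> \<beta>))"
  using comult_apply_functional[of "inv\<^bsub>G\<^esub> \<beta>" "inv\<^bsub>G\<^esub> \<alpha>" "q \<alpha>" "r \<beta>"] assms
  unfolding product_summand_def by (simp add: G.inv_mult_group component_functional)

lemma dual_mult_closed:
  assumes q: "q \<in> carrier R" and r: "r \<in> carrier R"
  shows "q \<otimes>\<^bsub>R\<^esub> r \<in> carrier R"
proof (rule dual_carrierI)
  show "q \<otimes>\<^bsub>R\<^esub> r \<in> extensional (carrier G)"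
    by (simp add: dual_ring_def)
  show "finite ((\<lambda>(\<alpha>, \<beta>). \<alpha> \<otimes>\<^bsub>G\<^esub> \<beta>) ` (dual_supp q \<times> dual_supp r))"
    using finite_supp q r by blast
  fix \<gamma> assume \<gamma>: "\<gamma> \<in> carrier G"
  show "(q \<otimes>\<^bsub>R\<^esub> r) \<gamma> \<in> dual_component \<gamma>"
  proof (rule dual_componentI)
    have "product_summand \<alpha> (inv\<^bsub>G\<^esub> \<alpha> \<otimes>\<^bsub>G\<^esub> \<gamma>) q r \<in> functionals (inv\<^bsub>G\<^esub> \<gamma>)" if "\<alpha> \<in> dual_supp q" for \<alpha>
      using product_summand_functional[OF q r supp_in[OF that], of "inv\<^bsub>G\<^esub> \<alpha> \<otimes>\<^bsub>G\<^esub> \<gamma>"] \<gamma> supp_in[OF that]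
      by (simp add: mult_inv_cancel)
    then show "(\<lambda>c. \<Oplus>\<^bsub>A\<^esub>\<alpha>\<in>dual_supp q. product_summand \<alpha> (inv\<^bsub>G\<^esub> \<alpha> \<otimes>\<^bsub>G\<^esub> \<gamma>) q r c) \<in> functionals (inv\<^bsub>G\<^esub> \<gamma>)"
      using \<gamma> finite_supp[OF q] by (intro functional_finsum) auto
    show "(q \<otimes>\<^bsub>R\<^esub> r) \<gamma> c = (\<Oplus>\<^bsub>A\<^esub>\<alpha>\<in>dual_supp q. product_summand \<alpha> (inv\<^bsub>G\<^esub> \<alpha> \<otimes>\<^bsub>G\<^esub> \<gamma>) q r c)" if "c \<in> CI \<gamma>" for c
      by (rule dual_mult_apply_left[OF q r \<gamma> that finite_supp[OF q] order_refl supp_subset])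
  qed (use \<gamma> in \<open>simp_all add: dual_ring_def\<close>)
  fix c assume *: "\<gamma> \<notin> (\<lambda>(\<alpha>, \<beta>). \<alpha> \<otimes>\<^bsub>G\<^esub> \<beta>) ` (dual_supp q \<times> dual_supp r)" and c: "c \<in> CI \<gamma>"
  have empty: "{(\<alpha>, \<beta>) \<in> dual_supp q \<times> dual_supp r. \<alpha> \<otimes>\<^bsub>G\<^esub> \<beta> = \<gamma>} = {}"
    using * by force
  show "(q \<otimes>\<^bsub>R\<^esub> r) \<gamma> c = \<zero>\<^bsub>A\<^esub>"
    unfolding dual_mult_sum[OF q r \<gamma> c] empty by simp
qed

lemma product_summand_plus_left:
  assumes q: "q \<in> carrier R" "q' \<in> carrier R" and r: "r \<in> carrier R"
    and G: "\<alpha> \<in> carrier G" "\<beta> \<in> carrier G" and c: "c \<in> CI (\<alpha> \<otimes>\<^bsub>G\<^esub> \<beta>)"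
  shows "product_summand \<alpha> \<beta> (q \<oplus>\<^bsub>R\<^esub> q') r c = product_summand \<alpha> \<beta> q r c \<oplus>\<^bsub>A\<^esub> product_summand \<alpha> \<beta> q' r c"
proof -
  note f = component_functional[OF q(1) G(1)] component_functional[OF q(2) G(1)]
  have "comult_apply (inv\<^bsub>G\<^esub> \<beta>) (inv\<^bsub>G\<^esub> \<alpha>) ((q \<oplus>\<^bsub>R\<^esub> q') \<alpha>) c =
      comult_apply (inv\<^bsub>G\<^esub> \<beta>) (inv\<^bsub>G\<^esub> \<alpha>) (q \<alpha>) c \<oplus>\<^bsub>C (inv\<^bsub>G\<^esub> \<beta>)\<^esub> comult_apply (inv\<^bsub>G\<^esub> \<beta>) (inv\<^bsub>G\<^esub> \<alpha>) (q' \<alpha>) c"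
    using G c by (intro comult_apply_plus f component_functional[OF dual_plus_closed[OF q]])
      (simp_all add: dual_plus_apply G.inv_mult_group)
  then show ?thesis
    unfolding product_summand_def
    by (simp add: functional_add[OF component_functional[OF r G(2)]] comult_apply_inv[OF G f(1) c]
        comult_apply_inv[OF G f(2) c])
qed

lemma product_summand_plus_right:
  assumes q: "q \<in> carrier R" and G: "\<alpha> \<in> carrier G" "\<beta> \<in> carrier G" and c: "c \<in> CI (\<alpha> \<otimes>\<^bsub>G\<^esub> \<beta>)"
  shows "product_summand \<alpha> \<beta> q (r \<oplus>\<^bsub>R\<^esub> r') c = product_summand \<alpha> \<beta> q r c \<oplus>\<^bsub>A\<^esub> product_summand \<alpha> \<beta> q r' c"
  unfolding product_summand_def by (intro dual_plus_apply comult_apply_inv component_functional q G c)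

lemma dual_l_distr:
  assumes q: "q \<in> carrier R" "q' \<in> carrier R" and r: "r \<in> carrier R"
  shows "(q \<oplus>\<^bsub>R\<^esub> q') \<otimes>\<^bsub>R\<^esub> r = q \<otimes>\<^bsub>R\<^esub> r \<oplus>\<^bsub>R\<^esub> q' \<otimes>\<^bsub>R\<^esub> r"
proof (intro dual_eqI dual_mult_closed dual_plus_closed q r)
  fix \<gamma> c assume \<gamma>: "\<gamma> \<in> carrier G" and c: "c \<in> CI \<gamma>"
  let ?t = "\<lambda>q \<beta>. product_summand (\<gamma> \<otimes>\<^bsub>G\<^esub> inv\<^bsub>G\<^esub> \<beta>) \<beta> q r c"
  note expand = dual_mult_apply_right[OF _ r \<gamma> c finite_supp[OF r] order_refl supp_subset]
  have closed: "?t q \<beta> \<in> carrier A" if "q \<in> carrier R" "\<beta> \<in> dual_supp r" for q \<beta>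
    using that \<gamma> c supp_in[OF that(2)] by (intro product_summand_closed r) (simp_all add: mult_inv_cancel)
  have "((q \<oplus>\<^bsub>R\<^esub> q') \<otimes>\<^bsub>R\<^esub> r) \<gamma> c = (\<Oplus>\<^bsub>A\<^esub>\<beta>\<in>dual_supp r. ?t q \<beta> \<oplus>\<^bsub>A\<^esub> ?t q' \<beta>)"
    unfolding expand[OF dual_plus_closed[OF q]]
    by (rule A.finsum_cong'[OF refl])
      (use closed q \<gamma> c in \<open>auto simp: product_summand_plus_left[OF q r] mult_inv_cancel dest: supp_in\<close>)
  also have "\<dots> = (\<Oplus>\<^bsub>A\<^esub>\<beta>\<in>dual_supp r. ?t q \<beta>) \<oplus>\<^bsub>A\<^esub> (\<Oplus>\<^bsub>A\<^esub>\<beta>\<in>dual_supp r. ?t q' \<beta>)"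
    by (rule A.finsum_addf) (use closed q in auto)
  also have "\<dots> = (q \<otimes>\<^bsub>R\<^esub> r \<oplus>\<^bsub>R\<^esub> q' \<otimes>\<^bsub>R\<^esub> r) \<gamma> c"
    using \<gamma> c by (simp add: dual_plus_apply expand q)
  finally show "((q \<oplus>\<^bsub>R\<^esub> q') \<otimes>\<^bsub>R\<^esub> r) \<gamma> c = (q \<otimes>\<^bsub>R\<^esub> r \<oplus>\<^bsub>R\<^esub> q' \<otimes>\<^bsub>R\<^esub> r) \<gamma> c" .
qed

lemma dual_r_distr:
  assumes r: "r \<in> carrier R" "r' \<in> carrier R" and q: "q \<in> carrier R"
  shows "q \<otimes>\<^bsub>R\<^esub> (r \<oplus>\<^bsub>R\<^esub> r') = q \<otimes>\<^bsub>R\<^esub> r \<oplus>\<^bsub>R\<^esub> q \<otimes>\<^bsub>R\<^esub> r'"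
proof (intro dual_eqI dual_mult_closed dual_plus_closed q r)
  fix \<gamma> c assume \<gamma>: "\<gamma> \<in> carrier G" and c: "c \<in> CI \<gamma>"
  let ?t = "\<lambda>r \<alpha>. product_summand \<alpha> (inv\<^bsub>G\<^esub> \<alpha> \<otimes>\<^bsub>G\<^esub> \<gamma>) q r c"
  note expand = dual_mult_apply_left[OF q _ \<gamma> c finite_supp[OF q] order_refl supp_subset]
  have closed: "?t r \<alpha> \<in> carrier A" if "r \<in> carrier R" "\<alpha> \<in> dual_supp q" for r \<alpha>
    using that \<gamma> c supp_in[OF that(2)] by (intro product_summand_closed q) (simp_all add: mult_inv_cancel)
  have "(q \<otimes>\<^bsub>R\<^esub> (r \<oplus>\<^bsub>R\<^esub> r')) \<gamma> c = (\<Oplus>\<^bsub>A\<^esub>\<alpha>\<in>dual_supp q. ?t r \<alpha> \<oplus>\<^bsub>A\<^esub> ?t r' \<alpha>)"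
    unfolding expand[OF dual_plus_closed[OF r]]
    by (rule A.finsum_cong'[OF refl])
      (use closed r \<gamma> c in \<open>auto simp: product_summand_plus_right[OF q] mult_inv_cancel dest: supp_in\<close>)
  also have "\<dots> = (\<Oplus>\<^bsub>A\<^esub>\<alpha>\<in>dual_supp q. ?t r \<alpha>) \<oplus>\<^bsub>A\<^esub> (\<Oplus>\<^bsub>A\<^esub>\<alpha>\<in>dual_supp q. ?t r' \<alpha>)"
    by (rule A.finsum_addf) (use closed r in auto)
  also have "\<dots> = (q \<otimes>\<^bsub>R\<^esub> r \<oplus>\<^bsub>R\<^esub> q \<otimes>\<^bsub>R\<^esub> r') \<gamma> c"
    using \<gamma> c by (simp add: dual_plus_apply expand r)
  finally show "(q \<otimes>\<^bsub>R\<^esub> (r \<oplus>\<^bsub>R\<^esub> r')) \<gamma> c = (q \<otimes>\<^bsub>R\<^esub> r \<oplus>\<^bsub>R\<^esub> q \<otimes>\<^bsub>R\<^esub> r') \<gamma> c" .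
qed

lemma single_mult_apply:
  assumes \<alpha>: "\<alpha> \<in> carrier G" and f: "f \<in> dual_component \<alpha>" and r: "r \<in> carrier R"
    and \<gamma>: "\<gamma> \<in> carrier G" and c: "c \<in> CI \<gamma>"
  shows "(single \<alpha> f \<otimes>\<^bsub>R\<^esub> r) \<gamma> c =
    r (inv\<^bsub>G\<^esub> \<alpha> \<otimes>\<^bsub>G\<^esub> \<gamma>) (comult_apply (inv\<^bsub>G\<^esub> (inv\<^bsub>G\<^esub> \<alpha> \<otimes>\<^bsub>G\<^esub> \<gamma>)) (inv\<^bsub>G\<^esub> \<alpha>) f c)"
proof -
  have "(single \<alpha> f \<otimes>\<^bsub>R\<^esub> r) \<gamma> c = (\<Oplus>\<^bsub>A\<^esub>\<alpha>'\<in>{\<alpha>}. product_summand \<alpha>' (inv\<^bsub>G\<^esub> \<alpha>' \<otimes>\<^bsub>G\<^esub> \<gamma>) (single \<alpha> f) r c)"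
    by (rule dual_mult_apply_left[OF single_closed[OF \<alpha> f] r \<gamma> c _ single_supp]) (use \<alpha> in auto)
  also have "\<dots> = product_summand \<alpha> (inv\<^bsub>G\<^esub> \<alpha> \<otimes>\<^bsub>G\<^esub> \<gamma>) (single \<alpha> f) r c"
    using product_summand_closed[OF single_closed[OF \<alpha> f] r \<alpha>, of "inv\<^bsub>G\<^esub> \<alpha> \<otimes>\<^bsub>G\<^esub> \<gamma>" c] \<alpha> \<gamma> c
    by (simp add: mult_inv_cancel)
  finally show ?thesis
    using \<alpha> by (simp add: product_summand_def single_def)
qed

lemma single_mult_single:
  assumes G: "\<alpha> \<in> carrier G" "\<beta> \<in> carrier G" and f: "f \<in> dual_component \<alpha>" and g: "g \<in> dual_component \<beta>"
  shows "single \<alpha> f \<otimes>\<^bsub>R\<^esub> single \<beta> g = single (\<alpha> \<otimes>\<^bsub>G\<^esub> \<beta>) (dual_hmult \<alpha> \<beta> f g)"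
proof (rule dual_eqI)
  fix \<gamma> c assume \<gamma>: "\<gamma> \<in> carrier G" and c: "c \<in> CI \<gamma>"
  let ?\<delta> = "inv\<^bsub>G\<^esub> \<alpha> \<otimes>\<^bsub>G\<^esub> \<gamma>"
  have 1: "?\<delta> = \<beta> \<longleftrightarrow> \<gamma> = \<alpha> \<otimes>\<^bsub>G\<^esub> \<beta>"
    using G \<gamma> by (auto simp: mult_inv_cancel)
  have "comult_apply (inv\<^bsub>G\<^esub> ?\<delta>) (inv\<^bsub>G\<^esub> \<alpha>) f c \<in> CI ?\<delta>"
    using G \<gamma> c f by (intro comult_apply_inv) (simp_all add: mult_inv_cancel dual_component_functional)
  then show "(single \<alpha> f \<otimes>\<^bsub>R\<^esub> single \<beta> g) \<gamma> c = single (\<alpha> \<otimes>\<^bsub>G\<^esub> \<beta>) (dual_hmult \<alpha> \<beta> f g) \<gamma> c"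
    using G \<gamma> c 1 by (auto simp: single_mult_apply[OF G(1) f single_closed[OF G(2) g] \<gamma> c] single_apply
        dual_hmult_apply)
qed (intro dual_mult_closed single_closed dual_hmult_closed G.m_closed G f g)+

text \<open>Coassociativity for the degrees \<open>\<gamma>\<^sup>-\<^sup>1\<close>, \<open>\<beta>\<^sup>-\<^sup>1\<close>, \<open>\<alpha>\<^sup>-\<^sup>1\<close>, in this order because inversion reverses products.\<close>

lemma dual_hmult_assoc:
  assumes G: "\<alpha> \<in> carrier G" "\<beta> \<in> carrier G" "\<gamma> \<in> carrier G"
    and f: "f \<in> dual_component \<alpha>" and g: "g \<in> dual_component \<beta>" and h: "h \<in> dual_component \<gamma>"
  shows "dual_hmult (\<alpha> \<otimes>\<^bsub>G\<^esub> \<beta>) \<gamma> (dual_hmult \<alpha> \<beta> f g) h = dual_hmult \<alpha> (\<beta> \<otimes>\<^bsub>G\<^esub> \<gamma>) f (dual_hmult \<beta> \<gamma> g h)"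
proof (rule dual_component_eqI[where \<alpha> = "\<alpha> \<otimes>\<^bsub>G\<^esub> \<beta> \<otimes>\<^bsub>G\<^esub> \<gamma>"])
  fix c assume c: "c \<in> CI (\<alpha> \<otimes>\<^bsub>G\<^esub> \<beta> \<otimes>\<^bsub>G\<^esub> \<gamma>)"
  then have c': "c \<in> CI (\<alpha> \<otimes>\<^bsub>G\<^esub> (\<beta> \<otimes>\<^bsub>G\<^esub> \<gamma>))"
    using G by (simp add: G.m_assoc)
  note f' = dual_component_functional[OF f] and g' = dual_component_functional[OF g]
  have "comult_apply (inv\<^bsub>G\<^esub> \<gamma>) (inv\<^bsub>G\<^esub> \<beta>) g (comult_apply (inv\<^bsub>G\<^esub> \<gamma> \<otimes>\<^bsub>G\<^esub> inv\<^bsub>G\<^esub> \<beta>) (inv\<^bsub>G\<^esub> \<alpha>) f c) =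
      comult_apply (inv\<^bsub>G\<^esub> \<gamma>) (inv\<^bsub>G\<^esub> \<beta> \<otimes>\<^bsub>G\<^esub> inv\<^bsub>G\<^esub> \<alpha>) (dual_hmult \<alpha> \<beta> f g) c"
    by (rule comult_apply_coassoc[OF _ _ _ f' g'])
      (use G c in \<open>simp_all add: dual_hmult_apply G.inv_mult_group G.m_assoc\<close>)
  moreover have "comult_apply (inv\<^bsub>G\<^esub> (\<beta> \<otimes>\<^bsub>G\<^esub> \<gamma>)) (inv\<^bsub>G\<^esub> \<alpha>) f c \<in> CI (\<beta> \<otimes>\<^bsub>G\<^esub> \<gamma>)"
    using G c' by (intro comult_apply_inv f') auto
  ultimately show "dual_hmult (\<alpha> \<otimes>\<^bsub>G\<^esub> \<beta>) \<gamma> (dual_hmult \<alpha> \<beta> f g) h c =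
      dual_hmult \<alpha> (\<beta> \<otimes>\<^bsub>G\<^esub> \<gamma>) f (dual_hmult \<beta> \<gamma> g h) c"
    using G by (simp add: dual_hmult_apply[OF c] dual_hmult_apply[OF c'] dual_hmult_apply G.inv_mult_group)
qed (use G dual_hmult_closed[OF G.m_closed[OF G(1,2)] G(3) dual_hmult_closed[OF G(1,2) f g] h]
      dual_hmult_closed[OF G(1) G.m_closed[OF G(2,3)] f dual_hmult_closed[OF G(2,3) g h]] in
    \<open>simp_all add: G.m_assoc\<close>)

lemma dual_mult_assoc:
  assumes q: "q \<in> carrier R" and r: "r \<in> carrier R" and s: "s \<in> carrier R"
  shows "(q \<otimes>\<^bsub>R\<^esub> r) \<otimes>\<^bsub>R\<^esub> s = q \<otimes>\<^bsub>R\<^esub> (r \<otimes>\<^bsub>R\<^esub> s)"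
  using q
proof (induction q rule: dual_ring_induct)
  case (add q q')
  then show ?case
    using r s by (simp add: dual_l_distr dual_mult_closed)
next
  case f: (single \<alpha> f)
  note sf = single_closed[OF f]
  show ?case
    using r
  proof (induction r rule: dual_ring_induct)
    case (add r r')
    then show ?case
      using sf s by (simp add: dual_l_distr dual_r_distr dual_mult_closed)
  next
    case g: (single \<beta> g)
    note sg = single_closed[OF g]
    show ?case
      using s
    proof (induction s rule: dual_ring_induct)
      case (add s s')
      then show ?case
        using sf sg by (simp add: dual_r_distr dual_mult_closed)
    next
      case h: (single \<gamma> h)
      show ?case
        using f g h by (simp add: single_mult_single dual_hmult_closed dual_hmult_assoc G.m_assoc)
    qed
  qed
qed

lemma counit_component: "restrict \<epsilon> (carrier (C \<one>\<^bsub>G\<^esub>)) \<in> dual_component \<one>\<^bsub>G\<^esub>"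
  using counit_hom by (intro dual_componentI[where f = \<epsilon>]) (simp_all add: bimodule_hom_def)

lemma dual_one: "\<one>\<^bsub>R\<^esub> = single \<one>\<^bsub>G\<^esub> (restrict \<epsilon> (carrier (C \<one>\<^bsub>G\<^esub>)))"
  by (auto simp: dual_ring_def single_def)

lemma dual_one_closed: "\<one>\<^bsub>R\<^esub> \<in> carrier R"
  unfolding dual_one by (intro single_closed counit_component) simp

lemma dual_l_one:
  assumes q: "q \<in> carrier R"
  shows "\<one>\<^bsub>R\<^esub> \<otimes>\<^bsub>R\<^esub> q = q"
proof (intro dual_eqI dual_mult_closed dual_one_closed q)
  fix \<gamma> c assume "\<gamma> \<in> carrier G" "c \<in> CI \<gamma>"
  then show "(\<one>\<^bsub>R\<^esub> \<otimes>\<^bsub>R\<^esub> q) \<gamma> c = q \<gamma> c"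
    unfolding dual_one by (simp add: single_mult_apply counit_component q comult_apply_counit_right)
qed

lemma dual_r_one:
  assumes q: "q \<in> carrier R"
  shows "q \<otimes>\<^bsub>R\<^esub> \<one>\<^bsub>R\<^esub> = q"
  using q
proof (induction q rule: dual_ring_induct)
  case (add q r)
  then show ?case
    by (simp add: dual_l_distr dual_one_closed)
next
  case (single \<alpha> f)
  note f' = dual_component_functional[OF single(2)]
  have "dual_hmult \<alpha> \<one>\<^bsub>G\<^esub> f (restrict \<epsilon> (carrier (C \<one>\<^bsub>G\<^esub>))) = f"
  proof (rule dual_component_eqI[of _ \<alpha>])
    show "dual_hmult \<alpha> \<one>\<^bsub>G\<^esub> f (restrict \<epsilon> (carrier (C \<one>\<^bsub>G\<^esub>))) \<in> dual_component \<alpha>"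
      using dual_hmult_closed[OF single(1) G.one_closed single(2) counit_component] single(1) by simp
    fix c assume c: "c \<in> CI \<alpha>"
    then have "comult_apply \<one>\<^bsub>G\<^esub> (inv\<^bsub>G\<^esub> \<alpha>) f c \<in> carrier (C \<one>\<^bsub>G\<^esub>)"
      using comult_apply_inv[OF single(1) G.one_closed f'] single(1) by simp
    then show "dual_hmult \<alpha> \<one>\<^bsub>G\<^esub> f (restrict \<epsilon> (carrier (C \<one>\<^bsub>G\<^esub>))) c = f c"
      using single(1) c by (simp add: dual_hmult_apply comult_apply_counit_left[OF _ _ f'])
  qed fact
  then show ?case
    unfolding dual_one using single by (simp add: single_mult_single counit_component)
qed

lemma dual_ring_ring: "ring R"
  by (intro ringI dual_abelian_group monoidI dual_mult_closed dual_one_closed dual_mult_assoc dual_l_one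
      dual_r_one dual_l_distr dual_r_distr)

subsection \<open>The right action of the base ring\<close>

lemma dual_rsmult_apply: "\<lbrakk>\<alpha> \<in> carrier G; c \<in> CI \<alpha>\<rbrakk> \<Longrightarrow> dual_rsmult q b \<alpha> c = q \<alpha> c \<otimes>\<^bsub>A\<^esub> b"
  by (simp add: dual_rsmult_def)

lemma dual_rsmult_closed:
  assumes q: "q \<in> carrier R" and b: "b \<in> carrier A"
  shows "dual_rsmult q b \<in> carrier R"
proof (rule dual_carrierI)
  show "dual_rsmult q b \<in> extensional (carrier G)"
    by (simp add: dual_rsmult_def)
  show "finite (dual_supp q)"
    using q by (rule finite_supp)
  fix \<alpha> assume \<alpha>: "\<alpha> \<in> carrier G"
  show "dual_rsmult q b \<alpha> \<in> dual_component \<alpha>"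
    by (rule dual_componentI[OF functional_postmult[OF component_functional[OF q \<alpha>] b]])
      (use \<alpha> in \<open>simp_all add: dual_rsmult_def\<close>)
qed (use b in \<open>simp add: dual_rsmult_apply outside_supp\<close>)

lemma comult_apply_dual_rsmult:
  assumes q: "q \<in> carrier R" and b: "b \<in> carrier A" and G: "\<alpha> \<in> carrier G" "\<beta> \<in> carrier G"
    and c: "c \<in> CI (\<alpha> \<otimes>\<^bsub>G\<^esub> \<beta>)"
  shows "comult_apply (inv\<^bsub>G\<^esub> \<beta>) (inv\<^bsub>G\<^esub> \<alpha>) (dual_rsmult q b \<alpha>) c =
    comult_apply (inv\<^bsub>G\<^esub> \<beta>) (inv\<^bsub>G\<^esub> \<alpha>) (q \<alpha>) c \<triangleleft>\<^bsub>C (inv\<^bsub>G\<^esub> \<beta>)\<^esub> b"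
  using G c by (intro comult_apply_postmult component_functional q b dual_rsmult_closed)
    (simp_all add: dual_rsmult_apply G.inv_mult_group)

lemma dual_rsmult_mult:
  assumes q: "q \<in> carrier R" and r: "r \<in> carrier R" and b: "b \<in> carrier A"
  shows "dual_rsmult (q \<otimes>\<^bsub>R\<^esub> r) b = q \<otimes>\<^bsub>R\<^esub> dual_rsmult r b"
proof (intro dual_eqI dual_mult_closed dual_rsmult_closed q r b)
  fix \<gamma> c assume \<gamma>: "\<gamma> \<in> carrier G" and c: "c \<in> CI \<gamma>"
  let ?t = "\<lambda>r \<alpha>. product_summand \<alpha> (inv\<^bsub>G\<^esub> \<alpha> \<otimes>\<^bsub>G\<^esub> \<gamma>) q r c"
  note expand = dual_mult_apply_left[OF q _ \<gamma> c finite_supp[OF q] order_refl supp_subset]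
  have closed: "?t r \<alpha> \<in> carrier A" if "r \<in> carrier R" "\<alpha> \<in> dual_supp q" for r \<alpha>
    using that \<gamma> c supp_in[OF that(2)] by (intro product_summand_closed q) (simp_all add: mult_inv_cancel)
  have "dual_rsmult (q \<otimes>\<^bsub>R\<^esub> r) b \<gamma> c = (\<Oplus>\<^bsub>A\<^esub>\<alpha>\<in>dual_supp q. ?t r \<alpha>) \<otimes>\<^bsub>A\<^esub> b"
    using \<gamma> c by (simp add: dual_rsmult_apply expand r)
  also have "\<dots> = (\<Oplus>\<^bsub>A\<^esub>\<alpha>\<in>dual_supp q. ?t r \<alpha> \<otimes>\<^bsub>A\<^esub> b)"
    by (rule A.finsum_ldistr[OF finite_supp[OF q] b]) (use closed r in auto)
  also have "\<dots> = (\<Oplus>\<^bsub>A\<^esub>\<alpha>\<in>dual_supp q. ?t (dual_rsmult r b) \<alpha>)"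
  proof (rule A.finsum_cong'[OF refl])
    fix \<alpha> assume \<alpha>: "\<alpha> \<in> dual_supp q"
    have "comult_apply (inv\<^bsub>G\<^esub> (inv\<^bsub>G\<^esub> \<alpha> \<otimes>\<^bsub>G\<^esub> \<gamma>)) (inv\<^bsub>G\<^esub> \<alpha>) (q \<alpha>) c \<in> CI (inv\<^bsub>G\<^esub> \<alpha> \<otimes>\<^bsub>G\<^esub> \<gamma>)"
      using supp_in[OF \<alpha>] \<gamma> c by (intro comult_apply_inv component_functional q) (simp_all add: mult_inv_cancel)
    then show "?t r \<alpha> \<otimes>\<^bsub>A\<^esub> b = ?t (dual_rsmult r b) \<alpha>"
      using supp_in[OF \<alpha>] \<gamma> by (simp add: product_summand_def dual_rsmult_apply)
  qed (use closed dual_rsmult_closed[OF r b] in auto)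
  also have "\<dots> = (q \<otimes>\<^bsub>R\<^esub> dual_rsmult r b) \<gamma> c"
    by (simp add: expand dual_rsmult_closed r b)
  finally show "dual_rsmult (q \<otimes>\<^bsub>R\<^esub> r) b \<gamma> c = (q \<otimes>\<^bsub>R\<^esub> dual_rsmult r b) \<gamma> c" .
qed

lemma
  assumes q: "q \<in> carrier R"
  shows dual_rsmult_plus_left: "\<lbrakk>r \<in> carrier R; b \<in> carrier A\<rbrakk> \<Longrightarrow>
      dual_rsmult (q \<oplus>\<^bsub>R\<^esub> r) b = dual_rsmult q b \<oplus>\<^bsub>R\<^esub> dual_rsmult r b"
    and dual_rsmult_plus_right: "\<lbrakk>a \<in> carrier A; b \<in> carrier A\<rbrakk> \<Longrightarrow>
      dual_rsmult q (a \<oplus>\<^bsub>A\<^esub> b) = dual_rsmult q a \<oplus>\<^bsub>R\<^esub> dual_rsmult q b"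
    and dual_rsmult_assoc: "\<lbrakk>a \<in> carrier A; b \<in> carrier A\<rbrakk> \<Longrightarrow>
      dual_rsmult q (a \<otimes>\<^bsub>A\<^esub> b) = dual_rsmult (dual_rsmult q a) b"
    and dual_rsmult_one: "dual_rsmult q \<one>\<^bsub>A\<^esub> = q"
  by (rule dual_eqI; simp add: q dual_plus_closed dual_rsmult_closed dual_plus_apply dual_rsmult_apply
      component_closed A.l_distr A.r_distr A.m_assoc)+

end

section \<open>Modules, connecting maps and separation of points\<close>

lemma (in left_module) zero_smult: "m \<in> carrier M \<Longrightarrow> \<zero>\<^bsub>S\<^esub> \<odot>\<^bsub>M\<^esub> m = \<zero>\<^bsub>M\<^esub>"
  using lsmult_l_distr[of "\<zero>\<^bsub>S\<^esub>" "\<zero>\<^bsub>S\<^esub>" m] lsmult_closed[of "\<zero>\<^bsub>S\<^esub>" m] by simp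

lemma (in left_module) finsum_smult:
  assumes "finite F" "f \<in> F \<rightarrow> carrier S" "m \<in> carrier M"
  shows "(\<Oplus>\<^bsub>S\<^esub>i\<in>F. f i) \<odot>\<^bsub>M\<^esub> m = (\<Oplus>\<^bsub>M\<^esub>i\<in>F. f i \<odot>\<^bsub>M\<^esub> m)"
  using assms
proof (induction F rule: finite_induct)
  case empty
  then show ?case by (simp add: zero_smult)
next
  case (insert i F)
  then show ?case by (simp add: Pi_iff lsmult_l_distr lsmult_closed S.finsum_closed)
qed

lemma (in right_module) rsmult_zero: "m \<in> carrier M \<Longrightarrow> m \<triangleleft>\<^bsub>M\<^esub> \<zero>\<^bsub>R\<^esub> = \<zero>\<^bsub>M\<^esub>"
  using rsmult_r_distr[of m "\<zero>\<^bsub>R\<^esub>" "\<zero>\<^bsub>R\<^esub>"] rsmult_closed[of m "\<zero>\<^bsub>R\<^esub>"] by simp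

lemma (in right_module) rsmult_finsum:
  assumes "finite F" "f \<in> F \<rightarrow> carrier R" "m \<in> carrier M"
  shows "m \<triangleleft>\<^bsub>M\<^esub> (\<Oplus>\<^bsub>R\<^esub>i\<in>F. f i) = (\<Oplus>\<^bsub>M\<^esub>i\<in>F. m \<triangleleft>\<^bsub>M\<^esub> f i)"
  using assms
proof (induction F rule: finite_induct)
  case empty
  then show ?case by (simp add: rsmult_zero)
next
  case (insert i F)
  then show ?case by (simp add: Pi_iff rsmult_r_distr rsmult_closed R.finsum_closed)
qed

text \<open>The criterion for connecting maps of Morita contexts: the outer actions on both sides come from the
  ring in which the map takes its values.\<close>

lemma tensor_lift_regular_hom:
  assumes M: "bimodule S A M" and N: "bimodule A S N" and f: "balanced_map A M N S f"
    and l: "\<And>s m n. \<lbrakk>s \<in> carrier S; m \<in> carrier M; n \<in> carrier N\<rbrakk> \<Longrightarrow> f (s \<odot>\<^bsub>M\<^esub> m) n = s \<otimes>\<^bsub>S\<^esub> f m n"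
    and r: "\<And>s m n. \<lbrakk>s \<in> carrier S; m \<in> carrier M; n \<in> carrier N\<rbrakk> \<Longrightarrow> f m (n \<triangleleft>\<^bsub>N\<^esub> s) = f m n \<otimes>\<^bsub>S\<^esub> s"
  shows "tensor_lift S f \<in> bimodule_hom S S (tensor A M N) (regular_bimodule S)"
proof -
  interpret BM: bimodule S A M by fact
  interpret BN: bimodule A S N by fact
  interpret tensor_pair A M N by (rule tensor_pairI) fact+
  note t = tensor_lift_pure[OF BM.S.abelian_group_axioms f] tensor_lift_closed[OF BM.S.abelian_group_axioms f]
    tensor_lift_add[OF BM.S.abelian_group_axioms f]
  have "tensor_lift S f (s \<odot>\<^bsub>MN\<^esub> Z) = s \<otimes>\<^bsub>S\<^esub> tensor_lift S f Z"
    if s: "s \<in> carrier S" and Z: "Z \<in> carrier MN" for s Z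
    using Z
  proof (induction rule: tensor_induct)
    case (pure m n)
    then show ?case using s by (simp add: smult_pure[OF M] t l BM.lsmult_closed)
  next
    case (add Z W)
    then show ?case using s by (simp add: smult_add[OF M] smult_closed[OF M] t BM.S.r_distr)
  qed
  moreover have "tensor_lift S f (Z \<triangleleft>\<^bsub>MN\<^esub> s) = tensor_lift S f Z \<otimes>\<^bsub>S\<^esub> s"
    if s: "s \<in> carrier S" and Z: "Z \<in> carrier MN" for s Z
    using Z
  proof (induction rule: tensor_induct)
    case (pure m n)
    then show ?case using s by (simp add: rsmult_pure[OF N] t r BN.rsmult_closed)
  next
    case (add Z W)
    then show ?case using s by (simp add: rsmult_add[OF N] rsmult_closed[OF N] t BM.S.l_distr)
  qed
  ultimately show ?thesis
    by (simp add: bimodule_hom_def left_linear_def regular_bimodule_simps t)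
qed

lemma (in tensor_pair) tensor_map_id:
  assumes "Z \<in> carrier MN"
  shows "tensor_map A M N id id Z = Z"
proof -
  have "balanced_map A M N MN (\<lambda>m n. pt (id m) (id n))"
    using pure_balanced_map by simp
  note t = tensor_lift_pure[OF tensor_abelian_group this, folded tensor_map_def, unfolded id_apply]
    tensor_lift_add[OF tensor_abelian_group this, folded tensor_map_def, unfolded id_apply]
  show ?thesis
    using assms by (induction rule: tensor_induct) (simp_all add: t)
qed

lemma morita_isomorphic_refl:
  assumes K: "morita_context K"
  shows "morita_isomorphic K K"
proof -
  have P: "bimodule (ringS K) (ringR K) (modP K)" and Q: "bimodule (ringR K) (ringS K) (modQ K)"
    using K by (simp_all add: morita_context_def Let_def)
  have PQ: "tensor_map (ringR K) (modP K) (modQ K) id id t = t"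
    if "t \<in> carrier (tensor (ringR K) (modP K) (modQ K))" for t
    using tensor_pair.tensor_map_id[OF tensor_pairI[OF P Q] that] .
  have QP: "tensor_map (ringS K) (modQ K) (modP K) id id t = t"
    if "t \<in> carrier (tensor (ringS K) (modQ K) (modP K))" for t
    using tensor_pair.tensor_map_id[OF tensor_pairI[OF Q P] that] .
  have iso: "id \<in> ring_iso R R" for R :: "'x ring"
    by (simp add: ring_iso_def ring_hom_def)
  have biso: "id \<in> bimodule_iso_over S R id id M M"
    for S :: "'s ring" and R :: "'r ring" and M :: "('s, 'r, 'm) bimodule"
    by (simp add: bimodule_iso_over_def)
  show ?thesis
    unfolding morita_isomorphic_def
    by (intro conjI K exI[of _ id] iso biso ballI) (simp_all only: PQ QP id_apply)
qed

text \<open>The coordinates of an embedding into a free module are functionals, and an embedding is injective.\<close>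

lemma left_projective_separating:
  fixes M :: "('s, 'm, 'y) module_scheme"
  assumes M: "left_projective S M" and c: "c \<in> carrier M" "d \<in> carrier M"
    and eq: "\<And>f. f \<in> left_linear S M (regular_bimodule S) \<Longrightarrow> f c = f d"
  shows "c = d"
proof -
  obtain I :: "'m set" and U j where j: "j \<in> left_linear S M (free_left_module S I)" and inj: "bij_betw j (carrier M) U"
    using M unfolding left_projective_def by blast
  have j_closed: "j m \<in> I \<rightarrow>\<^sub>E carrier S" if "m \<in> carrier M" for m
    using j that by (auto simp: left_linear_def free_left_module_def)
  have "j c i = j d i" if i: "i \<in> I" for i
  proof (rule eq)
    show "(\<lambda>m. j m i) \<in> left_linear S M (regular_bimodule S)"
      using j i j_closed by (auto simp: left_linear_def free_left_module_def regular_bimodule_simps)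
  qed
  then have "j c = j d"
    using PiE_ext[OF j_closed[OF c(1)] j_closed[OF c(2)]] by blast
  then show ?thesis
    using inj c by (auto simp: bij_betw_def inj_on_def)
qed

section \<open>The Morita context of a grouplike family\<close>

context grouplike_coring
begin

lemma grouplike_inv_closed: "\<alpha> \<in> carrier G \<Longrightarrow> x (inv\<^bsub>G\<^esub> \<alpha>) \<in> CI \<alpha>"
  by (simp add: grouplike_closed)

lemma grouplike_rsmult_closed:
  assumes "\<alpha> \<in> carrier G" "a \<in> carrier A"
  shows "x \<alpha> \<triangleleft>\<^bsub>C \<alpha>\<^esub> a \<in> carrier (C \<alpha>)"
proof -
  interpret bimodule A A "C \<alpha>" by (rule bimodule_C) fact
  show ?thesis using assms by (simp add: rsmult_closed grouplike_closed)
qed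

lemma grouplike_inv_rsmult_closed: "\<lbrakk>\<alpha> \<in> carrier G; a \<in> carrier A\<rbrakk> \<Longrightarrow> x (inv\<^bsub>G\<^esub> \<alpha>) \<triangleleft>\<^bsub>C (inv\<^bsub>G\<^esub> \<alpha>)\<^esub> a \<in> CI \<alpha>"
  by (intro grouplike_rsmult_closed G.inv_closed)

lemma grouplike_eval_summand_closed: "\<lbrakk>a \<in> carrier A; q \<in> carrier R; \<alpha> \<in> carrier G\<rbrakk> \<Longrightarrow>
    q \<alpha> (x (inv\<^bsub>G\<^esub> \<alpha>) \<triangleleft>\<^bsub>C (inv\<^bsub>G\<^esub> \<alpha>)\<^esub> a) \<in> carrier A"
  by (rule component_closed[OF _ _ grouplike_inv_rsmult_closed])

text \<open>Since \<open>x\<close> is grouplike, \<open>\<Delta>(x\<^bsub>\<gamma>\<delta>\<^esub> a) = x\<^sub>\<gamma> \<otimes> x\<^sub>\<delta> a\<close>.\<close>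

lemma comult_apply_grouplike:
  assumes G: "\<gamma> \<in> carrier G" "\<delta> \<in> carrier G" and f: "f \<in> functionals \<delta>" and a: "a \<in> carrier A"
  shows "comult_apply \<gamma> \<delta> f (x (\<gamma> \<otimes>\<^bsub>G\<^esub> \<delta>) \<triangleleft>\<^bsub>C (\<gamma> \<otimes>\<^bsub>G\<^esub> \<delta>)\<^esub> a) = x \<gamma> \<triangleleft>\<^bsub>C \<gamma>\<^esub> f (x \<delta> \<triangleleft>\<^bsub>C \<delta>\<^esub> a)"
  using comult_apply_pure[OF G functional_precomp[OF G(2) f a] grouplike_closed[OF G(1)]
      grouplike_closed[OF G(2)] grouplike_comult[OF G]]
  by (simp add: comult_apply_rsmult G f a grouplike_closed)

lemma grouplike_eval_eq_sum:
  assumes q: "q \<in> carrier R" and a: "a \<in> carrier A" and F: "finite F" "dual_supp q \<subseteq> F" "F \<subseteq> carrier G"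
  shows "grouplike_eval a q = (\<Oplus>\<^bsub>A\<^esub>\<alpha>\<in>F. q \<alpha> (x (inv\<^bsub>G\<^esub> \<alpha>) \<triangleleft>\<^bsub>C (inv\<^bsub>G\<^esub> \<alpha>)\<^esub> a))"
  unfolding grouplike_eval_def
proof (rule A.add.finprod_mono_neutral_cong_left)
  show "(\<lambda>\<alpha>. q \<alpha> (x (inv\<^bsub>G\<^esub> \<alpha>) \<triangleleft>\<^bsub>C (inv\<^bsub>G\<^esub> \<alpha>)\<^esub> a)) \<in> F \<rightarrow> carrier A"
    using F(3) a q by (intro funcsetI grouplike_eval_summand_closed[of a q]) auto
  fix \<alpha> assume \<alpha>: "\<alpha> \<in> F - dual_supp q"
  then have "\<alpha> \<in> carrier G"
    using F(3) by auto
  with \<alpha> a show "q \<alpha> (x (inv\<^bsub>G\<^esub> \<alpha>) \<triangleleft>\<^bsub>C (inv\<^bsub>G\<^esub> \<alpha>)\<^esub> a) = \<zero>\<^bsub>A\<^esub>"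
    by (intro outside_supp grouplike_rsmult_closed) auto
qed (use F in auto)

lemma grouplike_eval_closed: "\<lbrakk>a \<in> carrier A; q \<in> carrier R\<rbrakk> \<Longrightarrow> grouplike_eval a q \<in> carrier A"
  unfolding grouplike_eval_def
  by (intro A.finsum_closed funcsetI grouplike_eval_summand_closed[of a q] supp_in)

lemma grouplike_eval_single:
  assumes "a \<in> carrier A" "\<alpha> \<in> carrier G" "f \<in> dual_component \<alpha>"
  shows "grouplike_eval a (single \<alpha> f) = f (x (inv\<^bsub>G\<^esub> \<alpha>) \<triangleleft>\<^bsub>C (inv\<^bsub>G\<^esub> \<alpha>)\<^esub> a)"
proof -
  have "f (x (inv\<^bsub>G\<^esub> \<alpha>) \<triangleleft>\<^bsub>C (inv\<^bsub>G\<^esub> \<alpha>)\<^esub> a) \<in> carrier A"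
    by (rule functional_closed[OF dual_component_functional[OF assms(3)] grouplike_inv_rsmult_closed[OF assms(2,1)]])
  then show ?thesis
    using grouplike_eval_eq_sum[OF single_closed[OF assms(2,3)] assms(1) _ single_supp] assms(2)
    by (simp add: single_def)
qed

text \<open>A common index set for the two sums is the union of the supports; the support of the sum lies in it.\<close>

lemma grouplike_eval_plus_right:
  assumes a: "a \<in> carrier A" and q: "q \<in> carrier R" and r: "r \<in> carrier R"
  shows "grouplike_eval a (q \<oplus>\<^bsub>R\<^esub> r) = grouplike_eval a q \<oplus>\<^bsub>A\<^esub> grouplike_eval a r"
proof -
  let ?F = "dual_supp q \<union> dual_supp r" and ?x = "\<lambda>\<alpha>. x (inv\<^bsub>G\<^esub> \<alpha>) \<triangleleft>\<^bsub>C (inv\<^bsub>G\<^esub> \<alpha>)\<^esub> a"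
  have F: "finite ?F" "?F \<subseteq> carrier G"
    using finite_supp q r supp_subset by auto
  have supp: "dual_supp (q \<oplus>\<^bsub>R\<^esub> r) \<subseteq> ?F"
    by (rule supp_subsetI) (auto simp: dual_plus_apply outside_supp component_in dual_plus_closed q r)
  have x_closed: "?x \<alpha> \<in> CI \<alpha>" if "\<alpha> \<in> ?F" for \<alpha>
    using that a by (intro grouplike_rsmult_closed G.inv_closed) (auto dest: supp_in)
  have "grouplike_eval a (q \<oplus>\<^bsub>R\<^esub> r) = (\<Oplus>\<^bsub>A\<^esub>\<alpha>\<in>?F. (q \<oplus>\<^bsub>R\<^esub> r) \<alpha> (?x \<alpha>))"
    by (rule grouplike_eval_eq_sum[OF dual_plus_closed[OF q r] a F(1) supp F(2)])
  also have "\<dots> = (\<Oplus>\<^bsub>A\<^esub>\<alpha>\<in>?F. q \<alpha> (?x \<alpha>) \<oplus>\<^bsub>A\<^esub> r \<alpha> (?x \<alpha>))"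
    using F(2) x_closed by (intro A.finsum_cong'[OF refl] funcsetI A.a_closed component_closed q r dual_plus_apply) auto
  also have "\<dots> = (\<Oplus>\<^bsub>A\<^esub>\<alpha>\<in>?F. q \<alpha> (?x \<alpha>)) \<oplus>\<^bsub>A\<^esub> (\<Oplus>\<^bsub>A\<^esub>\<alpha>\<in>?F. r \<alpha> (?x \<alpha>))"
    using F(2) x_closed by (intro A.finsum_addf funcsetI component_closed q r) auto
  also have "\<dots> = grouplike_eval a q \<oplus>\<^bsub>A\<^esub> grouplike_eval a r"
    using grouplike_eval_eq_sum[OF q a F(1) _ F(2)] grouplike_eval_eq_sum[OF r a F(1) _ F(2)] by simp
  finally show ?thesis .
qed

lemma grouplike_eval_plus_left:
  assumes a: "a \<in> carrier A" and b: "b \<in> carrier A" and q: "q \<in> carrier R"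
  shows "grouplike_eval (a \<oplus>\<^bsub>A\<^esub> b) q = grouplike_eval a q \<oplus>\<^bsub>A\<^esub> grouplike_eval b q"
  using q
proof (induction q rule: dual_ring_induct)
  case (single \<alpha> f)
  interpret bimodule A A "C (inv\<^bsub>G\<^esub> \<alpha>)" by (rule bimodule_C) (use single in simp)
  show ?case
    using single a b grouplike_inv_closed[of \<alpha>]
    by (simp add: grouplike_eval_single rsmult_r_distr functional_add[OF dual_component_functional] rsmult_closed)
next
  case (add q r)
  then show ?case
    using a b by (simp add: grouplike_eval_plus_right grouplike_eval_closed A.a_ac)
qed

lemma grouplike_eval_one:
  assumes a: "a \<in> carrier A"
  shows "grouplike_eval a \<one>\<^bsub>R\<^esub> = a"
proof -
  have "\<epsilon> (x \<one>\<^bsub>G\<^esub> \<triangleleft>\<^bsub>C \<one>\<^bsub>G\<^esub>\<^esub> a) = \<epsilon> (x \<one>\<^bsub>G\<^esub>) \<otimes>\<^bsub>A\<^esub> a"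
    using counit_hom a by (simp add: bimodule_hom_def regular_bimodule_simps grouplike_closed)
  then show ?thesis
    using a unfolding dual_one by (simp add: grouplike_eval_single counit_component grouplike_counit grouplike_rsmult_closed)
qed

text \<open>For homogeneous \<open>f\<close> and \<open>g\<close> of degrees \<open>\<alpha>\<close> and \<open>\<beta>\<close> this is
  \<open>g(c\<^sub>(\<^sub>1\<^sub>) f(c\<^sub>(\<^sub>2\<^sub>))) = g(x\<^bsub>\<beta>\<^sup>-\<^sup>1\<^esub> f(x\<^bsub>\<alpha>\<^sup>-\<^sup>1\<^esub> a))\<close> for \<open>c = x\<^bsub>(\<alpha>\<beta>)\<^sup>-\<^sup>1\<^esub> a\<close>, the law of a right \<open>R\<close>-module.\<close>

lemma grouplike_eval_mult:
  assumes a: "a \<in> carrier A" and q: "q \<in> carrier R" and r: "r \<in> carrier R"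
  shows "grouplike_eval a (q \<otimes>\<^bsub>R\<^esub> r) = grouplike_eval (grouplike_eval a q) r"
  using q
proof (induction q rule: dual_ring_induct)
  case (add q q')
  then show ?case
    using a r by (simp add: dual_l_distr grouplike_eval_plus_right grouplike_eval_plus_left dual_mult_closed grouplike_eval_closed)
next
  case f: (single \<alpha> f)
  note sf = single_closed[OF f] and f' = dual_component_functional[OF f(2)]
  show ?case
    using r
  proof (induction r rule: dual_ring_induct)
    case (add r r')
    then show ?case
      using a sf by (simp add: dual_r_distr grouplike_eval_plus_right dual_mult_closed grouplike_eval_closed)
  next
    case g: (single \<beta> g)
    have "x (inv\<^bsub>G\<^esub> (\<alpha> \<otimes>\<^bsub>G\<^esub> \<beta>)) \<triangleleft>\<^bsub>C (inv\<^bsub>G\<^esub> (\<alpha> \<otimes>\<^bsub>G\<^esub> \<beta>))\<^esub> a \<in> CI (\<alpha> \<otimes>\<^bsub>G\<^esub> \<beta>)"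
      by (rule grouplike_inv_rsmult_closed) (use a f g in auto)
    moreover have "f (x (inv\<^bsub>G\<^esub> \<alpha>) \<triangleleft>\<^bsub>C (inv\<^bsub>G\<^esub> \<alpha>)\<^esub> a) \<in> carrier A"
      by (rule functional_closed[OF f' grouplike_inv_rsmult_closed[OF f(1) a]])
    ultimately show ?case
      using a f g comult_apply_grouplike[of "inv\<^bsub>G\<^esub> \<beta>" "inv\<^bsub>G\<^esub> \<alpha>" f a] f'
      by (simp add: single_mult_single grouplike_eval_single dual_hmult_closed dual_hmult_apply G.inv_mult_group)
  qed
qed

lemma grouplike_eval_dual_rsmult:
  assumes a: "a \<in> carrier A" and q: "q \<in> carrier R" and b: "b \<in> carrier A"
  shows "grouplike_eval a (dual_rsmult q b) = grouplike_eval a q \<otimes>\<^bsub>A\<^esub> b"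
proof -
  let ?x = "\<lambda>\<alpha>. x (inv\<^bsub>G\<^esub> \<alpha>) \<triangleleft>\<^bsub>C (inv\<^bsub>G\<^esub> \<alpha>)\<^esub> a"
  have supp: "dual_supp (dual_rsmult q b) \<subseteq> dual_supp q"
    by (rule supp_subsetI) (use b in \<open>auto simp: dual_rsmult_apply outside_supp component_in dual_rsmult_closed q\<close>)
  have x_closed: "?x \<alpha> \<in> CI \<alpha>" if "\<alpha> \<in> dual_supp q" for \<alpha>
    using supp_in[OF that] a by (intro grouplike_rsmult_closed G.inv_closed)
  have "grouplike_eval a (dual_rsmult q b) = (\<Oplus>\<^bsub>A\<^esub>\<alpha>\<in>dual_supp q. dual_rsmult q b \<alpha> (?x \<alpha>))"
    by (rule grouplike_eval_eq_sum[OF dual_rsmult_closed[OF q b] a finite_supp[OF q] supp supp_subset])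
  also have "\<dots> = (\<Oplus>\<^bsub>A\<^esub>\<alpha>\<in>dual_supp q. q \<alpha> (?x \<alpha>) \<otimes>\<^bsub>A\<^esub> b)"
    using x_closed by (intro A.finsum_cong'[OF refl] funcsetI A.m_closed component_closed q b dual_rsmult_apply)
      (auto dest: supp_in)
  also have "\<dots> = grouplike_eval a q \<otimes>\<^bsub>A\<^esub> b"
    unfolding grouplike_eval_def using x_closed
    by (intro A.finsum_ldistr[symmetric] finite_supp q b funcsetI component_closed) (auto dest: supp_in)
  finally show ?thesis .
qed

lemma T_closed: "t \<in> T_set \<Longrightarrow> t \<in> carrier A"
  by (simp add: T_set_def)

lemma T_commutes: "t \<in> T_set \<Longrightarrow> \<alpha> \<in> carrier G \<Longrightarrow> x \<alpha> \<triangleleft>\<^bsub>C \<alpha>\<^esub> t = t \<odot>\<^bsub>C \<alpha>\<^esub> x \<alpha>"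
  by (simp add: T_set_def)

text \<open>An element of \<open>T\<close> moves past \<open>x\<close> to the left, where the functionals are linear.\<close>

lemma grouplike_eval_T_smult:
  assumes t: "t \<in> T_set" and a: "a \<in> carrier A" and q: "q \<in> carrier R"
  shows "grouplike_eval (t \<otimes>\<^bsub>A\<^esub> a) q = t \<otimes>\<^bsub>A\<^esub> grouplike_eval a q"
  using q
proof (induction q rule: dual_ring_induct)
  case (single \<alpha> f)
  interpret bimodule A A "C (inv\<^bsub>G\<^esub> \<alpha>)" by (rule bimodule_C) (use single in simp)
  have "x (inv\<^bsub>G\<^esub> \<alpha>) \<triangleleft>\<^bsub>C (inv\<^bsub>G\<^esub> \<alpha>)\<^esub> (t \<otimes>\<^bsub>A\<^esub> a) = t \<odot>\<^bsub>C (inv\<^bsub>G\<^esub> \<alpha>)\<^esub> (x (inv\<^bsub>G\<^esub> \<alpha>) \<triangleleft>\<^bsub>C (inv\<^bsub>G\<^esub> \<alpha>)\<^esub> a)"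
    using single a t grouplike_inv_closed[of \<alpha>]
    by (simp add: rsmult_assoc T_closed T_commutes bismult_assoc)
  then show ?case
    using single a t grouplike_inv_closed[of \<alpha>]
    by (simp add: grouplike_eval_single T_closed functional_smult[OF dual_component_functional] rsmult_closed)
next
  case (add q r)
  then show ?case
    using a t by (simp add: grouplike_eval_plus_right grouplike_eval_closed T_closed A.r_distr)
qed

lemma T_subring: "subring T_set A"
proof (rule A.subringI)
  have one: "\<one>\<^bsub>A\<^esub> \<in> T_set"
  proof -
    have "\<one>\<^bsub>A\<^esub> \<odot>\<^bsub>C \<alpha>\<^esub> x \<alpha> = x \<alpha> \<triangleleft>\<^bsub>C \<alpha>\<^esub> \<one>\<^bsub>A\<^esub>" if "\<alpha> \<in> carrier G" for \<alpha>
    proof -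
      interpret bimodule A A "C \<alpha>" by (rule bimodule_C) fact
      show ?thesis using that by (simp add: lsmult_one rsmult_one grouplike_closed)
    qed
    then show ?thesis by (simp add: T_set_def)
  qed
  then show "\<one>\<^bsub>A\<^esub> \<in> T_set" .
  show "T_set \<subseteq> carrier A"
    by (auto simp: T_set_def)
  fix s t assume s: "s \<in> T_set" and t: "t \<in> T_set"
  note st = T_closed[OF s] T_closed[OF t]
  have "(s \<oplus>\<^bsub>A\<^esub> t) \<odot>\<^bsub>C \<alpha>\<^esub> x \<alpha> = x \<alpha> \<triangleleft>\<^bsub>C \<alpha>\<^esub> (s \<oplus>\<^bsub>A\<^esub> t)"
    and "(s \<otimes>\<^bsub>A\<^esub> t) \<odot>\<^bsub>C \<alpha>\<^esub> x \<alpha> = x \<alpha> \<triangleleft>\<^bsub>C \<alpha>\<^esub> (s \<otimes>\<^bsub>A\<^esub> t)"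
    and "(\<ominus>\<^bsub>A\<^esub> s) \<odot>\<^bsub>C \<alpha>\<^esub> x \<alpha> = x \<alpha> \<triangleleft>\<^bsub>C \<alpha>\<^esub> (\<ominus>\<^bsub>A\<^esub> s)" if \<alpha>: "\<alpha> \<in> carrier G" for \<alpha>
  proof -
    interpret bimodule A A "C \<alpha>" by (rule bimodule_C) fact
    note x\<alpha> = grouplike_closed[OF \<alpha>]
    show "(s \<oplus>\<^bsub>A\<^esub> t) \<odot>\<^bsub>C \<alpha>\<^esub> x \<alpha> = x \<alpha> \<triangleleft>\<^bsub>C \<alpha>\<^esub> (s \<oplus>\<^bsub>A\<^esub> t)"
      using st x\<alpha> by (simp add: lsmult_l_distr rsmult_r_distr T_commutes s t \<alpha>)
    show "(s \<otimes>\<^bsub>A\<^esub> t) \<odot>\<^bsub>C \<alpha>\<^esub> x \<alpha> = x \<alpha> \<triangleleft>\<^bsub>C \<alpha>\<^esub> (s \<otimes>\<^bsub>A\<^esub> t)"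
      using st x\<alpha> bismult_assoc[OF st(1) x\<alpha> st(2)]
      by (simp add: lsmult_assoc rsmult_assoc T_commutes s t \<alpha>)
    have "(\<ominus>\<^bsub>A\<^esub> s) \<odot>\<^bsub>C \<alpha>\<^esub> x \<alpha> \<oplus>\<^bsub>C \<alpha>\<^esub> s \<odot>\<^bsub>C \<alpha>\<^esub> x \<alpha> = x \<alpha> \<triangleleft>\<^bsub>C \<alpha>\<^esub> (\<ominus>\<^bsub>A\<^esub> s) \<oplus>\<^bsub>C \<alpha>\<^esub> s \<odot>\<^bsub>C \<alpha>\<^esub> x \<alpha>"
      using st x\<alpha> lsmult_l_distr[of "\<ominus>\<^bsub>A\<^esub> s" s "x \<alpha>"] rsmult_r_distr[of "x \<alpha>" "\<ominus>\<^bsub>A\<^esub> s" s]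
      by (simp add: T_commutes[OF s \<alpha>] A.l_neg zero_smult rsmult_zero)
    then show "(\<ominus>\<^bsub>A\<^esub> s) \<odot>\<^bsub>C \<alpha>\<^esub> x \<alpha> = x \<alpha> \<triangleleft>\<^bsub>C \<alpha>\<^esub> (\<ominus>\<^bsub>A\<^esub> s)"
      using st x\<alpha> by (simp add: lsmult_closed rsmult_closed)
  qed
  then show "s \<oplus>\<^bsub>A\<^esub> t \<in> T_set" "s \<otimes>\<^bsub>A\<^esub> t \<in> T_set" "\<ominus>\<^bsub>A\<^esub> s \<in> T_set"
    using st by (simp_all add: T_set_def)
qed

lemma T_ring_ring: "ring T_ring"
  unfolding T_ring_def by (rule A.subring_is_ring[OF T_subring])

lemma T_ring_simps:
  "carrier T_ring = T_set" "u \<otimes>\<^bsub>T_ring\<^esub> v = u \<otimes>\<^bsub>A\<^esub> v" "u \<oplus>\<^bsub>T_ring\<^esub> v = u \<oplus>\<^bsub>A\<^esub> v"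
  "\<one>\<^bsub>T_ring\<^esub> = \<one>\<^bsub>A\<^esub>" "\<zero>\<^bsub>T_ring\<^esub> = \<zero>\<^bsub>A\<^esub>"
  by (simp_all add: T_ring_def)

lemma A_bimodule_simps:
  "carrier A_bimodule = carrier A" "u \<oplus>\<^bsub>A_bimodule\<^esub> v = u \<oplus>\<^bsub>A\<^esub> v" "\<zero>\<^bsub>A_bimodule\<^esub> = \<zero>\<^bsub>A\<^esub>"
  "u \<odot>\<^bsub>A_bimodule\<^esub> v = u \<otimes>\<^bsub>A\<^esub> v" "u \<triangleleft>\<^bsub>A_bimodule\<^esub> q = grouplike_eval u q"
  by (simp_all add: A_bimodule_def)

lemma sub_bimodule_simps:
  "carrier (sub_bimodule U) = U" "u \<oplus>\<^bsub>sub_bimodule U\<^esub> v = u \<oplus>\<^bsub>R\<^esub> v" "\<zero>\<^bsub>sub_bimodule U\<^esub> = \<zero>\<^bsub>R\<^esub>"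
  "u \<odot>\<^bsub>sub_bimodule U\<^esub> v = u \<otimes>\<^bsub>R\<^esub> v" "u \<triangleleft>\<^bsub>sub_bimodule U\<^esub> a = dual_rsmult u a"
  by (simp_all add: sub_bimodule_def)

lemma bimodule_A: "bimodule T_ring R A_bimodule"
proof -
  have "abelian_group A_bimodule"
    using A.add.l_inv_ex by (intro abelian_groupI) (simp_all add: A_bimodule_simps A.a_ac)
  then show ?thesis
    by (intro bimodule.intro left_module.intro right_module.intro left_module_axioms.intro
        right_module_axioms.intro bimodule_axioms.intro T_ring_ring dual_ring_ring)
      (simp_all add: A_bimodule_simps T_ring_simps T_closed A.l_distr A.r_distr A.m_assoc
        grouplike_eval_closed grouplike_eval_plus_left grouplike_eval_plus_right grouplike_eval_mult grouplike_eval_one grouplike_eval_T_smult)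
qed

lemma O_closed: "q \<in> O_set \<Longrightarrow> q \<in> carrier R"
  by (simp add: O_set_def)

lemma O_eq:
  "\<lbrakk>q \<in> O_set; \<alpha> \<in> carrier G; \<beta> \<in> carrier G; c \<in> CI (\<alpha> \<otimes>\<^bsub>G\<^esub> \<beta>)\<rbrakk> \<Longrightarrow>
    comult_apply (inv\<^bsub>G\<^esub> \<beta>) (inv\<^bsub>G\<^esub> \<alpha>) (q \<alpha>) c = q (\<alpha> \<otimes>\<^bsub>G\<^esub> \<beta>) c \<odot>\<^bsub>C (inv\<^bsub>G\<^esub> \<beta>)\<^esub> x (inv\<^bsub>G\<^esub> \<beta>)"
  by (simp add: O_set_def)

lemma O_plus:
  assumes q: "q \<in> O_set" and r: "r \<in> O_set"
  shows "q \<oplus>\<^bsub>R\<^esub> r \<in> O_set"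
  unfolding O_set_def
proof (intro CollectI conjI ballI dual_plus_closed O_closed q r)
  fix \<alpha> \<beta> c assume G: "\<alpha> \<in> carrier G" "\<beta> \<in> carrier G" and c: "c \<in> CI (\<alpha> \<otimes>\<^bsub>G\<^esub> \<beta>)"
  interpret bimodule A A "C (inv\<^bsub>G\<^esub> \<beta>)" by (rule bimodule_C) (use G in simp)
  have "comult_apply (inv\<^bsub>G\<^esub> \<beta>) (inv\<^bsub>G\<^esub> \<alpha>) ((q \<oplus>\<^bsub>R\<^esub> r) \<alpha>) c =
      comult_apply (inv\<^bsub>G\<^esub> \<beta>) (inv\<^bsub>G\<^esub> \<alpha>) (q \<alpha>) c \<oplus>\<^bsub>C (inv\<^bsub>G\<^esub> \<beta>)\<^esub> comult_apply (inv\<^bsub>G\<^esub> \<beta>) (inv\<^bsub>G\<^esub> \<alpha>) (r \<alpha>) c"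
    using G c by (intro comult_apply_plus component_functional dual_plus_closed O_closed q r)
      (simp_all add: dual_plus_apply G.inv_mult_group)
  then show "comult_apply (inv\<^bsub>G\<^esub> \<beta>) (inv\<^bsub>G\<^esub> \<alpha>) ((q \<oplus>\<^bsub>R\<^esub> r) \<alpha>) c =
      (q \<oplus>\<^bsub>R\<^esub> r) (\<alpha> \<otimes>\<^bsub>G\<^esub> \<beta>) c \<odot>\<^bsub>C (inv\<^bsub>G\<^esub> \<beta>)\<^esub> x (inv\<^bsub>G\<^esub> \<beta>)"
    using G c by (simp add: O_eq q r dual_plus_apply lsmult_l_distr component_closed O_closed grouplike_inv_closed)
qed

text \<open>Coassociativity turns contraction with a component of \<open>f # q\<close> into contraction of
  \<open>d = c\<^sub>(\<^sub>1\<^sub>) f(c\<^sub>(\<^sub>2\<^sub>))\<close> with a component of \<open>q\<close>, and the relation that defines \<open>O\<close> applies to \<open>d\<close>.\<close>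

lemma O_single_mult:
  assumes \<delta>: "\<delta> \<in> carrier G" and f: "f \<in> dual_component \<delta>" and q: "q \<in> O_set"
  shows "single \<delta> f \<otimes>\<^bsub>R\<^esub> q \<in> O_set"
  unfolding O_set_def
proof (intro CollectI conjI ballI dual_mult_closed single_closed O_closed \<delta> f q)
  fix \<alpha> \<beta> c assume G: "\<alpha> \<in> carrier G" "\<beta> \<in> carrier G" and c: "c \<in> CI (\<alpha> \<otimes>\<^bsub>G\<^esub> \<beta>)"
  let ?\<alpha> = "inv\<^bsub>G\<^esub> \<delta> \<otimes>\<^bsub>G\<^esub> \<alpha>"
  note f' = dual_component_functional[OF f]
  have \<alpha>: "?\<alpha> \<in> carrier G" "\<delta> \<otimes>\<^bsub>G\<^esub> ?\<alpha> = \<alpha>" "inv\<^bsub>G\<^esub> ?\<alpha> \<otimes>\<^bsub>G\<^esub> inv\<^bsub>G\<^esub> \<delta> = inv\<^bsub>G\<^esub> \<alpha>"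
    "\<delta> \<otimes>\<^bsub>G\<^esub> (?\<alpha> \<otimes>\<^bsub>G\<^esub> \<beta>) = \<alpha> \<otimes>\<^bsub>G\<^esub> \<beta>" "inv\<^bsub>G\<^esub> \<delta> \<otimes>\<^bsub>G\<^esub> (\<alpha> \<otimes>\<^bsub>G\<^esub> \<beta>) = ?\<alpha> \<otimes>\<^bsub>G\<^esub> \<beta>"
    using G \<delta> by (simp_all add: mult_inv_cancel G.inv_mult_group G.m_assoc)
  have \<alpha>\<beta>: "inv\<^bsub>G\<^esub> (?\<alpha> \<otimes>\<^bsub>G\<^esub> \<beta>) = inv\<^bsub>G\<^esub> \<beta> \<otimes>\<^bsub>G\<^esub> inv\<^bsub>G\<^esub> ?\<alpha>" "inv\<^bsub>G\<^esub> (\<alpha> \<otimes>\<^bsub>G\<^esub> \<beta>) = inv\<^bsub>G\<^esub> \<beta> \<otimes>\<^bsub>G\<^esub> inv\<^bsub>G\<^esub> ?\<alpha> \<otimes>\<^bsub>G\<^esub> inv\<^bsub>G\<^esub> \<delta>"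
    using G.inv_mult_group[OF \<alpha>(1) G(2)] G.inv_mult_group[OF G]
      G.m_assoc[of "inv\<^bsub>G\<^esub> \<beta>" "inv\<^bsub>G\<^esub> ?\<alpha>" "inv\<^bsub>G\<^esub> \<delta>"] \<alpha>(1,3) G \<delta> by auto
  let ?d = "comult_apply (inv\<^bsub>G\<^esub> (?\<alpha> \<otimes>\<^bsub>G\<^esub> \<beta>)) (inv\<^bsub>G\<^esub> \<delta>) f c"
  have d: "?d \<in> CI (?\<alpha> \<otimes>\<^bsub>G\<^esub> \<beta>)"
    by (rule comult_apply_inv[OF \<delta> _ f']) (use \<alpha> G c in simp_all)
  have "comult_apply (inv\<^bsub>G\<^esub> \<beta>) (inv\<^bsub>G\<^esub> ?\<alpha>) (q ?\<alpha>) ?d =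
      comult_apply (inv\<^bsub>G\<^esub> \<beta>) (inv\<^bsub>G\<^esub> ?\<alpha> \<otimes>\<^bsub>G\<^esub> inv\<^bsub>G\<^esub> \<delta>) ((single \<delta> f \<otimes>\<^bsub>R\<^esub> q) \<alpha>) c"
    unfolding \<alpha>\<beta>(1)
  proof (rule comult_apply_coassoc[OF _ _ _ f'])
    show "q ?\<alpha> \<in> functionals (inv\<^bsub>G\<^esub> ?\<alpha>)"
      by (rule component_functional[OF O_closed[OF q] \<alpha>(1)])
    show "c \<in> carrier (C (inv\<^bsub>G\<^esub> \<beta> \<otimes>\<^bsub>G\<^esub> inv\<^bsub>G\<^esub> ?\<alpha> \<otimes>\<^bsub>G\<^esub> inv\<^bsub>G\<^esub> \<delta>))"
      using c unfolding \<alpha>\<beta>(2) .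
    show "(single \<delta> f \<otimes>\<^bsub>R\<^esub> q) \<alpha> d = q ?\<alpha> (comult_apply (inv\<^bsub>G\<^esub> ?\<alpha>) (inv\<^bsub>G\<^esub> \<delta>) f d)"
      if "d \<in> carrier (C (inv\<^bsub>G\<^esub> ?\<alpha> \<otimes>\<^bsub>G\<^esub> inv\<^bsub>G\<^esub> \<delta>))" for d
      using that unfolding \<alpha>(3) by (rule single_mult_apply[OF \<delta> f O_closed[OF q] G(1)])
  qed (use G \<delta> \<alpha> in simp_all)
  then have "comult_apply (inv\<^bsub>G\<^esub> \<beta>) (inv\<^bsub>G\<^esub> \<alpha>) ((single \<delta> f \<otimes>\<^bsub>R\<^esub> q) \<alpha>) c =
      q (?\<alpha> \<otimes>\<^bsub>G\<^esub> \<beta>) ?d \<odot>\<^bsub>C (inv\<^bsub>G\<^esub> \<beta>)\<^esub> x (inv\<^bsub>G\<^esub> \<beta>)"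
    unfolding \<alpha>(3) using O_eq[OF q \<alpha>(1) G(2) d] by simp
  also have "q (?\<alpha> \<otimes>\<^bsub>G\<^esub> \<beta>) ?d = (single \<delta> f \<otimes>\<^bsub>R\<^esub> q) (\<alpha> \<otimes>\<^bsub>G\<^esub> \<beta>) c"
    using single_mult_apply[OF \<delta> f O_closed[OF q] _ c] G unfolding \<alpha>(5) by simp
  finally show "comult_apply (inv\<^bsub>G\<^esub> \<beta>) (inv\<^bsub>G\<^esub> \<alpha>) ((single \<delta> f \<otimes>\<^bsub>R\<^esub> q) \<alpha>) c =
      (single \<delta> f \<otimes>\<^bsub>R\<^esub> q) (\<alpha> \<otimes>\<^bsub>G\<^esub> \<beta>) c \<odot>\<^bsub>C (inv\<^bsub>G\<^esub> \<beta>)\<^esub> x (inv\<^bsub>G\<^esub> \<beta>)" .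
qed

lemma O_mult:
  assumes r: "r \<in> carrier R" and q: "q \<in> O_set"
  shows "r \<otimes>\<^bsub>R\<^esub> q \<in> O_set"
  using r
proof (induction r rule: dual_ring_induct)
  case (single \<alpha> f)
  then show ?case using q by (intro O_single_mult)
next
  case (add r s)
  then show ?case using q by (simp add: dual_l_distr O_closed O_plus)
qed

lemma O_rsmult:
  assumes q: "q \<in> O_set" and t: "t \<in> T_set"
  shows "dual_rsmult q t \<in> O_set"
  unfolding O_set_def
proof (intro CollectI conjI ballI dual_rsmult_closed O_closed T_closed q t)
  fix \<alpha> \<beta> c assume G: "\<alpha> \<in> carrier G" "\<beta> \<in> carrier G" and c: "c \<in> CI (\<alpha> \<otimes>\<^bsub>G\<^esub> \<beta>)"
  interpret bimodule A A "C (inv\<^bsub>G\<^esub> \<beta>)" by (rule bimodule_C) (use G in simp)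
  have "q (\<alpha> \<otimes>\<^bsub>G\<^esub> \<beta>) c \<in> carrier A"
    using G c by (intro component_closed O_closed q) auto
  then show "comult_apply (inv\<^bsub>G\<^esub> \<beta>) (inv\<^bsub>G\<^esub> \<alpha>) (dual_rsmult q t \<alpha>) c =
      dual_rsmult q t (\<alpha> \<otimes>\<^bsub>G\<^esub> \<beta>) c \<odot>\<^bsub>C (inv\<^bsub>G\<^esub> \<beta>)\<^esub> x (inv\<^bsub>G\<^esub> \<beta>)"
    using G c q t
    by (simp add: comult_apply_dual_rsmult O_closed T_closed O_eq dual_rsmult_apply lsmult_assoc
        bismult_assoc T_commutes grouplike_inv_closed)
qed

lemma O_zero: "\<zero>\<^bsub>R\<^esub> \<in> O_set"
  unfolding O_set_def
proof (intro CollectI conjI ballI dual_zero_closed)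
  fix \<alpha> \<beta> c assume G: "\<alpha> \<in> carrier G" "\<beta> \<in> carrier G" and c: "c \<in> CI (\<alpha> \<otimes>\<^bsub>G\<^esub> \<beta>)"
  interpret bimodule A A "C (inv\<^bsub>G\<^esub> \<beta>)" by (rule bimodule_C) (use G in simp)
  have "comult_apply (inv\<^bsub>G\<^esub> \<beta>) (inv\<^bsub>G\<^esub> \<alpha>) (\<zero>\<^bsub>R\<^esub> \<alpha>) c = \<zero>\<^bsub>C (inv\<^bsub>G\<^esub> \<beta>)\<^esub>"
    using G c by (intro comult_apply_zero) (simp_all add: dual_zero_ring_apply G.inv_mult_group)
  then show "comult_apply (inv\<^bsub>G\<^esub> \<beta>) (inv\<^bsub>G\<^esub> \<alpha>) (\<zero>\<^bsub>R\<^esub> \<alpha>) c =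
      \<zero>\<^bsub>R\<^esub> (\<alpha> \<otimes>\<^bsub>G\<^esub> \<beta>) c \<odot>\<^bsub>C (inv\<^bsub>G\<^esub> \<beta>)\<^esub> x (inv\<^bsub>G\<^esub> \<beta>)"
    using G c by (simp add: dual_zero_ring_apply zero_smult grouplike_inv_closed)
qed

lemma bimodule_O: "bimodule R T_ring (sub_bimodule O_set)"
proof -
  interpret R: ring R by (rule dual_ring_ring)
  have "\<exists>r\<in>O_set. r \<oplus>\<^bsub>R\<^esub> q = \<zero>\<^bsub>R\<^esub>" if q: "q \<in> O_set" for q
  proof (rule bexI)
    \<comment> \<open>Closure under the left action of \<open>R\<close> already provides the negatives, as \<open>(-1) # q\<close>.\<close>
    show "(\<ominus>\<^bsub>R\<^esub> \<one>\<^bsub>R\<^esub>) \<otimes>\<^bsub>R\<^esub> q \<in> O_set"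
      by (intro O_mult q) simp
    show "(\<ominus>\<^bsub>R\<^esub> \<one>\<^bsub>R\<^esub>) \<otimes>\<^bsub>R\<^esub> q \<oplus>\<^bsub>R\<^esub> q = \<zero>\<^bsub>R\<^esub>"
      using O_closed[OF q] by (simp add: R.l_minus R.l_neg)
  qed
  then have "abelian_group (sub_bimodule O_set)"
    by (intro abelian_groupI) (simp_all add: sub_bimodule_simps O_plus O_zero O_closed R.a_ac)
  then show ?thesis
    by (intro bimodule.intro left_module.intro right_module.intro left_module_axioms.intro
        right_module_axioms.intro bimodule_axioms.intro T_ring_ring dual_ring_ring)
      (simp_all add: sub_bimodule_simps T_ring_simps T_closed O_closed O_mult O_rsmult R.l_distr R.r_distr
        R.m_assoc dual_rsmult_plus_left dual_rsmult_plus_right dual_rsmult_assoc dual_rsmult_one dual_rsmult_mult)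
qed

lemma mult_single_apply:
  assumes q: "q \<in> carrier R" and \<beta>: "\<beta> \<in> carrier G" and f: "f \<in> dual_component \<beta>"
    and \<gamma>: "\<gamma> \<in> carrier G" and c: "c \<in> CI \<gamma>"
  shows "(q \<otimes>\<^bsub>R\<^esub> single \<beta> f) \<gamma> c =
    f (comult_apply (inv\<^bsub>G\<^esub> \<beta>) (inv\<^bsub>G\<^esub> (\<gamma> \<otimes>\<^bsub>G\<^esub> inv\<^bsub>G\<^esub> \<beta>)) (q (\<gamma> \<otimes>\<^bsub>G\<^esub> inv\<^bsub>G\<^esub> \<beta>)) c)"
proof -
  have "(q \<otimes>\<^bsub>R\<^esub> single \<beta> f) \<gamma> c = (\<Oplus>\<^bsub>A\<^esub>\<beta>'\<in>{\<beta>}. product_summand (\<gamma> \<otimes>\<^bsub>G\<^esub> inv\<^bsub>G\<^esub> \<beta>') \<beta>' q (single \<beta> f) c)"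
    by (rule dual_mult_apply_right[OF q single_closed[OF \<beta> f] \<gamma> c _ single_supp]) (use \<beta> in auto)
  also have "\<dots> = product_summand (\<gamma> \<otimes>\<^bsub>G\<^esub> inv\<^bsub>G\<^esub> \<beta>) \<beta> q (single \<beta> f) c"
    using product_summand_closed[OF q single_closed[OF \<beta> f] _ \<beta>, of "\<gamma> \<otimes>\<^bsub>G\<^esub> inv\<^bsub>G\<^esub> \<beta>" c] \<beta> \<gamma> c
    by (simp add: mult_inv_cancel)
  finally show ?thesis
    using \<beta> by (simp add: product_summand_def single_def)
qed

text \<open>For homogeneous \<open>r = f\<close> of degree \<open>\<beta>\<close> the relation defining \<open>O\<close> shows that the left hand side in degree
  \<open>\<gamma>\<close> evaluates \<open>f\<close> at \<open>q\<^sub>\<gamma>(c) x\<^bsub>\<beta>\<^sup>-\<^sup>1\<^esub> a\<close>, and left linearity of \<open>f\<close> moves \<open>q\<^sub>\<gamma>(c)\<close> out. This identity is at once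
  the right \<open>R\<close>-linearity of \<open>\<mu>\<close> and, with \<open>r\<close> in \<open>O\<close>, the law \<open>\<mu>(q \<otimes> a) r = q \<tau>(a \<otimes> r)\<close>.\<close>

lemma dual_rsmult_mult_O:
  assumes q: "q \<in> O_set" and a: "a \<in> carrier A" and r: "r \<in> carrier R"
  shows "dual_rsmult q a \<otimes>\<^bsub>R\<^esub> r = dual_rsmult q (grouplike_eval a r)"
  using r
proof (induction r rule: dual_ring_induct)
  case (add r s)
  then show ?case
    using q a by (simp add: dual_r_distr dual_rsmult_closed O_closed grouplike_eval_plus_right dual_rsmult_plus_right grouplike_eval_closed)
next
  case (single \<beta> f)
  note \<beta> = single(1) and f = single(2) and f' = dual_component_functional[OF single(2)] and q' = O_closed[OF q]
  interpret bimodule A A "C (inv\<^bsub>G\<^esub> \<beta>)" by (rule bimodule_C) (use \<beta> in simp)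
  show ?case
  proof (intro dual_eqI dual_mult_closed dual_rsmult_closed single_closed grouplike_eval_closed q' a \<beta> f)
    fix \<gamma> c assume \<gamma>: "\<gamma> \<in> carrier G" and c: "c \<in> CI \<gamma>"
    let ?\<alpha> = "\<gamma> \<otimes>\<^bsub>G\<^esub> inv\<^bsub>G\<^esub> \<beta>"
    have \<alpha>: "?\<alpha> \<in> carrier G" "?\<alpha> \<otimes>\<^bsub>G\<^esub> \<beta> = \<gamma>"
      using \<beta> \<gamma> by (simp_all add: mult_inv_cancel)
    have c': "c \<in> CI (?\<alpha> \<otimes>\<^bsub>G\<^esub> \<beta>)"
      using c unfolding \<alpha>(2) .
    have "(dual_rsmult q a \<otimes>\<^bsub>R\<^esub> single \<beta> f) \<gamma> c =
        f ((q \<gamma> c \<odot>\<^bsub>C (inv\<^bsub>G\<^esub> \<beta>)\<^esub> x (inv\<^bsub>G\<^esub> \<beta>)) \<triangleleft>\<^bsub>C (inv\<^bsub>G\<^esub> \<beta>)\<^esub> a)"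
      using mult_single_apply[OF dual_rsmult_closed[OF q' a] \<beta> f \<gamma> c]
        comult_apply_dual_rsmult[OF q' a \<alpha>(1) \<beta> c'] O_eq[OF q \<alpha>(1) \<beta> c'] \<alpha>(2)
      by simp
    also have "\<dots> = q \<gamma> c \<otimes>\<^bsub>A\<^esub> f (x (inv\<^bsub>G\<^esub> \<beta>) \<triangleleft>\<^bsub>C (inv\<^bsub>G\<^esub> \<beta>)\<^esub> a)"
      using component_closed[OF q' \<gamma> c] grouplike_inv_closed[OF \<beta>] a
      by (simp add: bismult_assoc functional_smult[OF f'] rsmult_closed)
    also have "\<dots> = dual_rsmult q (grouplike_eval a (single \<beta> f)) \<gamma> c"
      using \<gamma> c a \<beta> f by (simp add: dual_rsmult_apply grouplike_eval_single)
    finally show "(dual_rsmult q a \<otimes>\<^bsub>R\<^esub> single \<beta> f) \<gamma> c = dual_rsmult q (grouplike_eval a (single \<beta> f)) \<gamma> c" .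
  qed
qed

text \<open>The relation defining \<open>O\<close>, applied to \<open>x\<^bsub>\<beta>\<alpha>\<^sup>-\<^sup>1\<^esub> a\<close>, reads
  \<open>x\<^sub>\<beta> q\<^sub>\<alpha>(x\<^bsub>\<alpha>\<^sup>-\<^sup>1\<^esub> a) = q\<^bsub>\<alpha>\<beta>\<^sup>-\<^sup>1\<^esub>(x\<^bsub>\<beta>\<alpha>\<^sup>-\<^sup>1\<^esub> a) x\<^sub>\<beta>\<close>. Summation over \<open>\<alpha>\<close> gives the claim, because
  \<open>\<alpha> \<mapsto> \<alpha>\<beta>\<^sup>-\<^sup>1\<close> permutes \<open>G\<close>.\<close>

lemma grouplike_eval_O_in_T:
  assumes q: "q \<in> O_set" and a: "a \<in> carrier A"
  shows "grouplike_eval a q \<in> T_set"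
proof -
  note q' = O_closed[OF q]
  have "grouplike_eval a q \<odot>\<^bsub>C \<beta>\<^esub> x \<beta> = x \<beta> \<triangleleft>\<^bsub>C \<beta>\<^esub> grouplike_eval a q" if \<beta>: "\<beta> \<in> carrier G" for \<beta>
  proof -
    interpret bimodule A A "C \<beta>" by (rule bimodule_C) fact
    let ?v = "\<lambda>\<alpha>. q \<alpha> (x (inv\<^bsub>G\<^esub> \<alpha>) \<triangleleft>\<^bsub>C (inv\<^bsub>G\<^esub> \<alpha>)\<^esub> a)"
    \<comment> \<open>The index set is enlarged so that both \<open>F\<close> and its translate by \<open>\<beta>\<^sup>-\<^sup>1\<close> contain the support of \<open>q\<close>.\<close>
    define F where "F = dual_supp q \<union> (\<lambda>\<alpha>. \<alpha> \<otimes>\<^bsub>G\<^esub> \<beta>) ` dual_supp q"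
    have F: "finite F" "F \<subseteq> carrier G" "dual_supp q \<subseteq> F"
      using finite_supp[OF q'] \<beta> by (auto simp: F_def dest: supp_in)
    let ?F = "(\<lambda>\<alpha>. \<alpha> \<otimes>\<^bsub>G\<^esub> inv\<^bsub>G\<^esub> \<beta>) ` F"
    have "\<alpha> \<in> ?F" if "\<alpha> \<in> dual_supp q" for \<alpha>
    proof
      show "\<alpha> = (\<alpha> \<otimes>\<^bsub>G\<^esub> \<beta>) \<otimes>\<^bsub>G\<^esub> inv\<^bsub>G\<^esub> \<beta>"
        using supp_in[OF that] \<beta> by (simp add: mult_inv_cancel)
    qed (use that in \<open>auto simp: F_def\<close>)
    then have F': "finite ?F" "?F \<subseteq> carrier G" "dual_supp q \<subseteq> ?F"
      using F \<beta> by auto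
    have v_closed: "?v \<alpha> \<in> carrier A" if "\<alpha> \<in> carrier G" for \<alpha>
      by (rule grouplike_eval_summand_closed[OF a q' that])
    have inj: "inj_on (\<lambda>\<alpha>. \<alpha> \<otimes>\<^bsub>G\<^esub> inv\<^bsub>G\<^esub> \<beta>) F"
      using F(2) \<beta> by (auto simp: inj_on_def subset_iff)
    have shift: "x \<beta> \<triangleleft>\<^bsub>C \<beta>\<^esub> ?v \<alpha> = ?v (\<alpha> \<otimes>\<^bsub>G\<^esub> inv\<^bsub>G\<^esub> \<beta>) \<odot>\<^bsub>C \<beta>\<^esub> x \<beta>" if \<alpha>: "\<alpha> \<in> carrier G" for \<alpha>
    proof -
      let ?c = "x (\<beta> \<otimes>\<^bsub>G\<^esub> inv\<^bsub>G\<^esub> \<alpha>) \<triangleleft>\<^bsub>C (\<beta> \<otimes>\<^bsub>G\<^esub> inv\<^bsub>G\<^esub> \<alpha>)\<^esub> a"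
      have inv: "inv\<^bsub>G\<^esub> (\<alpha> \<otimes>\<^bsub>G\<^esub> inv\<^bsub>G\<^esub> \<beta>) = \<beta> \<otimes>\<^bsub>G\<^esub> inv\<^bsub>G\<^esub> \<alpha>"
        using \<alpha> \<beta> by (simp add: G.inv_mult_group)
      have c: "?c \<in> CI (\<alpha> \<otimes>\<^bsub>G\<^esub> inv\<^bsub>G\<^esub> \<beta>)"
        unfolding inv by (rule grouplike_rsmult_closed) (use \<alpha> \<beta> a in auto)
      have "comult_apply \<beta> (inv\<^bsub>G\<^esub> \<alpha>) (q \<alpha>) ?c = x \<beta> \<triangleleft>\<^bsub>C \<beta>\<^esub> ?v \<alpha>"
        using \<alpha> by (intro comult_apply_grouplike \<beta> component_functional q' a) auto
      moreover have "comult_apply \<beta> (inv\<^bsub>G\<^esub> \<alpha>) (q \<alpha>) ?c = q (\<alpha> \<otimes>\<^bsub>G\<^esub> inv\<^bsub>G\<^esub> \<beta>) ?c \<odot>\<^bsub>C \<beta>\<^esub> x \<beta>"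
        using O_eq[OF q \<alpha> G.inv_closed[OF \<beta>] c] \<beta> by simp
      ultimately show ?thesis
        by (simp add: inv)
    qed
    have "x \<beta> \<triangleleft>\<^bsub>C \<beta>\<^esub> grouplike_eval a q = (\<Oplus>\<^bsub>C \<beta>\<^esub>\<alpha>\<in>F. x \<beta> \<triangleleft>\<^bsub>C \<beta>\<^esub> ?v \<alpha>)"
      unfolding grouplike_eval_eq_sum[OF q' a F(1,3,2)]
      by (rule rsmult_finsum[OF F(1)]) (use F v_closed \<beta> grouplike_closed in auto)
    also have "\<dots> = (\<Oplus>\<^bsub>C \<beta>\<^esub>\<alpha>\<in>F. ?v (\<alpha> \<otimes>\<^bsub>G\<^esub> inv\<^bsub>G\<^esub> \<beta>) \<odot>\<^bsub>C \<beta>\<^esub> x \<beta>)"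
      using F(2) \<beta> by (intro M.finsum_cong'[OF refl] funcsetI lsmult_closed v_closed grouplike_closed shift) auto
    also have "\<dots> = (\<Oplus>\<^bsub>A\<^esub>\<alpha>\<in>F. ?v (\<alpha> \<otimes>\<^bsub>G\<^esub> inv\<^bsub>G\<^esub> \<beta>)) \<odot>\<^bsub>C \<beta>\<^esub> x \<beta>"
      using F(2) \<beta> by (intro finsum_smult[symmetric] F(1) funcsetI v_closed grouplike_closed) auto
    also have "(\<Oplus>\<^bsub>A\<^esub>\<alpha>\<in>F. ?v (\<alpha> \<otimes>\<^bsub>G\<^esub> inv\<^bsub>G\<^esub> \<beta>)) = (\<Oplus>\<^bsub>A\<^esub>\<alpha>\<in>?F. ?v \<alpha>)"
      by (rule A.finsum_reindex[symmetric, OF _ inj]) (use F'(2) v_closed in auto)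
    also have "\<dots> = grouplike_eval a q"
      by (rule grouplike_eval_eq_sum[OF q' a F'(1,3,2), symmetric])
    finally show ?thesis by simp
  qed
  then show ?thesis
    by (simp add: T_set_def grouplike_eval_closed a q')
qed

lemma balanced_\<tau>: "balanced_map R A_bimodule (sub_bimodule O_set) T_ring grouplike_eval"
  by (rule balanced_mapI) (simp_all add: A_bimodule_simps sub_bimodule_simps T_ring_simps O_closed
      grouplike_eval_O_in_T grouplike_eval_plus_left grouplike_eval_plus_right grouplike_eval_mult)

lemma balanced_\<mu>: "balanced_map T_ring (sub_bimodule O_set) A_bimodule R dual_rsmult"
  by (rule balanced_mapI) (simp_all add: A_bimodule_simps sub_bimodule_simps T_ring_simps O_closed T_closed
      dual_rsmult_closed dual_rsmult_plus_left dual_rsmult_plus_right dual_rsmult_assoc)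

lemma tensor_pair_\<tau>: "tensor_pair R A_bimodule (sub_bimodule O_set)"
  by (rule tensor_pairI[OF bimodule_A bimodule_O])

lemma tensor_pair_\<mu>: "tensor_pair T_ring (sub_bimodule O_set) A_bimodule"
  by (rule tensor_pairI[OF bimodule_O bimodule_A])

lemma \<tau>_pure: "\<lbrakk>a \<in> carrier A; q \<in> O_set\<rbrakk> \<Longrightarrow> \<tau> (pure_tensor R A_bimodule (sub_bimodule O_set) a q) = grouplike_eval a q"
  unfolding \<tau>_def
  by (rule tensor_pair.tensor_lift_pure[OF tensor_pair_\<tau> ring.is_abelian_group[OF T_ring_ring] balanced_\<tau>])
    (simp_all add: A_bimodule_simps sub_bimodule_simps)

lemma \<mu>_pure: "\<lbrakk>a \<in> carrier A; q \<in> O_set\<rbrakk> \<Longrightarrow>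
    \<mu> (pure_tensor T_ring (sub_bimodule O_set) A_bimodule q a) = dual_rsmult q a"
  unfolding \<mu>_def
  by (rule tensor_pair.tensor_lift_pure[OF tensor_pair_\<mu> ring.is_abelian_group[OF dual_ring_ring] balanced_\<mu>])
    (simp_all add: A_bimodule_simps sub_bimodule_simps)

lemma morita_context_M: "morita_context context_M"
proof -
  have "\<tau> \<in> bimodule_hom T_ring T_ring (tensor R A_bimodule (sub_bimodule O_set)) (regular_bimodule T_ring)"
    unfolding \<tau>_def
    by (rule tensor_lift_regular_hom[OF bimodule_A bimodule_O balanced_\<tau>])
      (simp_all add: A_bimodule_simps sub_bimodule_simps T_ring_simps O_closed T_closed grouplike_eval_T_smult grouplike_eval_dual_rsmult)
  moreover have "\<mu> \<in> bimodule_hom R R (tensor T_ring (sub_bimodule O_set) A_bimodule) (regular_bimodule R)"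
    unfolding \<mu>_def
    by (rule tensor_lift_regular_hom[OF bimodule_O bimodule_A balanced_\<mu>])
      (simp_all add: A_bimodule_simps sub_bimodule_simps O_closed dual_rsmult_mult dual_rsmult_mult_O)
  ultimately show ?thesis
    unfolding morita_context_def Let_def context_M_def
    using T_ring_ring dual_ring_ring bimodule_A bimodule_O
    by (simp add: A_bimodule_simps sub_bimodule_simps \<tau>_pure \<mu>_pure grouplike_eval_dual_rsmult O_closed dual_rsmult_mult_O)
qed

lemma functionals_separate:
  assumes fin: left_homogeneously_finite and \<alpha>: "\<alpha> \<in> carrier G"
    and c: "c \<in> carrier (C \<alpha>)" "d \<in> carrier (C \<alpha>)"
    and eq: "\<And>f. f \<in> dual_component (inv\<^bsub>G\<^esub> \<alpha>) \<Longrightarrow> f c = f d"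
  shows "c = d"
proof (rule left_projective_separating[OF _ c])
  show "left_projective A (C \<alpha>)"
    using fin \<alpha> by (simp add: left_homogeneously_finite_def)
  fix f assume "f \<in> functionals \<alpha>"
  then have "restrict f (carrier (C \<alpha>)) \<in> dual_component (inv\<^bsub>G\<^esub> \<alpha>)"
    using \<alpha> by (intro dual_componentI[where f = f]) simp_all
  from eq[OF this] show "f c = f d"
    using c by simp
qed

lemma T'_eq:
  assumes fin: left_homogeneously_finite
  shows "T'_set = T_set"
proof -
  have "a \<odot>\<^bsub>C \<alpha>\<^esub> x \<alpha> = x \<alpha> \<triangleleft>\<^bsub>C \<alpha>\<^esub> a"
    if a: "a \<in> T'_set" and \<alpha>: "\<alpha> \<in> carrier G" for a \<alpha>
  proof (rule functionals_separate[OF fin \<alpha>])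
    interpret bimodule A A "C \<alpha>" by (rule bimodule_C) fact
    have "a \<in> carrier A" using a by (simp add: T'_set_def)
    then show "a \<odot>\<^bsub>C \<alpha>\<^esub> x \<alpha> \<in> carrier (C \<alpha>)" "x \<alpha> \<triangleleft>\<^bsub>C \<alpha>\<^esub> a \<in> carrier (C \<alpha>)"
      using \<alpha> by (simp_all add: lsmult_closed rsmult_closed grouplike_closed)
  qed (use a \<alpha> in \<open>simp add: T'_set_def\<close>)
  then show ?thesis
    by (auto simp: T'_set_def T_set_def)
qed

lemma O'_eq:
  assumes fin: left_homogeneously_finite
  shows "O'_set = O_set"
proof -
  have "comult_apply (inv\<^bsub>G\<^esub> \<beta>) (inv\<^bsub>G\<^esub> \<alpha>) (q \<alpha>) c = q (\<alpha> \<otimes>\<^bsub>G\<^esub> \<beta>) c \<odot>\<^bsub>C (inv\<^bsub>G\<^esub> \<beta>)\<^esub> x (inv\<^bsub>G\<^esub> \<beta>)"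
    if q: "q \<in> O'_set" and G: "\<alpha> \<in> carrier G" "\<beta> \<in> carrier G" and c: "c \<in> CI (\<alpha> \<otimes>\<^bsub>G\<^esub> \<beta>)" for q \<alpha> \<beta> c
  proof (rule functionals_separate[OF fin, of "inv\<^bsub>G\<^esub> \<beta>"])
    interpret bimodule A A "C (inv\<^bsub>G\<^esub> \<beta>)" by (rule bimodule_C) (use G in simp)
    have q': "q \<in> carrier R" using q by (simp add: O'_set_def)
    show "comult_apply (inv\<^bsub>G\<^esub> \<beta>) (inv\<^bsub>G\<^esub> \<alpha>) (q \<alpha>) c \<in> CI \<beta>"
      by (intro comult_apply_inv component_functional q' G c)
    show "q (\<alpha> \<otimes>\<^bsub>G\<^esub> \<beta>) c \<odot>\<^bsub>C (inv\<^bsub>G\<^esub> \<beta>)\<^esub> x (inv\<^bsub>G\<^esub> \<beta>) \<in> CI \<beta>"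
      by (intro lsmult_closed component_closed q' G c G.m_closed grouplike_inv_closed)
    show "f (comult_apply (inv\<^bsub>G\<^esub> \<beta>) (inv\<^bsub>G\<^esub> \<alpha>) (q \<alpha>) c) = f (q (\<alpha> \<otimes>\<^bsub>G\<^esub> \<beta>) c \<odot>\<^bsub>C (inv\<^bsub>G\<^esub> \<beta>)\<^esub> x (inv\<^bsub>G\<^esub> \<beta>))"
      if "f \<in> dual_component (inv\<^bsub>G\<^esub> (inv\<^bsub>G\<^esub> \<beta>))" for f
      using q G c that by (simp add: O'_set_def)
  qed (use G in simp)
  then show ?thesis
    by (auto simp: O'_set_def O_set_def)
qed

lemma context_M'_eq: "left_homogeneously_finite \<Longrightarrow> context_M' = context_M"
  by (simp add: context_M'_def context_M_def T'_ring_def T_ring_def \<tau>'_def \<tau>_def T'_eq O'_eq)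

end

theorem proposition7p1:
  fixes G :: "'g monoid" and A :: "'a ring" and C :: "'g \<Rightarrow> ('a, 'a, 'c) bimodule"
    and \<Delta> :: "'g \<Rightarrow> 'g \<Rightarrow> 'c \<Rightarrow> ('c \<times> 'c \<Rightarrow>\<^sub>0 int) set" and \<epsilon> :: "'c \<Rightarrow> 'a" and x :: "'g \<Rightarrow> 'c"
  assumes "grouplike_coring G A C \<Delta> \<epsilon> x"
  shows
    "let M = grouplike_coring.context_M G A C \<Delta> \<epsilon> x;
         M' = grouplike_coring.context_M' G A C \<Delta> \<epsilon> x
     in morita_context M \<and>
        (\<forall>a\<in>carrier (modP M). \<forall>q\<in>carrier (modQ M).
           connPQ M (pure_tensor (ringR M) (modP M) (modQ M) a q) =
           (\<Oplus>\<^bsub>A\<^esub>\<alpha>\<in>group_coring.dual_supp G A C q.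
              q \<alpha> (x (inv\<^bsub>G\<^esub> \<alpha>) \<triangleleft>\<^bsub>C (inv\<^bsub>G\<^esub> \<alpha>)\<^esub> a))) \<and>
        (\<forall>q\<in>carrier (modQ M). \<forall>a\<in>carrier (modP M).
           connQP M (pure_tensor (ringS M) (modQ M) (modP M) q a) =
           group_coring.dual_rsmult G A C q a) \<and>
        (group_coring.left_homogeneously_finite G A C \<longrightarrow> morita_isomorphic M M')"
proof -
  interpret grouplike_coring G A C \<Delta> \<epsilon> x by fact
  have "connPQ context_M (pure_tensor (ringR context_M) (modP context_M) (modQ context_M) a q) =
      (\<Oplus>\<^bsub>A\<^esub>\<alpha>\<in>dual_supp q. q \<alpha> (x (inv\<^bsub>G\<^esub> \<alpha>) \<triangleleft>\<^bsub>C (inv\<^bsub>G\<^esub> \<alpha>)\<^esub> a))"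
    if "a \<in> carrier (modP context_M)" "q \<in> carrier (modQ context_M)" for a q
    using that \<tau>_pure[of a q]
    by (simp add: context_M_def A_bimodule_simps sub_bimodule_simps grouplike_eval_def)
  moreover have "connQP context_M (pure_tensor (ringS context_M) (modQ context_M) (modP context_M) q a) = dual_rsmult q a"
    if "q \<in> carrier (modQ context_M)" "a \<in> carrier (modP context_M)" for a q
    using that \<mu>_pure[of a q] by (simp add: context_M_def A_bimodule_simps sub_bimodule_simps)
  moreover have "left_homogeneously_finite \<Longrightarrow> morita_isomorphic context_M context_M'"
    using morita_isomorphic_refl[OF morita_context_M] context_M'_eq by simp
  ultimately show ?thesis
    unfolding Let_def using morita_context_M by blast
qed

end
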